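(* Let $d\ge1$, $a\equiv\mathrm{Id}$ and let $\tilde\theta:\mathbb{R}^d\to(0,\infty)$ be an arbitrary positive, continuous, $\mathbb{Z}^d$-periodic function with mean $\int_{\mathbb{T}^d}\tilde\theta=1$. There is a choice of almost periodic function $\theta^{\mathrm{stripe}}:\mathbb{R}\to\{1,2\}$, which is in $B^p(\mathbb{R})$ for any $p<\infty$, and a scale $\epsilon\mapsto\delta(\epsilon)>0$ satisfying $\epsilon^{-1}\delta(\epsilon)\to0$ as $\epsilon\to0$, such that if $\theta(y)=\theta^{\mathrm{stripe}}(y_1)\tilde\theta(y)$ for $y=(y_1,\dots,y_d)\in\mathbb{R}^d$, then, for any $\varrho>0$, $$\lim_{\epsilon\downarrow0}\varrho^{-(d-1)}\sigma_{\epsilon,\delta(\epsilon)}(e_1;[-\varrho/2,\varrho/2]^d)\le\sigma_W<\bar\sigma(e_1).$$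
   Context: Let $W:\mathbb{R}\to[0,\infty)$ be continuous with zeros precisely at $-1$ and $1$, and $\sigma_W=\int_{-1}^1\sqrt{2W(u)}\,du$. For $1\le p<\infty$, the Besicovitch space $B^p(\mathbb{R})$ is the completion of the algebra of trigonometric polynomials (arbitrary real frequencies) under $\|f\|_{B^p}=\big(\lim_{R\to\infty}\frac1{2R}\int_{-R}^R|f|^p\,dx\big)^{1/p}$; i.e. a (locally $L^p$) function $f$ is in $B^p(\mathbb{R})$ if for every $\eta>0$ there is a trigonometric polynomial $P$ with $\limsup_{R\to\infty}\frac1{2R}\int_{-R}^R|f-P|^p\,dx\le\eta$. For $\epsilon,\delta>0$ and $U\subseteq\mathbb{R}^d$, $$\mathscr{F}_{\epsilon,\delta}(u;U)=\int_U\Big(\frac\epsilon2|\nabla u|^2+\frac1\epsilon\theta(\delta^{-1}x)W(u)\Big)dx.$$ Fix an arbitrary smooth $q:\mathbb{R}\to[-1,1]$ with $q(\infty)=1$, $q(-\infty)=-1$. With $e_1=(1,0,\dots,0)$ and $Q=[-\varrho/2,\varrho/2]^d$, $$\sigma_{\epsilon,\delta}(e_1;Q)=\min\{\mathscr{F}_{\epsilon,\delta}(u;Q)\mid u\in H^1(Q),\ u(x)=q(\epsilon^{-1}x\cdot e_1)\text{ for }x\in\partial Q\}.$$ Finally $\bar\sigma(e_1)=\sigma_W\sqrt{\bar\theta}$ where $\bar\theta=\lim_{R\uparrow\infty}\frac1{(2R)^d}\int_{[-R,R]^d}\theta\,dx$ is the mean value of $\theta$.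
   Formalization: For d ≥ 2 the smooth function q fixing the boundary data is additionally assumed to have bounded derivative; for arbitrary smooth q the claim fails, since fast oscillation of q near infinity makes the energy blow up. *)

theory Defs
  imports "HOL-Analysis.Analysis"
begin

(* C-infinity: everywhere differentiable, and so are all iterated directional derivatives. *)
coinductive smooth :: "('a::real_normed_vector \<Rightarrow> real) \<Rightarrow> bool" where
  "\<lbrakk>\<And>x. f differentiable (at x); \<And>v. smooth (\<lambda>x. frechet_derivative f (at x) v)\<rbrakk> \<Longrightarrow> smooth f"

definition grad :: "(real^'n \<Rightarrow> real) \<Rightarrow> real^'n \<Rightarrow> real^'n" where
  "grad f x = (\<chi> i. frechet_derivative f (at x) (axis i 1))"

definition test_function :: "(real^'n) set \<Rightarrow> (real^'n \<Rightarrow> real) \<Rightarrow> bool" where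
  "test_function \<Omega> \<phi> \<longleftrightarrow> smooth \<phi> \<and> compact (closure {x. \<phi> x \<noteq> 0}) \<and> closure {x. \<phi> x \<noteq> 0} \<subseteq> \<Omega>"


subsection \<open>Sobolev functions\<close>

definition L2_on :: "(real^'n) set \<Rightarrow> (real^'n \<Rightarrow> 'b::euclidean_space) \<Rightarrow> bool" where
  "L2_on U f \<longleftrightarrow> f \<in> borel_measurable (lebesgue_on U) \<and> integrable (lebesgue_on U) (\<lambda>x. (norm (f x))\<^sup>2)"

(* H1 U u Du: u is in H^1(U), and Du is (a representative of) its weak gradient. U is meant to be
   a set such as a closed cube, whose boundary is a null set; weak derivatives are tested in the
   interior of U. *)
definition H1 :: "(real^'n) set \<Rightarrow> (real^'n \<Rightarrow> real) \<Rightarrow> (real^'n \<Rightarrow> real^'n) \<Rightarrow> bool" where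
  "H1 U u Du \<longleftrightarrow> L2_on U u \<and> L2_on U Du \<and>
     (\<forall>\<phi> i. test_function (interior U) \<phi> \<longrightarrow>
        (LINT x|lebesgue_on U. u x * grad \<phi> x $ i) = - (LINT x|lebesgue_on U. Du x $ i * \<phi> x))"

definition H1_0 :: "(real^'n) set \<Rightarrow> (real^'n \<Rightarrow> real) \<Rightarrow> (real^'n \<Rightarrow> real^'n) \<Rightarrow> bool" where
  "H1_0 U u Du \<longleftrightarrow> H1 U u Du \<and>
     (\<exists>\<phi>. (\<forall>m::nat. test_function (interior U) (\<phi> m)) \<and>
          (\<lambda>m. LINT x|lebesgue_on U. (u x - \<phi> m x)\<^sup>2) \<longlonglongrightarrow> 0 \<and>
          (\<lambda>m. LINT x|lebesgue_on U. (norm (Du x - grad (\<phi> m) x))\<^sup>2) \<longlonglongrightarrow> 0)"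

(* u = h on the boundary of U, in the usual sense for u in H^1(U) and h smooth up to the
   boundary: u - h is in H^1_0(U). *)
definition eq_on_boundary :: "(real^'n) set \<Rightarrow> (real^'n \<Rightarrow> real) \<Rightarrow> (real^'n \<Rightarrow> real) \<Rightarrow> bool" where
  "eq_on_boundary U u h \<longleftrightarrow> (\<exists>Dw. H1_0 U (\<lambda>x. u x - h x) Dw)"


subsection \<open>The energy and the cell problem\<close>

(* Du stands for the weak gradient of u. The value is infinite if the energy density is not integrable. *)
definition energy :: "real \<Rightarrow> real \<Rightarrow> (real^'n \<Rightarrow> real) \<Rightarrow> (real \<Rightarrow> real) \<Rightarrow>
    (real^'n) set \<Rightarrow> (real^'n \<Rightarrow> real) \<Rightarrow> (real^'n \<Rightarrow> real^'n) \<Rightarrow> ennreal" where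
  "energy \<epsilon> \<delta> \<theta> W U u Du =
     (\<integral>\<^sup>+ x. ennreal (\<epsilon> / 2 * (norm (Du x))\<^sup>2 + 1 / \<epsilon> * \<theta> (x /\<^sub>R \<delta>) * W (u x)) \<partial>lebesgue_on U)"

(* The least energy; written as an infimum, which is the minimum whenever a minimiser exists. *)
definition sigma_cell :: "(real \<Rightarrow> real) \<Rightarrow> (real \<Rightarrow> real) \<Rightarrow> (real^'n \<Rightarrow> real) \<Rightarrow>
    real \<Rightarrow> real \<Rightarrow> real^'n \<Rightarrow> (real^'n) set \<Rightarrow> ennreal" where
  "sigma_cell W q \<theta> \<epsilon> \<delta> e U =
     Inf {energy \<epsilon> \<delta> \<theta> W U u Du | u Du.
            H1 U u Du \<and> eq_on_boundary U u (\<lambda>x. q ((x \<bullet> e) / \<epsilon>))}"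

definition cube :: "real \<Rightarrow> (real^'n) set" where
  "cube \<rho> = cbox (vec (- \<rho> / 2)) (vec (\<rho> / 2))"

definition sigma_W :: "(real \<Rightarrow> real) \<Rightarrow> real" where
  "sigma_W W = integral {-1..1} (\<lambda>s. sqrt (2 * W s))"

definition has_mean_value :: "(real^'n \<Rightarrow> real) \<Rightarrow> real \<Rightarrow> bool" where
  "has_mean_value f m \<longleftrightarrow>
     ((\<lambda>R. (LINT x|lebesgue_on (cbox (vec (- R)) (vec R)). f x) / (2 * R) ^ CARD('n)) \<longlongrightarrow> m) at_top"

definition mean_value :: "(real^'n \<Rightarrow> real) \<Rightarrow> real" where
  "mean_value f = (THE m. has_mean_value f m)"

(* The effective surface tension; for an isotropic gradient term it does not depend on the direction. *)
definition sigma_bar :: "(real \<Rightarrow> real) \<Rightarrow> (real^'n \<Rightarrow> real) \<Rightarrow> real" where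
  "sigma_bar W \<theta> = sigma_W W * sqrt (mean_value \<theta>)"


subsection \<open>Besicovitch almost periodic functions\<close>

definition trig_poly :: "(real \<Rightarrow> complex) \<Rightarrow> bool" where
  "trig_poly P \<longleftrightarrow> (\<exists>\<Lambda> c. finite \<Lambda> \<and> P = (\<lambda>x. \<Sum>\<xi>\<in>\<Lambda>. c \<xi> * cis (\<xi> * x)))"

definition besicovitch :: "real \<Rightarrow> (real \<Rightarrow> complex) \<Rightarrow> bool" where
  "besicovitch p f \<longleftrightarrow>
     f \<in> borel_measurable lebesgue \<and>
     (\<forall>R. integrable (lebesgue_on {-R..R}) (\<lambda>x. cmod (f x) powr p)) \<and>
     (\<forall>\<eta>>0. \<exists>P. trig_poly P \<and>
        Limsup at_top (\<lambda>R. ereal ((LINT x|lebesgue_on {-R..R}. cmod (f x - P x) powr p) / (2 * R))) \<le> ereal \<eta>)"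


definition lattice_periodic :: "(real^'n \<Rightarrow> real) \<Rightarrow> bool" where
  "lattice_periodic f \<longleftrightarrow> (\<forall>x z. (\<forall>i. z $ i \<in> \<int>) \<longrightarrow> f (x + z) = f x)"

end

theory Submission
  imports Defs
begin

text \<open>
  The stripe pattern is \<open>1\<close> on a sparse sequence of ever longer windows and \<open>2\<close> elsewhere. The windows
  have density zero, so that in the Besicovitch sense the pattern is the constant \<open>2\<close> and \<open>\<theta>\<close> has mean \<open>2\<close>.
  However, a window is allowed to be a small fraction of its distance to the origin. Choosing \<open>\<delta> \<epsilon>\<close>
  suitably, there is a window that after rescaling lies at a distance \<open>r \<rightarrow> 0\<close> from the hyperplane \<open>x\<^sub>k = 0\<close> and
  is much longer than \<open>\<epsilon>\<close>. Placing the optimal transition there, one pays only for \<open>\<theta>'\<close>, whose mean is \<open>1\<close>;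
  the mismatch with the boundary values costs an amount proportional to \<open>r\<close>. This gives the bound \<open>\<sigma>\<^sub>W\<close>.

  For the limit to exist one needs the matching lower bound. Since the pattern is at least \<open>1\<close>, it can be
  replaced by \<open>1\<close>. As \<open>\<delta> \<epsilon>\<close> is much smaller than \<open>\<epsilon>\<^sup>2\<close>, the weight \<open>\<theta>'\<close> may be replaced by its mean, with an error
  controlled by the energy, and the Modica-Mortola inequality applies.
\<close>

subsection \<open>Smooth functions\<close>

text \<open>What fixes the size of \<open>\<delta>\<close> is the lower bound. Moving a competitor v
  by one period changes the potential part of the energy by about
  \<open>\<delta> / \<epsilon>\<close> times the integral of the norm of its gradient. Competitors
  come without an energy bound, so that integral is estimated by the gradient part of the energy
  plus a multiple of \<open>1 / \<epsilon>\<close>: the first share is absorbed, the second leaves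
  \<open>\<delta> / \<epsilon>\<^sup>2\<close>. The fourth power in \<open>window_start\<close>
  supplies the two powers of \<epsilon>, as the window index is at least
  \<open>1 / sqrt \<epsilon>\<close>. For the upper bound, with its explicit competitor,
  \<open>\<delta> / \<epsilon>\<close> \<rightarrow> 0 suffices. W is only continuous, so neither W
  nor \<open>sqrt (2 * W s)\<close> can be differentiated. From below W is replaced by a Lipschitz
  minorant; from above a smooth positive majorant of \<open>sqrt (2 * W s)\<close> on [-1, 1] drives
  an ordinary differential equation whose solution is the transition. Weak competitors are reduced
  to smooth ones by the density built into the boundary condition, so that no chain rule for Sobolev
  functions enters.\<close>

primrec Ck :: "nat \<Rightarrow> ('a::real_normed_vector \<Rightarrow> real) \<Rightarrow> bool" where
  "Ck 0 f \<longleftrightarrow> True"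
| "Ck (Suc n) f \<longleftrightarrow> (\<forall>x. f differentiable (at x)) \<and> (\<forall>v. Ck n (\<lambda>x. frechet_derivative f (at x) v))"

text \<open>Products and composites leave the shape of their factors when differentiated, which
  blocks a direct coinduction. With a finite order n the closure rules become inductions on n, and
  this equivalence carries them back to \<open>smooth\<close>.\<close>

lemma smooth_iff_Ck: "smooth f \<longleftrightarrow> (\<forall>n. Ck n f)"
proof
  have "smooth f \<Longrightarrow> Ck n f" for n
    by (induction n arbitrary: f) (auto elim: smooth.cases)
  then show "smooth f \<Longrightarrow> \<forall>n. Ck n f" by blast
next
  assume "\<forall>n. Ck n f"
  then show "smooth f"
  proof (coinduction arbitrary: f)
    case (smooth f)
    then have "Ck (Suc n) f" for n by blast
    then show ?case by auto
  qed
qed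

lemma CkI:
  assumes "\<And>x. (f has_derivative f' x) (at x)" "\<And>v. Ck n (\<lambda>x. f' x v)"
  shows "Ck (Suc n) f"
proof -
  have "frechet_derivative f (at x) = f' x" for x
    using frechet_derivative_at[OF assms(1)] by simp
  then show ?thesis using assms by (auto simp: differentiable_def)
qed

lemma Ck_has_derivative:
  "Ck (Suc n) f \<Longrightarrow> (f has_derivative frechet_derivative f (at x)) (at x)"
  by (simp add: frechet_derivative_works)

lemma Ck_Suc_imp: "Ck (Suc n) f \<Longrightarrow> Ck n f"
  by (induction n arbitrary: f) auto

lemma Ck_const: "Ck n (\<lambda>x. c)"
  by (induction n arbitrary: c) (auto intro!: CkI)

lemma Ck_bounded_linear: "bounded_linear f \<Longrightarrow> Ck n f"
proof (cases n)
  case (Suc m)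
  assume "bounded_linear f"
  then show ?thesis unfolding Suc
    by (intro CkI[where f' = "\<lambda>_. f"]) (auto intro: bounded_linear_imp_has_derivative Ck_const)
qed simp

lemma Ck_add: "Ck n f \<Longrightarrow> Ck n g \<Longrightarrow> Ck n (\<lambda>x. f x + g x)"
proof (induction n arbitrary: f g)
  case (Suc n)
  show ?case
    by (rule CkI[OF has_derivative_add[OF Ck_has_derivative[OF Suc.prems(1)] Ck_has_derivative[OF Suc.prems(2)]]])
      (use Suc in auto)
qed simp

lemma Ck_mult: "Ck n f \<Longrightarrow> Ck n g \<Longrightarrow> Ck n (\<lambda>x. f x * g x)"
proof (induction n arbitrary: f g)
  case (Suc n)
  note 1 = Suc.prems[THEN Ck_Suc_imp]
  show ?case
    by (rule CkI[OF has_derivative_mult[OF Ck_has_derivative[OF Suc.prems(1)] Ck_has_derivative[OF Suc.prems(2)]]])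
      (use Suc 1 in \<open>auto intro!: Ck_add\<close>)
qed simp

lemma frechet_derivative_real:
  fixes f :: "real \<Rightarrow> real"
  assumes "f differentiable (at x)"
  shows "frechet_derivative f (at x) v = deriv f x * v"
  by (metis assms DERIV_deriv_iff_real_differentiable frechet_derivative_at has_field_derivative_def)

lemma Ck_Suc_real:
  fixes f :: "real \<Rightarrow> real"
  shows "Ck (Suc n) f \<longleftrightarrow> (\<forall>x. f differentiable (at x)) \<and> Ck n (deriv f)"
proof (cases "\<forall>x. f differentiable (at x)")
  case True
  then have *: "(\<lambda>x. frechet_derivative f (at x) v) = (\<lambda>x. deriv f x * v)" for v
    by (auto simp: frechet_derivative_real)
  have "Ck n (deriv f) \<longleftrightarrow> (\<forall>v. Ck n (\<lambda>x. deriv f x * v))"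
    by (metis (no_types, lifting) Ck_const Ck_mult ext mult.right_neutral)
  with * show ?thesis by simp
qed auto

text \<open>The chain rule leaves \<open>deriv f\<close> composed with g, times a derivative of g.
  Both factors are controlled up to order n, and the induction has to let f and g vary.\<close>

lemma Ck_comp:
  fixes f :: "real \<Rightarrow> real"
  shows "Ck n f \<Longrightarrow> Ck n g \<Longrightarrow> Ck n (\<lambda>x. f (g x))"
proof (induction n arbitrary: f g)
  case (Suc n)
  have f: "(f has_derivative (\<lambda>h. deriv f y * h)) (at y)" for y
    using Suc.prems(1) DERIV_deriv_iff_real_differentiable[of f y] unfolding has_field_derivative_def by auto
  have 1: "Ck n g" "Ck n (deriv f)" using Suc.prems Ck_Suc_imp Ck_Suc_real by blast+
  show ?case
  proof (rule CkI)
    show "((\<lambda>x. f (g x)) has_derivative (\<lambda>v. deriv f (g x) * frechet_derivative g (at x) v)) (at x)" for x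
      by (rule has_derivative_compose[OF Ck_has_derivative[OF Suc.prems(2)] f])
    show "Ck n (\<lambda>x. deriv f (g x) * frechet_derivative g (at x) v)" for v
      using 1 Suc by (intro Ck_mult) auto
  qed
qed simp

text \<open>The derivative of \<open>inverse (f x)\<close> is a polynomial in
  \<open>inverse (f x)\<close> and a derivative of f, so the induction hypothesis applies to
  it.\<close>

lemma Ck_inverse:
  fixes f :: "'a::real_normed_vector \<Rightarrow> real"
  assumes "\<And>x. f x \<noteq> 0"
  shows "Ck n f \<Longrightarrow> Ck n (\<lambda>x. inverse (f x))"
proof (induction n)
  case (Suc n)
  have 1: "Ck n f" using Suc.prems Ck_Suc_imp by blast
  show ?case
  proof (rule CkI)
    show "((\<lambda>x. inverse (f x)) has_derivative
        (\<lambda>v. (- 1) * (inverse (f x) * frechet_derivative f (at x) v * inverse (f x)))) (at x)" for x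
      using Deriv.has_derivative_inverse[OF assms Ck_has_derivative[OF Suc.prems(1)]] by simp
    show "Ck n (\<lambda>x. (- 1) * (inverse (f x) * frechet_derivative f (at x) v * inverse (f x)))" for v
      using Suc 1 by (intro Ck_mult Ck_const) auto
  qed
qed simp

lemma smooth_const: "smooth (\<lambda>x. c)"
  and smooth_bounded_linear: "bounded_linear l \<Longrightarrow> smooth l"
  and smooth_add: "smooth f \<Longrightarrow> smooth g \<Longrightarrow> smooth (\<lambda>x. f x + g x)"
  and smooth_mult: "smooth f \<Longrightarrow> smooth g \<Longrightarrow> smooth (\<lambda>x. f x * g x)"
  and smooth_inverse: "smooth f \<Longrightarrow> (\<And>x. f x \<noteq> 0) \<Longrightarrow> smooth (\<lambda>x. inverse (f x))"
  by (auto simp: smooth_iff_Ck Ck_const Ck_bounded_linear Ck_add Ck_mult Ck_inverse)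

lemma smooth_comp:
  fixes f :: "real \<Rightarrow> real"
  shows "smooth f \<Longrightarrow> smooth g \<Longrightarrow> smooth (\<lambda>x. f (g x))"
  by (simp add: smooth_iff_Ck Ck_comp)

lemma smooth_diff: "smooth f \<Longrightarrow> smooth g \<Longrightarrow> smooth (\<lambda>x. f x - g x)"
  using smooth_add[of f "\<lambda>x. (-1) * g x"] smooth_mult[OF smooth_const[of "-1"], of g] by simp

lemma smooth_prod: "(\<And>i. i \<in> A \<Longrightarrow> smooth (f i)) \<Longrightarrow> smooth (\<lambda>x. \<Prod>i\<in>A. f i x)"
  by (induction A rule: infinite_finite_induct) (auto intro: smooth_const smooth_mult)

lemma smooth_differentiable: "smooth f \<Longrightarrow> f differentiable (at x)"
  by (auto elim: smooth.cases)

lemma smooth_continuous_on: "smooth f \<Longrightarrow> continuous_on A f"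
  by (meson continuous_at_imp_continuous_on differentiable_imp_continuous_within smooth_differentiable)

lemma smooth_frechet: "smooth f \<Longrightarrow> smooth (\<lambda>x. frechet_derivative f (at x) v)"
  by (auto elim: smooth.cases)

lemma smooth_deriv: "smooth f \<Longrightarrow> smooth (deriv f)" for f :: "real \<Rightarrow> real"
  by (metis Ck_Suc_real smooth_iff_Ck)

lemma smooth_DERIV: "smooth f \<Longrightarrow> (f has_real_derivative deriv f x) (at x)" for f :: "real \<Rightarrow> real"
  using DERIV_deriv_iff_real_differentiable smooth_differentiable by blast

lemma smooth_antiderivative:
  fixes f :: "real \<Rightarrow> real"
  assumes "smooth f" "\<And>x. (F has_real_derivative f x) (at x)"
  shows "smooth F"
  unfolding smooth_iff_Ck
proof
  fix n
  have "Ck (Suc n) F"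
    using assms unfolding Ck_Suc_real
    by (metis (no_types, lifting) DERIV_imp_deriv ext real_differentiable_def smooth_iff_Ck)
  then show "Ck n F" by (rule Ck_Suc_imp)
qed

lemma smooth_affine: "smooth (\<lambda>x::real. a * x + b)"
  by (intro smooth_add smooth_const smooth_bounded_linear bounded_linear_mult_right)

lemma smooth_scaled:
  fixes f :: "real \<Rightarrow> real"
  assumes "smooth f"
  shows "smooth (\<lambda>t. f ((t - r) / \<epsilon>))" "smooth (\<lambda>t. f (t / \<epsilon>))"
proof -
  have "smooth (\<lambda>t. f ((t - r) / \<epsilon>))" for r
    using smooth_comp[OF assms smooth_affine[of "1 / \<epsilon>" "- r / \<epsilon>"]] by (simp add: diff_divide_distrib)
  from this[of r] this[of 0] show "smooth (\<lambda>t. f ((t - r) / \<epsilon>))" "smooth (\<lambda>t. f (t / \<epsilon>))" by simp_all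
qed

lemma continuous_bounded_interval:
  fixes f :: "real \<Rightarrow> real"
  assumes "continuous_on {a..b} f"
  obtains B where "\<forall>t\<in>{a..b}. \<bar>f t\<bar> \<le> B"
proof -
  have "compact (f ` {a..b})" using assms by (rule compact_continuous_image) simp
  then show ?thesis using that by (auto dest!: compact_imp_bounded simp: bounded_iff)
qed

lemma lipschitz_const_nonneg:
  fixes w :: "real \<Rightarrow> real"
  assumes "\<And>s t. \<bar>w s - w t\<bar> \<le> L * \<bar>s - t\<bar>"
  shows "0 \<le> L"
  using assms[of 1 0] by (metis abs_ge_zero abs_one diff_zero mult.right_neutral order_trans)

text \<open>Used with \<open>\<delta> \<epsilon> / \<epsilon>\<^sup>2\<close> and with
  \<open>\<delta> \<epsilon> / \<epsilon>\<close>: each application lowers the power of \<epsilon>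
  in the denominator by one.\<close>

lemma tendsto_times_ident:
  fixes f :: "real \<Rightarrow> real"
  assumes "((\<lambda>\<epsilon>. f \<epsilon>) \<longlongrightarrow> 0) (at_right 0)" "\<And>\<epsilon>. \<epsilon> > 0 \<Longrightarrow> f \<epsilon> * \<epsilon> = g \<epsilon>"
  shows "(g \<longlongrightarrow> 0) (at_right 0)"
proof -
  have "((\<lambda>\<epsilon>. f \<epsilon> * \<epsilon>) \<longlongrightarrow> 0 * 0) (at_right 0)" by (intro tendsto_mult assms tendsto_ident_at)
  moreover have "\<forall>\<^sub>F \<epsilon> in at_right 0. f \<epsilon> * \<epsilon> = g \<epsilon>"
    by (rule eventually_at_right_less[THEN eventually_mono]) (rule assms)
  ultimately show ?thesis by (simp add: tendsto_cong)
qed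

lemma smooth_vec_nth: "smooth (\<lambda>x::real^'n. x $ i)"
  by (simp add: bounded_linear_vec_nth smooth_bounded_linear)

lemma smooth_real_polynomial: "real_polynomial_function p \<Longrightarrow> smooth p"
  by (induction rule: real_polynomial_function.induct)
    (auto intro: smooth_bounded_linear smooth_const smooth_add smooth_mult)

subsection \<open>Smooth step and cut-off functions\<close>

text \<open>The classical function exp (-1/x), extended by 0, is the case n = 0. The factor
  \<open>inverse x ^ n\<close> makes the family closed under differentiation, up to linear
  combinations.\<close>

definition flat :: "nat \<Rightarrow> real \<Rightarrow> real" where
  "flat n x = (if x > 0 then exp (- inverse x) * inverse x ^ n else 0)"

lemma flat_bound: "\<bar>flat n x\<bar> \<le> real (Suc n) ^ Suc n * \<bar>x\<bar>"
proof (cases "x > 0")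
  case False
  then have "flat n x = 0" by (simp only: flat_def if_False)
  then show ?thesis by (metis abs_ge_zero abs_zero mult_nonneg_nonneg of_nat_0_le_iff zero_le_power)
next
  case True
  define y where "y = inverse x"
  have y: "y > 0" using True by (simp add: y_def)
  \<comment> \<open>The inequality exp z \<ge> z at z = y / (n + 1), raised to the power n + 1. The
    power exceeds n by one in order to gain a factor x.\<close>
  have "y / real (Suc n) \<le> exp (y / real (Suc n))"
    using exp_ge_add_one_self[of "y / real (Suc n)"] by linarith
  then have "(y / real (Suc n)) ^ Suc n \<le> exp (y / real (Suc n)) ^ Suc n"
    using y by (intro power_mono) auto
  also have "\<dots> = exp y"
    by (simp add: exp_of_nat_mult[symmetric] del: of_nat_Suc power_Suc)
  finally have "y ^ Suc n \<le> real (Suc n) ^ Suc n * exp y"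
    by (simp add: power_divide divide_le_eq mult.commute del: of_nat_Suc power_Suc)
  then have "exp (- y) * y ^ Suc n \<le> exp (- y) * (real (Suc n) ^ Suc n * exp y)"
    by (intro mult_left_mono) auto
  also have "\<dots> = real (Suc n) ^ Suc n * (exp (- y) * exp y)" by (simp only: mult_ac)
  also have "\<dots> = real (Suc n) ^ Suc n"
    by (simp only: exp_minus_inverse mult.commute[of "exp (-y)"] mult_1_right)
  finally have "exp (- y) * y ^ n * y \<le> real (Suc n) ^ Suc n" by (simp only: power_Suc mult_ac)
  from mult_right_mono[OF this, of x] have "exp (- y) * y ^ n \<le> real (Suc n) ^ Suc n * x"
    using True by (simp add: mult.assoc y_def)
  then show ?thesis using True by (simp add: flat_def y_def)
qed

lemma flat_DERIV: "(flat n has_real_derivative flat (n + 2) x - n * flat (Suc n) x) (at x)"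
proof -
  consider "x > 0" | "x < 0" | "x = 0" by linarith
  then show ?thesis
  proof cases
    case 1
    have i: "(inverse has_real_derivative - (inverse x * inverse x)) (at x)"
      using DERIV_inverse[of x UNIV] 1 by (simp add: power2_eq_square)
    have "((\<lambda>x. exp (- inverse x) * inverse x ^ n) has_real_derivative
        exp (- inverse x) * - (- (inverse x * inverse x)) * inverse x ^ n +
        of_nat n * (- (inverse x * inverse x) * inverse x ^ (n - Suc 0)) * exp (- inverse x)) (at x)"
      by (rule DERIV_mult[OF DERIV_fun_exp[OF DERIV_minus[OF i]] DERIV_power[OF i]])
    also have "exp (- inverse x) * - (- (inverse x * inverse x)) * inverse x ^ n +
        of_nat n * (- (inverse x * inverse x) * inverse x ^ (n - Suc 0)) * exp (- inverse x) =
        flat (n + 2) x - n * flat (Suc n) x"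
      using 1 by (cases n) (simp_all add: flat_def algebra_simps)
    finally have "((\<lambda>x. exp (- inverse x) * inverse x ^ n) has_real_derivative
        flat (n + 2) x - n * flat (Suc n) x) (at x)" .
    then show ?thesis
      by (rule has_field_derivative_transform_within_open[where S = "{0<..}"]) (use 1 in \<open>auto simp: flat_def\<close>)
  next
    case 2
    have "((\<lambda>x. 0) has_real_derivative flat (n + 2) x - n * flat (Suc n) x) (at x)"
      using 2 by (auto simp: flat_def)
    then show ?thesis
      by (rule has_field_derivative_transform_within_open[where S = "{..<0}"]) (use 2 in \<open>auto simp: flat_def\<close>)
  next
    case 3
    \<comment> \<open>The difference quotient of \<open>flat n\<close> at 0 is
      \<open>flat (Suc n)\<close>, and the linear bound forces it to 0.\<close>
    have "(flat (Suc n) \<longlongrightarrow> 0) (at 0)"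
    proof (rule tendsto_rabs_zero_cancel, rule tendsto_sandwich[OF always_eventually always_eventually tendsto_const])
      show "\<forall>x. \<bar>flat (Suc n) x\<bar> \<le> real (Suc (Suc n)) ^ Suc (Suc n) * \<bar>x\<bar>"
        using flat_bound[of "Suc n"] by blast
      show "((\<lambda>x. real (Suc (Suc n)) ^ Suc (Suc n) * \<bar>x\<bar>) \<longlongrightarrow> 0) (at 0)"
        by (auto intro!: tendsto_eq_intros)
    qed auto
    moreover have "(\<lambda>y. (flat n y - flat n 0) / (y - 0)) = flat (Suc n)"
      by (auto simp: flat_def divide_inverse fun_eq_iff)
    ultimately have "(flat n has_real_derivative 0) (at 0)"
      unfolding has_field_derivative_iff by simp
    then show ?thesis by (simp add: 3 flat_def)
  qed
qed

lemma smooth_flat: "smooth (flat n)"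
  unfolding smooth_iff_Ck
proof
  fix m show "Ck m (flat n)"
  proof (induction m arbitrary: n)
    case (Suc m)
    have d: "deriv (flat n) = (\<lambda>x. flat (n + 2) x + (- real n) * flat (Suc n) x)"
      using flat_DERIV DERIV_imp_deriv by (fastforce simp: fun_eq_iff)
    have "\<forall>x. flat n differentiable (at x)"
      using flat_DERIV real_differentiable_def by blast
    then show ?case
      unfolding Ck_Suc_real d by (intro conjI Ck_add Ck_mult Ck_const Suc)
  qed simp
qed

text \<open>Transition from 0 on t \<le> 0 to 1 on t \<ge> 1. The denominator is positive because t
  and 1 - t are never both \<le> 0.\<close>

definition step :: "real \<Rightarrow> real" where
  "step t = flat 0 t * inverse (flat 0 t + flat 0 (1 - t))"

lemma flat_sum_pos: "flat 0 t + flat 0 (1 - t) > 0"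
  by (auto simp: flat_def add_pos_nonneg)

lemma smooth_step: "smooth step"
proof -
  have 1: "smooth (\<lambda>t. flat 0 (-1 * t + 1))" by (rule smooth_comp[OF smooth_flat smooth_affine])
  have "smooth (\<lambda>t. flat 0 t * inverse (flat 0 t + flat 0 (-1 * t + 1)))"
  proof (intro smooth_mult smooth_inverse smooth_add smooth_flat 1)
    show "flat 0 x + flat 0 (- 1 * x + 1) \<noteq> 0" for x
      using flat_sum_pos[of x] by simp
  qed
  moreover have "step = (\<lambda>t. flat 0 t * inverse (flat 0 t + flat 0 (-1 * t + 1)))"
    by (simp add: step_def fun_eq_iff)
  ultimately show ?thesis by metis
qed

lemma flat_0_nonneg: "flat 0 t \<ge> 0" by (simp add: flat_def)

lemma step_nonneg: "step t \<ge> 0"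
  unfolding step_def
  by (intro mult_nonneg_nonneg flat_0_nonneg) (metis flat_sum_pos inverse_nonnegative_iff_nonnegative less_imp_le)

lemma step_le_1: "step t \<le> 1"
proof -
  have "step t = flat 0 t / (flat 0 t + flat 0 (1 - t))" by (simp only: step_def divide_inverse)
  then show ?thesis using flat_sum_pos[of t] flat_0_nonneg[of "1 - t"] by (simp add: divide_le_eq_1)
qed

lemma step_0: "t \<le> 0 \<Longrightarrow> step t = 0"
  unfolding step_def by (simp only: flat_def not_less[symmetric] if_False mult_zero_left)

lemma step_1: "t \<ge> 1 \<Longrightarrow> step t = 1"
  by (auto simp only: step_def flat_def right_inverse exp_not_eq_zero power_0 mult_1_right split: if_splits) auto

text \<open>At these points \<open>step\<close> attains its global minimum or maximum, so the end
  points 0 and 1 are covered without one-sided limits.\<close>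

lemma deriv_step_0: "t \<le> 0 \<or> t \<ge> 1 \<Longrightarrow> deriv step t = 0"
proof (elim disjE)
  assume "t \<le> 0"
  then show ?thesis
    using DERIV_local_min[OF smooth_DERIV[OF smooth_step], of 1] by (simp add: step_0 step_nonneg)
next
  assume "t \<ge> 1"
  then show ?thesis
    using DERIV_local_max[OF smooth_DERIV[OF smooth_step], of 1] by (simp add: step_1 step_le_1)
qed

lemma deriv_step_bounded: obtains C where "C \<ge> 1" "\<And>t. \<bar>deriv step t\<bar> \<le> C"
proof -
  obtain B where B: "\<forall>t\<in>{0..1}. \<bar>deriv step t\<bar> \<le> B"
    using continuous_bounded_interval[OF smooth_continuous_on[OF smooth_deriv[OF smooth_step]]] by blast
  have "\<bar>deriv step t\<bar> \<le> max 1 B" for t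
    using B deriv_step_0[of t] by (cases "t \<in> {0..1}") (auto simp: le_max_iff_disj)
  then show ?thesis by (intro that[of "max 1 B"]) auto
qed

subsection \<open>Gradients and test functions\<close>

lemma mem_cube: "x \<in> cube \<rho> \<longleftrightarrow> (\<forall>i. \<bar>x $ i\<bar> \<le> \<rho> / 2)"
proof -
  have "\<bar>y\<bar> \<le> \<rho> / 2 \<longleftrightarrow> - \<rho> / 2 \<le> y \<and> y \<le> \<rho> / 2" for y :: real by arith
  then show ?thesis by (simp only: cube_def mem_box_cart vec_component)
qed

lemma mem_interior_cube: "x \<in> interior (cube \<rho>) \<longleftrightarrow> (\<forall>i. \<bar>x $ i\<bar> < \<rho> / 2)"
proof -
  have "\<bar>y\<bar> < \<rho> / 2 \<longleftrightarrow> - \<rho> / 2 < y \<and> y < \<rho> / 2" for y :: real by arith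
  then show ?thesis by (simp only: cube_def interior_cbox mem_box_cart vec_component)
qed

lemma frechet_eq_grad:
  fixes f :: "real^'n \<Rightarrow> real"
  assumes "f differentiable (at x)"
  shows "frechet_derivative f (at x) v = grad f x \<bullet> v"
proof -
  have l: "linear (frechet_derivative f (at x))"
    using assms linear_frechet_derivative by blast
  have "frechet_derivative f (at x) v = frechet_derivative f (at x) (\<Sum>i\<in>UNIV. v $ i *s axis i 1)"
    by (simp add: basis_expansion)
  also have "\<dots> = (\<Sum>i\<in>UNIV. v $ i * frechet_derivative f (at x) (axis i 1))"
    by (simp add: linear_sum[OF l] linear_scale[OF l] scalar_mult_eq_scaleR)
  also have "\<dots> = grad f x \<bullet> v"
    by (simp add: grad_def inner_vec_def mult.commute)
  finally show ?thesis .
qed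

lemma has_derivative_grad:
  fixes f :: "real^'n \<Rightarrow> real"
  assumes "f differentiable (at x)"
  shows "(f has_derivative (\<lambda>v. grad f x \<bullet> v)) (at x)"
proof -
  have "frechet_derivative f (at x) = (\<lambda>v. grad f x \<bullet> v)" by (rule ext) (rule frechet_eq_grad[OF assms])
  then show ?thesis using assms by (metis frechet_derivative_works)
qed

lemma grad_eqI: "(f has_derivative (\<lambda>v. D \<bullet> v)) (at x) \<Longrightarrow> grad f x = D"
  by (simp add: grad_def vec_eq_iff inner_axis frechet_derivative_at[of f "\<lambda>v. D \<bullet> v" x, symmetric])

lemma grad_add:
  fixes f g :: "real^'n \<Rightarrow> real"
  assumes "f differentiable (at x)" "g differentiable (at x)"
  shows "grad (\<lambda>x. f x + g x) x = grad f x + grad g x"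
  by (rule grad_eqI) (use has_derivative_add[OF assms[THEN has_derivative_grad]] in \<open>simp add: inner_add_left\<close>)

lemma grad_diff:
  fixes f g :: "real^'n \<Rightarrow> real"
  assumes "f differentiable (at x)" "g differentiable (at x)"
  shows "grad (\<lambda>x. f x - g x) x = grad f x - grad g x"
  by (rule grad_eqI) (use has_derivative_diff[OF assms[THEN has_derivative_grad]] in \<open>simp add: inner_diff_left\<close>)

lemma grad_mult:
  fixes f g :: "real^'n \<Rightarrow> real"
  assumes "f differentiable (at x)" "g differentiable (at x)"
  shows "grad (\<lambda>x. f x * g x) x = f x *\<^sub>R grad g x + g x *\<^sub>R grad f x"
  by (rule grad_eqI) (use has_derivative_mult[OF assms[THEN has_derivative_grad]] in \<open>simp add: inner_add_left mult.commute\<close>)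

lemma grad_comp:
  fixes f :: "real \<Rightarrow> real" and g :: "real^'n \<Rightarrow> real"
  assumes "(f has_real_derivative f') (at (g x))" "g differentiable (at x)"
  shows "grad (\<lambda>x. f (g x)) x = f' *\<^sub>R grad g x"
  by (rule grad_eqI)
    (use has_derivative_compose[OF has_derivative_grad[OF assms(2)] assms(1)[unfolded has_field_derivative_def]]
     in \<open>simp add: mult.commute\<close>)

lemma grad_coordinate:
  fixes f :: "real \<Rightarrow> real"
  assumes "(f has_real_derivative f') (at (x $ k))"
  shows "grad (\<lambda>x. f (x $ k)) x = f' *\<^sub>R axis k 1"
proof -
  have "grad (\<lambda>x. x $ k) x = axis k 1"
    by (rule grad_eqI) (simp add: inner_axis' bounded_linear_imp_has_derivative bounded_linear_vec_nth)
  then show ?thesis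
    using grad_comp[of f f' "\<lambda>x. x $ k" x] assms
    by (simp add: bounded_linear_imp_differentiable bounded_linear_vec_nth)
qed

lemma smooth_grad: "smooth f \<Longrightarrow> smooth (\<lambda>x. grad f x $ i)"
  by (simp add: grad_def smooth_frechet)

lemma continuous_on_grad: "smooth f \<Longrightarrow> continuous_on A (grad f)"
proof -
  assume "smooth f"
  then have "continuous_on A (\<lambda>x. \<chi> i. grad f x $ i)"
    by (intro continuous_on_vec_lambda smooth_continuous_on smooth_grad)
  then show ?thesis by simp
qed

lemma test_function_smooth: "test_function U \<phi> \<Longrightarrow> smooth \<phi>"
  by (simp add: test_function_def)

lemma compact_closure_subset:
  fixes K :: "'a::t2_space set"
  shows "compact K \<Longrightarrow> closure S \<subseteq> K \<Longrightarrow> compact (closure S)"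
  using compact_Int_closed[of K "closure S"] by (simp add: Int_absorb1)

lemma test_function_mult:
  assumes "smooth f" "test_function U \<phi>"
  shows "test_function U (\<lambda>x. f x * \<phi> x)"
proof -
  have "closure {x. f x * \<phi> x \<noteq> 0} \<subseteq> closure {x. \<phi> x \<noteq> 0}"
    by (intro closure_mono) auto
  moreover from this have "compact (closure {x. f x * \<phi> x \<noteq> 0})"
    using assms(2) unfolding test_function_def by (blast intro: compact_closure_subset)
  ultimately show ?thesis
    using assms by (auto simp: test_function_def smooth_mult)
qed

lemma test_function_add:
  assumes "test_function U f" "test_function U g"
  shows "test_function U (\<lambda>x. f x + g x)"
proof -
  have "closure {x. f x + g x \<noteq> 0} \<subseteq> closure ({x. f x \<noteq> 0} \<union> {x. g x \<noteq> 0})"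
    by (intro closure_mono) auto
  also have "\<dots> = closure {x. f x \<noteq> 0} \<union> closure {x. g x \<noteq> 0}"
    by (rule closure_Un)
  finally have c: "closure {x. f x + g x \<noteq> 0} \<subseteq> closure {x. f x \<noteq> 0} \<union> closure {x. g x \<noteq> 0}" .
  have "compact (closure {x. f x \<noteq> 0} \<union> closure {x. g x \<noteq> 0})"
    using assms by (auto simp: test_function_def)
  then have "compact (closure {x. f x + g x \<noteq> 0})"
    using c by (rule compact_closure_subset)
  then show ?thesis using c assms by (auto simp: test_function_def smooth_add)
qed

text \<open>Such a point lies in the open complement of the closed support, where the function is
  locally 0.\<close>

lemma test_function_grad_zero:
  assumes "test_function U \<phi>" "x \<notin> U"
  shows "\<phi> x = 0" "grad \<phi> x = 0"
proof -
  have x: "x \<in> - closure {x. \<phi> x \<noteq> 0}" using assms by (auto simp: test_function_def)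
  then show "\<phi> x = 0" using closure_subset[of "{x. \<phi> x \<noteq> 0}"] by auto
  have z: "y \<in> - closure {x. \<phi> x \<noteq> 0} \<Longrightarrow> \<phi> y = 0" for y using closure_subset[of "{x. \<phi> x \<noteq> 0}"] by auto
  show "grad \<phi> x = 0"
  proof (rule grad_eqI)
    have "((\<lambda>x. 0) has_derivative (\<lambda>v. 0 \<bullet> v)) (at x)" by simp
    then show "(\<phi> has_derivative (\<lambda>v. 0 \<bullet> v)) (at x)"
      by (rule has_derivative_transform_within_open[OF _ open_Compl[OF closed_closure] x z[symmetric]])
  qed
qed

text \<open>The shift by 1 keeps the support at distance \<tau> from the faces, so that this is a
  test function on the open cube; the value 1 is reached at distance 2 * \<tau>.\<close>

definition cutoff :: "real \<Rightarrow> real \<Rightarrow> real^'n \<Rightarrow> real" where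
  "cutoff \<rho> \<tau> x = (\<Prod>i\<in>UNIV. step ((\<rho> / 2 - x $ i) / \<tau> - 1) * step ((\<rho> / 2 + x $ i) / \<tau> - 1))"

lemma smooth_cutoff: "smooth (cutoff \<rho> \<tau> :: real^'n \<Rightarrow> real)"
proof -
  have 1: "smooth (\<lambda>x::real^'n. step (a * x $ i + b))" for a b i
    using smooth_comp[of "\<lambda>t. step (a * t + b)" "\<lambda>x::real^'n. x $ i"]
      smooth_comp[of step "\<lambda>t. a * t + b"] smooth_step smooth_affine smooth_vec_nth by blast
  have "smooth (\<lambda>x::real^'n. \<Prod>i\<in>UNIV. step ((- 1 / \<tau>) * x $ i + (\<rho> / 2 / \<tau> - 1)) *
      step ((1 / \<tau>) * x $ i + (\<rho> / 2 / \<tau> - 1)))"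
  proof (rule smooth_prod)
    fix i :: 'n
    show "smooth (\<lambda>x::real^'n. step ((- 1 / \<tau>) * x $ i + (\<rho> / 2 / \<tau> - 1)) *
      step ((1 / \<tau>) * x $ i + (\<rho> / 2 / \<tau> - 1)))"
      by (rule smooth_mult) (rule 1)+
  qed
  moreover have "(\<lambda>x::real^'n. \<Prod>i\<in>UNIV. step ((- 1 / \<tau>) * x $ i + (\<rho> / 2 / \<tau> - 1)) *
      step ((1 / \<tau>) * x $ i + (\<rho> / 2 / \<tau> - 1))) = cutoff \<rho> \<tau>"
  proof -
    have "- 1 / \<tau> * y + (\<rho> / 2 / \<tau> - 1) = (\<rho> / 2 - y) / \<tau> - 1"
      "1 / \<tau> * y + (\<rho> / 2 / \<tau> - 1) = (\<rho> / 2 + y) / \<tau> - 1" for y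
      by (simp_all add: diff_divide_distrib add_divide_distrib)
    then show ?thesis by (intro ext) (simp only: cutoff_def)
  qed
  ultimately show ?thesis by metis
qed

lemma cutoff_nonneg: "0 \<le> cutoff \<rho> \<tau> x"
  unfolding cutoff_def by (intro prod_nonneg) (simp add: step_nonneg)

lemma cutoff_le_1: "cutoff \<rho> \<tau> x \<le> 1"
  unfolding cutoff_def by (intro prod_le_1) (simp add: step_nonneg mult_le_one step_le_1)

lemma cutoff_support:
  fixes x :: "real^'n"
  assumes "\<tau> > 0" "cutoff \<rho> \<tau> x \<noteq> 0"
  shows "\<bar>x $ i\<bar> \<le> \<rho> / 2 - \<tau>"
proof -
  have "step ((\<rho> / 2 - x $ i) / \<tau> - 1) \<noteq> 0" "step ((\<rho> / 2 + x $ i) / \<tau> - 1) \<noteq> 0"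
    using assms(2) by (auto simp: cutoff_def)
  then have "(\<rho> / 2 - x $ i) / \<tau> - 1 > 0" "(\<rho> / 2 + x $ i) / \<tau> - 1 > 0"
    by (meson step_0 not_le)+
  then show ?thesis using assms(1) by (auto simp: field_simps)
qed

lemma cutoff_eq_1:
  assumes "\<tau> > 0" "\<And>i. \<bar>x $ i\<bar> \<le> \<rho> / 2 - 2 * \<tau>"
  shows "cutoff \<rho> \<tau> x = 1"
  unfolding cutoff_def
proof (intro prod.neutral ballI)
  fix i
  have "(\<rho> / 2 - x $ i) / \<tau> - 1 \<ge> 1" "(\<rho> / 2 + x $ i) / \<tau> - 1 \<ge> 1"
    using assms(1) assms(2)[of i] by (auto simp: field_simps)
  then show "step ((\<rho> / 2 - x $ i) / \<tau> - 1) * step ((\<rho> / 2 + x $ i) / \<tau> - 1) = 1"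
    by (simp add: step_1)
qed

lemma test_function_cutoff:
  assumes "\<tau> > 0"
  shows "test_function (interior (cube \<rho>)) (cutoff \<rho> \<tau> :: real^'n \<Rightarrow> real)"
proof -
  let ?K = "cube (\<rho> - 2 * \<tau>) :: (real^'n) set"
  have "{x. cutoff \<rho> \<tau> x \<noteq> 0} \<subseteq> ?K"
    using cutoff_support[OF assms] by (auto simp: mem_cube field_simps)
  then have 1: "closure {x. cutoff \<rho> \<tau> x \<noteq> 0} \<subseteq> ?K"
    by (intro closure_minimal) (auto simp: cube_def)
  have "compact ?K" by (simp add: cube_def compact_cbox)
  then have "compact (closure {x::real^'n. cutoff \<rho> \<tau> x \<noteq> 0})"
    using 1 by (rule compact_closure_subset)
  moreover have "?K \<subseteq> interior (cube \<rho>)"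
  proof
    fix x :: "real^'n" assume "x \<in> ?K"
    then have "\<bar>x $ i\<bar> \<le> (\<rho> - 2 * \<tau>) / 2" for i by (simp only: mem_cube)
    moreover have "(\<rho> - 2 * \<tau>) / 2 < \<rho> / 2" using assms by simp
    ultimately show "x \<in> interior (cube \<rho>)" unfolding mem_interior_cube by (meson le_less_trans)
  qed
  ultimately show ?thesis using 1 smooth_cutoff by (auto simp: test_function_def)
qed

text \<open>The value 1 is a maximum, so the gradient vanishes also where equality holds and the
  function is not constant nearby.\<close>

lemma grad_cutoff_zero:
  assumes "\<tau> > 0" "\<And>i. \<bar>x $ i\<bar> \<le> \<rho> / 2 - 2 * \<tau>"
  shows "grad (cutoff \<rho> \<tau>) x = (0 :: real^'n)"
proof -
  have "(\<lambda>v. grad (cutoff \<rho> \<tau>) x \<bullet> v) = (\<lambda>v. 0)"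
    by (rule differential_zero_maxmin[OF _ open_UNIV has_derivative_grad[OF smooth_differentiable[OF smooth_cutoff]]])
      (auto simp: cutoff_eq_1[OF assms] cutoff_le_1)
  then show ?thesis by (metis inner_eq_zero_iff)
qed

text \<open>One constant has to serve all \<rho> and \<tau>: the cut-off is later taken at width
  \<open>s * \<epsilon>\<close> with \<epsilon> \<rightarrow> 0.\<close>

lemma grad_cutoff_bound:
  obtains C where "\<And>\<rho> \<tau> x. \<tau> > 0 \<Longrightarrow> norm (grad (cutoff \<rho> \<tau>) x :: real^'n) \<le> C / \<tau>"
proof -
  obtain B where B: "B \<ge> 1" "\<And>t. \<bar>deriv step t\<bar> \<le> B" by (rule deriv_step_bounded) blast
  \<comment> \<open>There are \<open>CARD('n)\<close> components, each a sum of
    \<open>CARD('n)\<close> terms of the product rule of size at most \<open>2 * B / \<tau>\<close>;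
    the 2 counts the two steps in one coordinate.\<close>
  let ?C = "real CARD('n) * real CARD('n) * 2 * B"
  have "norm (grad (cutoff \<rho> \<tau>) x :: real^'n) \<le> ?C / \<tau>" if \<tau>: "\<tau> > 0" for \<rho> \<tau> x
  proof -
    define s where "s i y = step ((\<rho> / 2 - y $ i) / \<tau> - 1) * step ((\<rho> / 2 + y $ i) / \<tau> - 1)" for i and y :: "real^'n"
    define d where "d i v = (step ((\<rho> / 2 - x $ i) / \<tau> - 1) * (deriv step ((\<rho> / 2 + x $ i) / \<tau> - 1) * (v $ i / \<tau>))
        + deriv step ((\<rho> / 2 - x $ i) / \<tau> - 1) * (- v $ i / \<tau>) * step ((\<rho> / 2 + x $ i) / \<tau> - 1))"
      for i and v :: "real^'n"
    have st: "(step has_derivative (\<lambda>h. deriv step t * h)) (at t)" for t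
      using smooth_DERIV[OF smooth_step] by (simp add: has_field_derivative_def)
    have nth: "((\<lambda>y::real^'n. y $ i) has_derivative (\<lambda>v. v $ i)) (at x)" for i
      by (simp add: bounded_linear_imp_has_derivative bounded_linear_vec_nth)
    have l1: "((\<lambda>y::real^'n. (\<rho> / 2 - y $ i) / \<tau> - 1) has_derivative (\<lambda>v. - v $ i / \<tau>)) (at x)" for i
      using \<tau> by (auto intro!: derivative_eq_intros nth)
    have l2: "((\<lambda>y::real^'n. (\<rho> / 2 + y $ i) / \<tau> - 1) has_derivative (\<lambda>v. v $ i / \<tau>)) (at x)" for i
      using \<tau> by (auto intro!: derivative_eq_intros nth)
    have s: "(s i has_derivative d i) (at x)" for i
      unfolding s_def d_def
      by (rule has_derivative_mult[OF has_derivative_compose[OF l1 st] has_derivative_compose[OF l2 st]])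
    have hd: "((\<lambda>y. \<Prod>i\<in>UNIV. s i y) has_derivative (\<lambda>v. \<Sum>i\<in>UNIV. d i v * (\<Prod>j\<in>UNIV - {i}. s j x))) (at x)"
      by (rule has_derivative_prod) (rule s)
    have c: "(\<lambda>y. \<Prod>i\<in>UNIV. s i y) = cutoff \<rho> \<tau>"
      by (simp add: cutoff_def s_def fun_eq_iff)
    have fr: "frechet_derivative (cutoff \<rho> \<tau>) (at x) = (\<lambda>v. \<Sum>i\<in>UNIV. d i v * (\<Prod>j\<in>UNIV - {i}. s j x))"
      using frechet_derivative_at[OF hd] by (simp only: c)
    have s01: "0 \<le> s j x" "s j x \<le> 1" for j
      by (auto simp: s_def step_nonneg step_le_1 mult_le_one)
    have db: "\<bar>d i v\<bar> \<le> 2 * B * norm v / \<tau>" for i v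
    proof -
      have v: "\<bar>v $ i\<bar> / \<tau> \<le> norm v / \<tau>" using component_le_norm_cart[of v i] \<tau> by (simp add: divide_right_mono)
      have n0: "0 \<le> norm v / \<tau>" using \<tau> by simp
      have a1: "\<bar>step t * (deriv step t' * (v $ i / \<tau>))\<bar> \<le> 1 * (B * (norm v / \<tau>))" for t t'
        unfolding abs_mult using B v \<tau> by (intro mult_mono) (auto simp: step_le_1 step_nonneg)
      have a2: "\<bar>deriv step t * (- v $ i / \<tau>) * step t'\<bar> \<le> B * (norm v / \<tau>) * 1" for t t'
        unfolding abs_mult using B v \<tau> by (intro mult_mono) (auto simp: step_le_1 step_nonneg)
      have "\<bar>d i v\<bar> \<le> 1 * (B * (norm v / \<tau>)) + B * (norm v / \<tau>) * 1"
        unfolding d_def by (rule order_trans[OF abs_triangle_ineq add_mono[OF a1 a2]])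
      then show ?thesis by simp
    qed
    have fb: "\<bar>frechet_derivative (cutoff \<rho> \<tau>) (at x) v\<bar> \<le> real CARD('n) * (2 * B * norm v / \<tau>)" for v
    proof -
      have "\<bar>frechet_derivative (cutoff \<rho> \<tau>) (at x) v\<bar> \<le> (\<Sum>i\<in>UNIV. \<bar>d i v * (\<Prod>j\<in>UNIV - {i}. s j x)\<bar>)"
        unfolding fr by (rule sum_abs)
      also have "\<dots> \<le> (\<Sum>i\<in>(UNIV::'n set). 2 * B * norm v / \<tau> * 1)"
      proof (rule sum_mono)
        fix i
        have "\<bar>\<Prod>j\<in>UNIV - {i}. s j x\<bar> \<le> 1"
          using s01 by (simp add: prod_nonneg prod_le_1)
        then show "\<bar>d i v * (\<Prod>j\<in>UNIV - {i}. s j x)\<bar> \<le> 2 * B * norm v / \<tau> * 1"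
          unfolding abs_mult using db B \<tau> by (intro mult_mono) auto
      qed
      finally show ?thesis by simp
    qed
    have "norm (grad (cutoff \<rho> \<tau>) x) \<le> (\<Sum>i\<in>UNIV. \<bar>grad (cutoff \<rho> \<tau>) x $ i\<bar>)"
      by (rule norm_le_l1_cart)
    also have "\<dots> \<le> (\<Sum>i\<in>(UNIV::'n set). real CARD('n) * (2 * B * 1 / \<tau>))"
      using fb[of "axis _ 1"] by (intro sum_mono) (simp add: grad_def)
    finally show ?thesis by simp
  qed
  then show ?thesis by (rule that)
qed

subsection \<open>Integration\<close>

lemma integral_lebesgue_on_borel:
  fixes f :: "'a::euclidean_space \<Rightarrow> real"
  assumes "f \<in> borel_measurable borel" "S \<in> sets borel"
  shows "(LINT x|lebesgue_on S. f x) = (LINT x|lborel. indicator S x * f x)"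
proof -
  have "(LINT x|lebesgue_on S. f x) = (LINT x|lebesgue. indicator S x *\<^sub>R f x)"
    using assms(2) by (intro integral_restrict_space) (auto intro: sets_completionI_sets)
  also have "\<dots> = (LINT x|lborel. indicator S x *\<^sub>R f x)"
    using assms by (intro integral_completion) simp
  finally show ?thesis by simp
qed

lemma nn_integral_lebesgue_on_borel:
  fixes f :: "'a::euclidean_space \<Rightarrow> ennreal"
  assumes "f \<in> borel_measurable borel" "S \<in> sets borel"
  shows "(\<integral>\<^sup>+x. f x \<partial>lebesgue_on S) = (\<integral>\<^sup>+x. f x * indicator S x \<partial>lborel)"
proof -
  have "(\<integral>\<^sup>+x. f x \<partial>lebesgue_on S) = (\<integral>\<^sup>+x. f x * indicator S x \<partial>lebesgue)"
    using assms(2) by (intro nn_integral_restrict_space) (auto intro: sets_completionI_sets)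
  also have "\<dots> = (\<integral>\<^sup>+x. f x * indicator S x \<partial>lborel)"
    by (rule nn_integral_completion)
  finally show ?thesis .
qed

lemma nn_integral_lborel_translate:
  fixes f :: "'a::euclidean_space \<Rightarrow> ennreal"
  assumes [measurable]: "f \<in> borel_measurable borel"
  shows "(\<integral>\<^sup>+x. f (c + x) \<partial>lborel) = (\<integral>\<^sup>+x. f x \<partial>lborel)"
proof -
  have "(\<integral>\<^sup>+x. f x \<partial>lborel) = (\<integral>\<^sup>+x. f x \<partial>distr lborel borel ((+) c))"
    by (simp add: lborel_distr_plus)
  also have "\<dots> = (\<integral>\<^sup>+x. f (c + x) \<partial>lborel)"
    by (intro nn_integral_distr) simp_all
  finally show ?thesis by simp
qed

lemma integral_lborel_translate:
  fixes f :: "'a::euclidean_space \<Rightarrow> real"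
  assumes [measurable]: "f \<in> borel_measurable borel"
  shows "(LINT x|lborel. f (c + x)) = (LINT x|lborel. f x)"
proof -
  have "(LINT x|lborel. f x) = (LINT x|distr lborel borel ((+) c). f x)"
    by (simp add: lborel_distr_plus)
  also have "\<dots> = (LINT x|lborel. f (c + x))"
    by (intro integral_distr) simp_all
  finally show ?thesis by simp
qed

lemma integrable_lborel_translate:
  fixes f :: "'a::euclidean_space \<Rightarrow> real"
  assumes "integrable lborel f"
  shows "integrable lborel (\<lambda>x. f (c + x))"
proof -
  have "integrable (distr lborel borel ((+) c)) f" using assms by (simp add: lborel_distr_plus)
  then show ?thesis by (subst (asm) integrable_distr_eq) (use assms in auto)
qed

text \<open>The difference quotients have integral zero by translation invariance, so dominated convergence
  gives the claim without slicing.\<close>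
lemma integral_frechet_derivative_zero:
  fixes F :: "'a::euclidean_space \<Rightarrow> real"
  assumes diff: "\<And>x. F differentiable (at x)"
    and cont: "continuous_on UNIV (\<lambda>x. frechet_derivative F (at x) v)"
    and supp: "\<And>x. norm x \<ge> r \<Longrightarrow> F x = 0" "r > 0"
  shows "(LINT x|lborel. frechet_derivative F (at x) v) = 0"
proof -
  let ?D = "\<lambda>x. frechet_derivative F (at x) v"
  have contF: "continuous_on UNIV F"
    using diff by (simp add: continuous_at_imp_continuous_on differentiable_imp_continuous_within)
  have [measurable]: "F \<in> borel_measurable borel" "?D \<in> borel_measurable borel"
    using contF cont by (simp_all add: borel_measurable_continuous_onI)
  have "compact (?D ` cball 0 (r + norm v))"
    by (rule compact_continuous_image[OF continuous_on_subset[OF cont]]) auto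
  then obtain B where B: "\<forall>y\<in>cball 0 (r + norm v). \<bar>?D y\<bar> \<le> B"
    by (auto dest!: compact_imp_bounded simp: bounded_iff)
  have B0: "B \<ge> 0" using B supp(2) by (auto dest: bspec[where x = 0])
  have mvt: "\<exists>s. 0 < s \<and> s < t \<and> F (t *\<^sub>R v + x) - F x = t * ?D (x + s *\<^sub>R v)" if "t > 0" for t x
  proof -
    have d: "((\<lambda>s. F (x + s *\<^sub>R v)) has_derivative (\<lambda>h. h * ?D (x + s *\<^sub>R v))) (at s)" for s
    proof -
      have 1: "(F has_derivative frechet_derivative F (at (x + s *\<^sub>R v))) (at (x + s *\<^sub>R v))"
        using diff by (simp add: frechet_derivative_works)
      have 2: "((\<lambda>s. x + s *\<^sub>R v) has_derivative (\<lambda>h. h *\<^sub>R v)) (at s)"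
        by (auto intro!: derivative_eq_intros)
      have "linear (frechet_derivative F (at (x + s *\<^sub>R v)))"
        using diff by (rule linear_frechet_derivative)
      then show ?thesis using has_derivative_compose[OF 2 1] by (simp add: linear_scale)
    qed
    have "\<exists>s. 0 < s \<and> s < t \<and> F (x + t *\<^sub>R v) - F (x + 0 *\<^sub>R v) = (t - 0) * ?D (x + s *\<^sub>R v)"
      by (rule MVT2[OF that]) (use d in \<open>simp add: has_field_derivative_def mult_commute_abs\<close>)
    then show ?thesis by (simp add: add.commute)
  qed
  define s where "s m x = (F ((1 / real (Suc m)) *\<^sub>R v + x) - F x) * real (Suc m)" for m x
  \<comment> \<open>Steps of length at most \<open>norm v\<close> keep all quotients supported in
    one ball, which makes the dominating function integrable.\<close>
  have s_bound: "\<bar>s m x\<bar> \<le> B * indicator (cball 0 (r + norm v)) x" for m x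
  proof -
    have le: "norm ((1 / real (Suc m)) *\<^sub>R v) \<le> norm v"
      by (simp add: divide_le_eq mult_left_le_one_le mult.commute[of _ "real m"] algebra_simps)
    show ?thesis
    proof (cases "norm x > r + norm v")
      case True
      then have "norm ((1 / real (Suc m)) *\<^sub>R v + x) \<ge> r"
        using le norm_triangle_ineq2[of x "- ((1 / real (Suc m)) *\<^sub>R v)"] by (simp add: add.commute)
      moreover have "norm x \<ge> r" using True norm_ge_zero[of v] by linarith
      ultimately have "s m x = 0" by (simp only: s_def supp(1)) simp
      then show ?thesis using True by simp
    next
      case False
      obtain q where q: "0 < q" "q < 1 / real (Suc m)"
        "F ((1 / real (Suc m)) *\<^sub>R v + x) - F x = (1 / real (Suc m)) * ?D (x + q *\<^sub>R v)"
        using mvt[of "1 / real (Suc m)" x] by auto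
      have sq: "s m x = ?D (x + q *\<^sub>R v)"
        unfolding s_def q(3) by simp
      have "\<bar>?D (x + q *\<^sub>R v)\<bar> \<le> B"
      proof (cases "norm (x + q *\<^sub>R v) > r")
        case True
        have "(F has_derivative (\<lambda>v. 0)) (at (x + q *\<^sub>R v))"
          by (rule has_derivative_transform_within_open[OF has_derivative_const[of 0] open_Compl[OF closed_cball[of 0 r]]])
            (use True supp in auto)
        from frechet_derivative_at[OF this] have "?D (x + q *\<^sub>R v) = 0" by metis
        then show ?thesis using B0 by simp
      next
        case False
        then have "x + q *\<^sub>R v \<in> cball 0 (r + norm v)" unfolding mem_cball_0 using norm_ge_zero[of v] by linarith
        then show ?thesis using B by blast
      qed
      then show ?thesis using False sq by (simp add: indicator_def)
    qed
  qed
  \<comment> \<open>The mean value points converge to x along the direction v, so continuity of the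
    derivative gives the pointwise limit.\<close>
  have lim: "(\<lambda>m. s m x) \<longlonglongrightarrow> ?D x" for x
  proof -
    have "\<forall>m. \<exists>q. 0 < q \<and> q < 1 / real (Suc m) \<and> s m x = ?D (x + q *\<^sub>R v)"
    proof
      fix m
      obtain q where q: "0 < q" "q < 1 / real (Suc m)"
        "F ((1 / real (Suc m)) *\<^sub>R v + x) - F x = (1 / real (Suc m)) * ?D (x + q *\<^sub>R v)"
        using mvt[of "1 / real (Suc m)" x] by auto
      then show "\<exists>q. 0 < q \<and> q < 1 / real (Suc m) \<and> s m x = ?D (x + q *\<^sub>R v)"
        by (intro exI[of _ q]) (simp add: s_def)
    qed
    then obtain q where q: "\<And>m. 0 < q m" "\<And>m. q m < 1 / real (Suc m)" "\<And>m. s m x = ?D (x + q m *\<^sub>R v)"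
      by metis
    have "q \<longlonglongrightarrow> 0"
      by (rule tendsto_sandwich[OF _ _ tendsto_const LIMSEQ_Suc[OF lim_1_over_n]])
        (use q in \<open>auto intro!: always_eventually less_imp_le\<close>)
    then have "(\<lambda>m. x + q m *\<^sub>R v) \<longlonglongrightarrow> x + 0 *\<^sub>R v" by (intro tendsto_intros)
    then have "(\<lambda>m. ?D (x + q m *\<^sub>R v)) \<longlonglongrightarrow> ?D x"
      using continuous_on_tendsto_compose[OF cont] by simp
    then show ?thesis by (simp add: q(3))
  qed
  have intF: "integrable lborel F"
  proof -
    have "integrable lborel (\<lambda>x. indicator (cball 0 r) x *\<^sub>R F x)"
      by (rule borel_integrable_compact[OF compact_cball continuous_on_subset[OF contF]]) simp
    also have "(\<lambda>x. indicator (cball 0 r) x *\<^sub>R F x) = F"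
      using supp by (auto simp: fun_eq_iff indicator_def)
    finally show ?thesis .
  qed
  have "(\<lambda>m. LINT x|lborel. s m x) \<longlonglongrightarrow> (LINT x|lborel. ?D x)"
  proof (rule integral_dominated_convergence[where w = "\<lambda>x. B * indicator (cball 0 (r + norm v)) x"])
    show "integrable lborel (\<lambda>x. B * indicator (cball 0 (r + norm v)) x)"
      by (intro integrable_mult_right integrable_real_indicator) (simp_all add: emeasure_lborel_cball_finite[unfolded infinity_ennreal_def])
  qed (use s_bound lim in \<open>auto simp: s_def\<close>)
  moreover have "(LINT x|lborel. s m x) = 0" for m
  proof -
    have "(LINT x|lborel. s m x) = ((LINT x|lborel. F ((1 / real (Suc m)) *\<^sub>R v + x)) - (LINT x|lborel. F x)) * real (Suc m)"
      unfolding s_def using intF integrable_lborel_translate[OF intF] by simp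
    then show ?thesis by (simp add: integral_lborel_translate)
  qed
  ultimately show ?thesis by (simp add: LIMSEQ_const_iff)
qed

section \<open>Integrals over cubes of functions of one or two coordinates\<close>

lemma nn_integral_lborel_prod_cart:
  fixes f :: "'n::finite \<Rightarrow> real \<Rightarrow> ennreal"
  assumes "\<And>i. f i \<in> borel_measurable borel"
  shows "(\<integral>\<^sup>+x. (\<Prod>i\<in>UNIV. f i (x $ i)) \<partial>(lborel :: (real^'n) measure)) = (\<Prod>i\<in>UNIV. \<integral>\<^sup>+t. f i t \<partial>lborel)"
proof -
  \<comment> \<open>\<open>nn_integral_lborel_prod\<close> ranges over basis vectors;
    \<open>g\<close> translates such a vector back into its index.\<close>
  define g where "g b = f (THE i. b = axis i (1::real))" for b :: "real^'n"
  have g: "g (axis i 1) = f i" for i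
    by (simp add: g_def axis_eq_axis)
  have b: "(Basis :: (real^'n) set) = (\<lambda>i. axis i 1) ` UNIV"
    by (auto simp: Basis_vec_def)
  have inj: "inj_on (\<lambda>i. axis i (1::real)) (UNIV :: 'n set)"
    by (simp add: inj_on_def axis_eq_axis)
  have "(\<integral>\<^sup>+x. (\<Prod>b\<in>Basis. g b (x \<bullet> b)) \<partial>(lborel :: (real^'n) measure)) = (\<Prod>b\<in>Basis. \<integral>\<^sup>+t. g b t \<partial>lborel)"
    by (rule nn_integral_lborel_prod) (use assms g in \<open>auto simp: b\<close>)
  then show ?thesis
    by (simp add: b prod.reindex[OF inj] g inner_axis)
qed


lemma indicator_cube: "(indicator (cube \<rho>) x :: ennreal) = (\<Prod>i\<in>UNIV. indicator {- \<rho> / 2..\<rho> / 2} (x $ i))"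
proof (cases "x \<in> cube \<rho>")
  case True
  then have "x $ i \<in> {- \<rho> / 2..\<rho> / 2}" for i by (auto simp: mem_cube abs_le_iff dest: spec[of _ i])
  then show ?thesis using True by simp
next
  case False
  then obtain i where "\<not> \<bar>x $ i\<bar> \<le> \<rho> / 2" unfolding mem_cube by blast
  then have "x $ i \<notin> {- \<rho> / 2..\<rho> / 2}" by auto
  then have "indicator {- \<rho> / 2..\<rho> / 2} (x $ i) = (0::ennreal)" by simp
  then have "(\<Prod>i\<in>UNIV. indicator {- \<rho> / 2..\<rho> / 2} (x $ i)) = (0::ennreal)"
    by (intro prod_zero) auto
  then show ?thesis using False by simp
qed

lemma cube_borel [measurable]: "cube \<rho> \<in> sets borel"
  by (simp add: cube_def)

text \<open>Each of the remaining coordinates integrates to \<rho>: this is the origin of the factor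
  \<open>\<rho> ^ (CARD('n) - 1)\<close> in the surface tension.\<close>

lemma nn_integral_cube_coord:
  fixes g :: "real \<Rightarrow> ennreal" and k :: "'n::finite"
  assumes [measurable]: "g \<in> borel_measurable borel" and \<rho>: "\<rho> \<ge> 0"
  shows "(\<integral>\<^sup>+x. g (x $ k) * indicator (cube \<rho>) x \<partial>(lborel :: (real^'n) measure)) =
    ennreal \<rho> ^ (CARD('n) - 1) * (\<integral>\<^sup>+t. g t * indicator {- \<rho> / 2..\<rho> / 2} t \<partial>lborel)"
proof -
  define f where "f i t = (if i = k then g t else 1) * indicator {- \<rho> / 2..\<rho> / 2} t" for i :: 'n and t
  have [measurable]: "f j \<in> borel_measurable borel" for j
    unfolding f_def by (cases "j = k") auto
  have "g (x $ k) * indicator (cube \<rho>) x = (\<Prod>i\<in>UNIV. f i (x $ i))" for x :: "real^'n"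
    by (simp add: f_def prod.distrib indicator_cube prod.delta)
  then have "(\<integral>\<^sup>+x. g (x $ k) * indicator (cube \<rho>) x \<partial>(lborel :: (real^'n) measure)) =
    (\<Prod>i\<in>UNIV. \<integral>\<^sup>+t. f i t \<partial>lborel)"
    by (simp add: nn_integral_lborel_prod_cart)
  also have "\<dots> = (\<integral>\<^sup>+t. f k t \<partial>lborel) * (\<Prod>i\<in>UNIV - {k}. \<integral>\<^sup>+t. f i t \<partial>lborel)"
    by (rule prod.remove) auto
  also have "(\<Prod>i\<in>UNIV - {k}. \<integral>\<^sup>+t. f i t \<partial>lborel) = (\<Prod>i\<in>UNIV - {k}. ennreal \<rho>)"
    by (intro prod.cong) (use \<rho> in \<open>auto simp: f_def\<close>)
  finally show ?thesis by (simp add: f_def card_Diff_singleton mult.commute)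
qed

text \<open>For the layers along the lateral faces: one coordinate locates the transition, another
  the distance to the face. Two distinct indices give \<open>CARD('n) \<ge> 2\<close>, so the
  subtraction in the exponent is genuine.\<close>

lemma nn_integral_cube_coord2:
  fixes g h :: "real \<Rightarrow> ennreal" and k i :: "'n::finite"
  assumes [measurable]: "g \<in> borel_measurable borel" "h \<in> borel_measurable borel" and \<rho>: "\<rho> \<ge> 0" and ik: "i \<noteq> k"
  shows "(\<integral>\<^sup>+x. g (x $ k) * h (x $ i) * indicator (cube \<rho>) x \<partial>(lborel :: (real^'n) measure)) =
    ennreal \<rho> ^ (CARD('n) - 2) * (\<integral>\<^sup>+t. g t * indicator {- \<rho> / 2..\<rho> / 2} t \<partial>lborel) *
      (\<integral>\<^sup>+t. h t * indicator {- \<rho> / 2..\<rho> / 2} t \<partial>lborel)"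
proof -
  define f where "f j t = (if j = k then g t else 1) * (if j = i then h t else 1) * indicator {- \<rho> / 2..\<rho> / 2} t"
    for j :: 'n and t
  have [measurable]: "f j \<in> borel_measurable borel" for j
    unfolding f_def by (cases "j = k"; cases "j = i") auto
  have "g (x $ k) * h (x $ i) * indicator (cube \<rho>) x = (\<Prod>j\<in>UNIV. f j (x $ j))" for x :: "real^'n"
    by (simp add: f_def prod.distrib indicator_cube prod.delta)
  then have "(\<integral>\<^sup>+x. g (x $ k) * h (x $ i) * indicator (cube \<rho>) x \<partial>(lborel :: (real^'n) measure)) =
    (\<Prod>i\<in>UNIV. \<integral>\<^sup>+t. f i t \<partial>lborel)"
    by (simp add: nn_integral_lborel_prod_cart)
  also have "\<dots> = (\<integral>\<^sup>+t. f k t \<partial>lborel) * (\<Prod>i\<in>UNIV - {k}. \<integral>\<^sup>+t. f i t \<partial>lborel)"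
    by (rule prod.remove) auto
  also have "(\<Prod>i\<in>UNIV - {k}. \<integral>\<^sup>+t. f i t \<partial>lborel) =
      (\<integral>\<^sup>+t. f i t \<partial>lborel) * (\<Prod>i\<in>UNIV - {k} - {i}. \<integral>\<^sup>+t. f i t \<partial>lborel)"
    by (rule prod.remove) (use ik in auto)
  also have "(\<Prod>i\<in>UNIV - {k} - {i}. \<integral>\<^sup>+t. f i t \<partial>lborel) = (\<Prod>i\<in>UNIV - {k} - {i}. ennreal \<rho>)"
    by (intro prod.cong) (use \<rho> in \<open>auto simp: f_def\<close>)
  also have "\<dots> = ennreal \<rho> ^ (CARD('n) - 2)"
    using ik by (simp add: card_Diff_singleton numeral_2_eq_2)
  finally show ?thesis using ik by (simp add: f_def mult_ac)
qed

lemma emeasure_cube: "\<rho> \<ge> 0 \<Longrightarrow> emeasure lborel (cube \<rho> :: (real^'n) set) = ennreal (\<rho> ^ CARD('n))"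
proof -
  assume \<rho>: "\<rho> \<ge> 0"
  have "emeasure lborel (cube \<rho> :: (real^'n) set) = ennreal \<rho> ^ (CARD('n) - 1) * ennreal \<rho>"
    using nn_integral_cube_coord[of "\<lambda>_. 1" \<rho>] \<rho> by simp
  also have "\<dots> = ennreal (\<rho> ^ (CARD('n) - 1) * \<rho>)"
    using \<rho> by (simp add: ennreal_power ennreal_mult)
  also have "\<rho> ^ (CARD('n) - 1) * \<rho> = \<rho> ^ CARD('n)"
    by (metis Suc_pred' power_Suc2 zero_less_card_finite)
  finally show ?thesis .
qed

subsection \<open>Periodic weights\<close>

lemma emeasure_unit_cbox: "emeasure lborel (cbox 0 1 :: (real^'n) set) = 1"
proof -
  have "emeasure lborel (cbox 0 1 :: (real^'n) set) = (\<Prod>b\<in>(Basis :: (real^'n) set). (1 - 0) \<bullet> b)"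
    by (subst emeasure_lborel_cbox) (auto simp: Basis_vec_def inner_axis)
  also have "\<dots> = 1"
    by (auto simp: Basis_vec_def inner_axis intro!: prod.neutral)
  finally show ?thesis by simp
qed

locale periodic_weight =
  fixes \<theta> :: "real^'n \<Rightarrow> real" and \<Theta> :: real
  assumes cont: "continuous_on UNIV \<theta>"
    and pos: "\<And>y. \<theta> y > 0"
    and bound: "\<And>y. \<theta> y \<le> \<Theta>"
    and per: "lattice_periodic \<theta>"
    and mean: "(LINT y|lebesgue_on (cbox 0 1). \<theta> y) = 1"
begin

lemma measurable_weight [measurable]: "\<theta> \<in> borel_measurable borel"
  using cont by (rule borel_measurable_continuous_onI)

lemma bound_pos: "\<Theta> > 0"
  using pos[of 0] bound[of 0] by linarith

text \<open>Half-open, so that its integer translates tile the space and the exchange of slabs below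
  is an identity at every point, not only almost everywhere.\<close>

definition cell :: "(real^'n) set" where "cell = {z. \<forall>j. 0 \<le> z $ j \<and> z $ j < 1}"

lemma cell_borel [measurable]: "cell \<in> sets borel"
  unfolding cell_def by measurable

lemma emeasure_cell_le: "emeasure lborel cell \<le> 1"
proof -
  have "emeasure lborel cell \<le> emeasure lborel (cbox 0 1 :: (real^'n) set)"
    by (intro emeasure_mono) (auto simp: cell_def mem_box_cart less_imp_le)
  then show ?thesis by (simp add: emeasure_unit_cbox)
qed

text \<open>The mean is prescribed for the unit cube at the origin, whereas homogenization needs it
  for the cell placed at any point \<open>x /\<^sub>R \<delta>\<close>. Hence the dependence on y is
  studied.\<close>

definition avg :: "real^'n \<Rightarrow> ennreal" where
  "avg y = (\<integral>\<^sup>+x. ennreal (\<theta> x) * indicator cell (x - y) \<partial>lborel)"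

lemma avg_translate: "avg y = (\<integral>\<^sup>+x. ennreal (\<theta> (y + x)) * indicator cell x \<partial>lborel)"
  unfolding avg_def by (subst nn_integral_lborel_translate[symmetric, where c = y]) simp_all

lemma avg_finite: "avg y < top"
proof -
  have "avg y \<le> (\<integral>\<^sup>+x. ennreal \<Theta> * indicator cell x \<partial>lborel)"
    unfolding avg_translate by (intro nn_integral_mono mult_right_mono ennreal_leI bound) simp
  also have "\<dots> = ennreal \<Theta> * emeasure lborel cell" by (simp add: nn_integral_cmult_indicator)
  also have "\<dots> \<le> ennreal \<Theta> * 1" by (intro mult_left_mono emeasure_cell_le) simp
  finally show ?thesis by (auto intro: le_less_trans)
qed

lemma avg_period: "(\<And>i. m $ i \<in> \<int>) \<Longrightarrow> avg (y + m) = avg y"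
proof -
  assume "\<And>i. m $ i \<in> \<int>"
  then have "\<theta> (y + x + m) = \<theta> (y + x)" for x
    using per by (simp add: lattice_periodic_def)
  moreover have "y + m + x = y + x + m" for x by (simp add: add_ac)
  ultimately show ?thesis unfolding avg_translate by (simp only:)
qed

text \<open>Moving the unit cell by \<open>t\<close> in one direction trades the slab in front for its
  translate by one period.\<close>
lemma avg_shift_coord:
  assumes t: "0 \<le> t" "t \<le> 1"
  shows "avg (y + t *\<^sub>R axis i 1) = avg y"
proof -
  let ?e = "axis i 1 :: real^'n"
  define slab where "slab = {z \<in> cell. z $ i < t}"
  have [measurable]: "slab \<in> sets borel"
    unfolding slab_def cell_def by measurable
  define K where "K = (\<integral>\<^sup>+x. ennreal (\<theta> x) * indicator slab (x - y) \<partial>lborel)"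
  have e: "?e $ j = (if j = i then 1 else 0)" for j by (simp add: axis_def)
  \<comment> \<open>As sets of z = x - y: the moved cell together with the slab that it left behind
    is the old cell together with that slab moved by one period.\<close>
  have id: "(indicator cell (x - (y + t *\<^sub>R ?e)) + indicator slab (x - y) :: ennreal) =
      indicator cell (x - y) + indicator slab (x - y - ?e)" for x
  proof -
    define z where "z = x - y"
    have z: "x - (y + t *\<^sub>R ?e) = z - t *\<^sub>R ?e" "x - y - ?e = z - ?e" "x - y = z" by (auto simp: z_def)
    show ?thesis
    proof (cases "\<forall>j. j \<noteq> i \<longrightarrow> 0 \<le> z $ j \<and> z $ j < 1")
      case True
      have c: "w \<in> cell \<longleftrightarrow> 0 \<le> w $ i \<and> w $ i < 1" if "\<And>j. j \<noteq> i \<Longrightarrow> w $ j = z $ j" for w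
        unfolding cell_def using True that by (auto, metis, metis)
      have "z - t *\<^sub>R ?e \<in> cell \<longleftrightarrow> t \<le> z $ i \<and> z $ i < 1 + t"
        by (subst c) (auto simp: e)
      moreover have "z \<in> cell \<longleftrightarrow> 0 \<le> z $ i \<and> z $ i < 1"
        by (subst c) auto
      moreover have "z - ?e \<in> cell \<longleftrightarrow> 1 \<le> z $ i \<and> z $ i < 2"
        by (subst c) (auto simp: e)
      ultimately show ?thesis unfolding z slab_def using t by (auto simp: indicator_def e)
    next
      case False
      then obtain j where j: "j \<noteq> i" "\<not> (0 \<le> z $ j \<and> z $ j < 1)" by blast
      have "w \<notin> cell" if "w $ j = z $ j" for w
        using j that unfolding cell_def by (metis (mono_tags, lifting) mem_Collect_eq)
      then have "z - t *\<^sub>R ?e \<notin> cell" "z \<notin> cell" "z - ?e \<notin> cell"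
        using j(1) by (auto simp: e)
      then show ?thesis unfolding z by (simp add: slab_def)
    qed
  qed
  have "avg (y + t *\<^sub>R ?e) + K =
      (\<integral>\<^sup>+x. ennreal (\<theta> x) * (indicator cell (x - (y + t *\<^sub>R ?e)) + indicator slab (x - y)) \<partial>lborel)"
    unfolding avg_def K_def distrib_left by (rule nn_integral_add[symmetric]) measurable
  also have "\<dots> = (\<integral>\<^sup>+x. ennreal (\<theta> x) * indicator cell (x - y) + ennreal (\<theta> x) * indicator slab (x - y - ?e) \<partial>lborel)"
    by (simp add: id distrib_left)
  also have "\<dots> = avg y + (\<integral>\<^sup>+x. ennreal (\<theta> x) * indicator slab (x - y - ?e) \<partial>lborel)"
    unfolding avg_def by (rule nn_integral_add) measurable
  also have "(\<integral>\<^sup>+x. ennreal (\<theta> x) * indicator slab (x - y - ?e) \<partial>lborel) = K"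
  proof -
    have "(\<integral>\<^sup>+x. ennreal (\<theta> x) * indicator slab (x - y - ?e) \<partial>lborel) =
        (\<integral>\<^sup>+x. ennreal (\<theta> (?e + x)) * indicator slab (?e + x - y - ?e) \<partial>lborel)"
      by (rule nn_integral_lborel_translate[symmetric]) measurable
    also have "\<dots> = K"
    proof -
      have "\<theta> (?e + x) = \<theta> x" for x
        using per unfolding lattice_periodic_def by (subst add.commute) (simp add: e)
      then show ?thesis by (simp add: K_def algebra_simps)
    qed
    finally show ?thesis .
  qed
  finally have "avg (y + t *\<^sub>R ?e) + K = avg y + K" .
  \<comment> \<open>Cancelling K in \<open>ennreal\<close> requires that K is finite.\<close>
  moreover have "K \<le> avg y"
    unfolding K_def avg_def slab_def by (intro nn_integral_mono mult_left_mono) (auto simp: indicator_def)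
  ultimately show ?thesis
    using avg_finite[of y] by (metis ennreal_add_left_cancel add.commute le_less_trans less_irrefl infinity_ennreal_def)
qed

text \<open>Each coordinate of y is split into integer and fractional part: periodicity removes the
  first, \<open>avg_shift_coord\<close> the second.\<close>

lemma avg_const: "avg y = avg 0"
proof -
  have 1: "avg (y + t *\<^sub>R axis i 1) = avg y" for y t i
  proof -
    have "y + t *\<^sub>R axis i 1 = (y + frac t *\<^sub>R axis i 1) + of_int \<lfloor>t\<rfloor> *\<^sub>R axis i 1"
      by (simp add: frac_def algebra_simps)
    also have "avg \<dots> = avg (y + frac t *\<^sub>R axis i 1)"
      by (rule avg_period) (auto simp: axis_def)
    also have "\<dots> = avg y"
      by (rule avg_shift_coord) (simp_all add: frac_ge_0 frac_lt_1 less_imp_le)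
    finally show ?thesis .
  qed
  have "avg (\<Sum>i\<in>A. y $ i *\<^sub>R axis i 1) = avg 0" if "finite A" for A
    using that
  proof (induction A)
    case (insert i A)
    then show ?case using 1[of "\<Sum>i\<in>A. y $ i *\<^sub>R axis i 1" "y $ i" i] by (simp add: add.commute)
  qed simp
  from this[of UNIV] show ?thesis
    by (simp add: basis_expansion scalar_mult_eq_scaleR[symmetric])
qed

lemma avg_eq_1: "avg y = 1"
proof -
  have int: "integrable lborel (\<lambda>x. indicator (cbox 0 1) x *\<^sub>R \<theta> x)"
    by (rule borel_integrable_compact[OF compact_cbox continuous_on_subset[OF cont]]) simp
  have 1: "(\<integral>\<^sup>+x. ennreal (indicator (cbox 0 1) x * \<theta> x) \<partial>lborel) = 1"
    using nn_integral_eq_integral[OF int] mean integral_lebesgue_on_borel[of \<theta> "cbox 0 1"] pos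
    by (simp add: less_imp_le)
  \<comment> \<open>The mean is prescribed on the closed cube, which differs from the half-open cell
    by a part of the boundary.\<close>
  have "negligible (cbox 0 1 - box 0 1 :: (real^'n) set)" by (rule negligible_frontier_interval)
  then have "cbox 0 1 - box 0 1 \<in> null_sets (lborel :: (real^'n) measure)"
    by (simp add: negligible_iff_null_sets null_sets_completion_iff)
  then have ae: "AE x::real^'n in lborel. x \<notin> cbox 0 1 - box 0 1"
    by (rule AE_not_in)
  have "avg 0 = (\<integral>\<^sup>+x. ennreal (indicator (cbox 0 1) x * \<theta> x) \<partial>lborel)"
    unfolding avg_translate
  proof (rule nn_integral_cong_AE)
    show "AE x in lborel. ennreal (\<theta> (0 + x)) * indicator cell x = ennreal (indicator (cbox 0 1) x * \<theta> x)"
      using ae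
    proof eventually_elim
      case (elim x)
      then have "x \<in> cell \<longleftrightarrow> x \<in> cbox 0 1"
        by (auto simp: cell_def mem_box_cart less_imp_le)
      then show ?case by (simp add: indicator_def)
    qed
  qed
  with 1 show ?thesis by (simp add: avg_const[of y])
qed

lemma nn_integral_cell: "(\<integral>\<^sup>+z. ennreal (\<theta> (y + z)) * indicator cell z \<partial>lborel) = 1"
  using avg_eq_1[of y] avg_translate by simp

lemma emeasure_cell: "emeasure lborel cell = 1"
proof -
  \<comment> \<open>The constant weight 1 is itself an instance of the locale, so the measure of the
    cell is read off from the result just proved.\<close>
  interpret one: periodic_weight "\<lambda>_. 1" 1
    by unfold_locales (auto simp: lattice_periodic_def emeasure_restrict_space measure_def emeasure_unit_cbox)
  show ?thesis using one.nn_integral_cell by (simp add: one.cell_def cell_def)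
qed

text \<open>Averaging over all translates of the fast variable: replacing the weight by its mean costs at
  most the oscillation of \<open>\<psi>\<close> under translations by less than one period.\<close>
lemma homogenization_estimate:
  fixes \<psi> :: "real^'n \<Rightarrow> real"
  assumes [measurable]: "\<psi> \<in> borel_measurable borel" and nonneg: "\<And>x. \<psi> x \<ge> 0" and \<delta>: "\<delta> > 0"
    and osc: "\<And>z. z \<in> cell \<Longrightarrow> (\<integral>\<^sup>+x. ennreal \<bar>\<psi> (x - \<delta> *\<^sub>R z) - \<psi> x\<bar> \<partial>lborel) \<le> c"
  shows "(\<integral>\<^sup>+x. ennreal (\<psi> x * \<theta> (x /\<^sub>R \<delta>)) \<partial>lborel) \<le> (\<integral>\<^sup>+x. ennreal (\<psi> x) \<partial>lborel) + ennreal \<Theta> * c"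
    and "(\<integral>\<^sup>+x. ennreal (\<psi> x) \<partial>lborel) \<le> (\<integral>\<^sup>+x. ennreal (\<psi> x * \<theta> (x /\<^sub>R \<delta>)) \<partial>lborel) + ennreal \<Theta> * c"
proof -
  define A where "A = (\<integral>\<^sup>+x. ennreal (\<psi> x * \<theta> (x /\<^sub>R \<delta>)) \<partial>lborel)"
  define A' where "A' z = (\<integral>\<^sup>+x. ennreal (\<psi> (x - \<delta> *\<^sub>R z) * \<theta> (x /\<^sub>R \<delta>)) \<partial>lborel)" for z
  define B where "B = (\<integral>\<^sup>+x. ennreal (\<psi> x) \<partial>lborel)"
  \<comment> \<open>Translation moves the shift from \<psi> to the fast variable, where it becomes z
    itself.\<close>
  have A': "A' z = (\<integral>\<^sup>+x. ennreal (\<psi> x * \<theta> (x /\<^sub>R \<delta> + z)) \<partial>lborel)" for z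
  proof -
    have "A' z = (\<integral>\<^sup>+x. ennreal (\<psi> (\<delta> *\<^sub>R z + x - \<delta> *\<^sub>R z) * \<theta> ((\<delta> *\<^sub>R z + x) /\<^sub>R \<delta>)) \<partial>lborel)"
      unfolding A'_def by (rule nn_integral_lborel_translate[symmetric]) measurable
    then show ?thesis using \<delta> by (simp add: scaleR_add_right add.commute)
  qed
  have point: "ennreal (a * w) \<le> ennreal (b * w) + ennreal \<Theta> * ennreal \<bar>b - a\<bar>"
    if "0 \<le> b" "0 < w" "w \<le> \<Theta>" for a b w
  proof -
    have "(a - b) * w \<le> \<bar>b - a\<bar> * w" using that by (intro mult_right_mono) auto
    also have "\<dots> \<le> \<bar>b - a\<bar> * \<Theta>" using that by (intro mult_left_mono) auto
    finally have "(a - b) * w \<le> \<bar>b - a\<bar> * \<Theta>" .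
    then have "a * w \<le> b * w + \<Theta> * \<bar>b - a\<bar>" by (simp add: algebra_simps)
    then have "ennreal (a * w) \<le> ennreal (b * w + \<Theta> * \<bar>b - a\<bar>)" by (rule ennreal_leI)
    also have "\<dots> = ennreal (b * w) + ennreal \<Theta> * ennreal \<bar>b - a\<bar>"
      using that bound_pos by (simp add: ennreal_mult)
    finally show ?thesis .
  qed
  have AA': "A \<le> A' z + ennreal \<Theta> * c" and A'A: "A' z \<le> A + ennreal \<Theta> * c" if "z \<in> cell" for z
  proof -
    have "A \<le> (\<integral>\<^sup>+x. ennreal (\<psi> (x - \<delta> *\<^sub>R z) * \<theta> (x /\<^sub>R \<delta>)) + ennreal \<Theta> * ennreal \<bar>\<psi> (x - \<delta> *\<^sub>R z) - \<psi> x\<bar> \<partial>lborel)"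
      unfolding A_def by (intro nn_integral_mono point nonneg pos bound)
    also have "\<dots> = A' z + ennreal \<Theta> * (\<integral>\<^sup>+x. ennreal \<bar>\<psi> (x - \<delta> *\<^sub>R z) - \<psi> x\<bar> \<partial>lborel)"
      unfolding A'_def by (simp add: nn_integral_add nn_integral_cmult)
    also have "\<dots> \<le> A' z + ennreal \<Theta> * c"
      by (intro add_left_mono mult_left_mono osc that) simp
    finally show "A \<le> A' z + ennreal \<Theta> * c" .
    have "A' z \<le> (\<integral>\<^sup>+x. ennreal (\<psi> x * \<theta> (x /\<^sub>R \<delta>)) + ennreal \<Theta> * ennreal \<bar>\<psi> x - \<psi> (x - \<delta> *\<^sub>R z)\<bar> \<partial>lborel)"
      unfolding A'_def by (intro nn_integral_mono point nonneg pos bound)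
    also have "\<dots> = A + ennreal \<Theta> * (\<integral>\<^sup>+x. ennreal \<bar>\<psi> (x - \<delta> *\<^sub>R z) - \<psi> x\<bar> \<partial>lborel)"
      unfolding A_def by (simp add: nn_integral_add nn_integral_cmult abs_minus_commute)
    also have "\<dots> \<le> A + ennreal \<Theta> * c"
      by (intro add_left_mono mult_left_mono osc that) simp
    finally show "A' z \<le> A + ennreal \<Theta> * c" .
  qed
  have [measurable]: "A' \<in> borel_measurable borel"
    unfolding A'_def by (rule lborel.borel_measurable_nn_integral[unfolded measurable_lborel1]) measurable
  \<comment> \<open>By Fubini the weight is averaged over z first, and that average is 1 at every
    x.\<close>
  have av: "(\<integral>\<^sup>+z. A' z * indicator cell z \<partial>lborel) = B"
  proof -
    have "(\<integral>\<^sup>+z. A' z * indicator cell z \<partial>lborel) =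
        (\<integral>\<^sup>+z. (\<integral>\<^sup>+x. ennreal (\<psi> x * \<theta> (x /\<^sub>R \<delta> + z)) * indicator cell z \<partial>lborel) \<partial>lborel)"
      unfolding A' by (intro nn_integral_cong nn_integral_multc[symmetric]) measurable
    also have "\<dots> = (\<integral>\<^sup>+x. (\<integral>\<^sup>+z. ennreal (\<psi> x * \<theta> (x /\<^sub>R \<delta> + z)) * indicator cell z \<partial>lborel) \<partial>lborel)"
      by (rule lborel_pair.Fubini') measurable
    also have "\<dots> = (\<integral>\<^sup>+x. ennreal (\<psi> x) * (\<integral>\<^sup>+z. ennreal (\<theta> (x /\<^sub>R \<delta> + z)) * indicator cell z \<partial>lborel) \<partial>lborel)"
      using nonneg pos by (simp add: ennreal_mult less_imp_le mult.assoc nn_integral_cmult)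
    also have "\<dots> = B" by (simp add: nn_integral_cell B_def)
    finally show ?thesis .
  qed
  have const: "(\<integral>\<^sup>+z. d * indicator cell z \<partial>lborel) = d" for d :: ennreal
    by (simp add: nn_integral_cmult_indicator emeasure_cell)
  have "A = (\<integral>\<^sup>+z. A * indicator cell z \<partial>lborel)" by (simp only: const)
  also have "\<dots> \<le> (\<integral>\<^sup>+z. A' z * indicator cell z + ennreal \<Theta> * c * indicator cell z \<partial>lborel)"
    using AA' by (intro nn_integral_mono) (auto simp: indicator_def)
  also have "\<dots> = B + ennreal \<Theta> * c"
    by (simp add: nn_integral_add av const)
  finally show "(\<integral>\<^sup>+x. ennreal (\<psi> x * \<theta> (x /\<^sub>R \<delta>)) \<partial>lborel) \<le> (\<integral>\<^sup>+x. ennreal (\<psi> x) \<partial>lborel) + ennreal \<Theta> * c"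
    by (simp add: A_def B_def)
  have "B \<le> (\<integral>\<^sup>+z. A * indicator cell z + ennreal \<Theta> * c * indicator cell z \<partial>lborel)"
    unfolding av[symmetric] using A'A by (intro nn_integral_mono) (auto simp: indicator_def)
  also have "\<dots> = A + ennreal \<Theta> * c"
    by (simp add: nn_integral_add const)
  finally show "(\<integral>\<^sup>+x. ennreal (\<psi> x) \<partial>lborel) \<le> (\<integral>\<^sup>+x. ennreal (\<psi> x * \<theta> (x /\<^sub>R \<delta>)) \<partial>lborel) + ennreal \<Theta> * c"
    by (simp add: A_def B_def)
qed

end

subsection \<open>Integrals over cubes\<close>

definition cube_integral :: "real \<Rightarrow> (real^'n \<Rightarrow> real) \<Rightarrow> real" where
  "cube_integral \<rho> f = (LINT x|lborel. indicator (cube \<rho>) x * f x)"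

lemma integrable_cube:
  fixes f :: "real^'n \<Rightarrow> real"
  assumes "continuous_on UNIV f"
  shows "integrable lborel (\<lambda>x. indicator (cube \<rho>) x * f x)"
  using borel_integrable_compact[of "cube \<rho> :: (real^'n) set" f] continuous_on_subset[OF assms]
  by (simp add: cube_def compact_cbox)

lemma cube_integral_add:
  "continuous_on UNIV f \<Longrightarrow> continuous_on UNIV g \<Longrightarrow>
    cube_integral \<rho> (\<lambda>x. f x + g x) = cube_integral \<rho> f + cube_integral \<rho> g"
  unfolding cube_integral_def by (simp add: distrib_left integrable_cube)

lemma cube_integral_cmult: "cube_integral \<rho> (\<lambda>x. c * f x) = c * cube_integral \<rho> f"
  unfolding cube_integral_def by (simp add: mult.left_commute)

lemma cube_integral_mono:
  "continuous_on UNIV f \<Longrightarrow> continuous_on UNIV g \<Longrightarrow> (\<And>x. x \<in> cube \<rho> \<Longrightarrow> f x \<le> g x) \<Longrightarrow>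
    cube_integral \<rho> f \<le> cube_integral \<rho> g"
  unfolding cube_integral_def by (intro integral_mono integrable_cube) (auto simp: indicator_def)

lemma cube_integral_nonneg: "(\<And>x. x \<in> cube \<rho> \<Longrightarrow> 0 \<le> f x) \<Longrightarrow> 0 \<le> cube_integral \<rho> f"
  unfolding cube_integral_def by (intro Bochner_Integration.integral_nonneg) (auto simp: indicator_def)

lemma ennreal_cube_integral:
  assumes "continuous_on UNIV f" "\<And>x. x \<in> cube \<rho> \<Longrightarrow> 0 \<le> f x"
  shows "ennreal (cube_integral \<rho> f) = (\<integral>\<^sup>+x. ennreal (f x) * indicator (cube \<rho>) x \<partial>lborel)"
proof -
  have "(\<integral>\<^sup>+x. ennreal (f x) * indicator (cube \<rho>) x \<partial>lborel) = (\<integral>\<^sup>+x. ennreal (indicator (cube \<rho>) x * f x) \<partial>lborel)"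
    by (intro nn_integral_cong) (auto simp: indicator_def)
  also have "\<dots> = ennreal (cube_integral \<rho> f)"
    unfolding cube_integral_def
    by (intro nn_integral_eq_integral integrable_cube assms) (use assms(2) in \<open>auto simp: indicator_def\<close>)
  finally show ?thesis by simp
qed

lemma cube_integral_const: "\<rho> \<ge> 0 \<Longrightarrow> cube_integral \<rho> (\<lambda>x::real^'n. c) = c * \<rho> ^ CARD('n)"
  using emeasure_cube[of \<rho>, where 'n = 'n]
  by (simp add: cube_integral_def measure_def)

lemma cube_integral_coord_nonneg:
  fixes g :: "real \<Rightarrow> real" and k :: "'n::finite"
  assumes g: "continuous_on UNIV g" and \<rho>: "\<rho> \<ge> 0" and nn: "\<And>t. t \<in> {- \<rho> / 2..\<rho> / 2} \<Longrightarrow> 0 \<le> g t"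
  shows "cube_integral \<rho> (\<lambda>x::real^'n. g (x $ k)) =
    \<rho> ^ (CARD('n) - 1) * (LINT t|lborel. indicator {- \<rho> / 2..\<rho> / 2} t * g t)"
proof -
  have c: "continuous_on UNIV (\<lambda>x::real^'n. g (x $ k))"
    by (intro continuous_on_compose2[OF g]) (auto intro!: continuous_intros)
  have [measurable]: "g \<in> borel_measurable borel" using g by (rule borel_measurable_continuous_onI)
  have m: "x $ k \<in> {- \<rho> / 2..\<rho> / 2}" if "x \<in> cube \<rho>" for x :: "real^'n"
    using that by (auto simp: mem_cube abs_le_iff dest: spec[of _ k])
  have i: "integrable lborel (\<lambda>t. indicator {- \<rho> / 2..\<rho> / 2} t * g t)"
    using borel_integrable_compact[of "{- \<rho> / 2..\<rho> / 2}" g] continuous_on_subset[OF g] by simp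
  have "ennreal (cube_integral \<rho> (\<lambda>x::real^'n. g (x $ k))) =
      (\<integral>\<^sup>+x. ennreal (g (x $ k)) * indicator (cube \<rho>) x \<partial>(lborel :: (real^'n) measure))"
    by (rule ennreal_cube_integral[OF c]) (use m nn in blast)
  also have "\<dots> = ennreal \<rho> ^ (CARD('n) - 1) * (\<integral>\<^sup>+t. ennreal (g t) * indicator {- \<rho> / 2..\<rho> / 2} t \<partial>lborel)"
    by (rule nn_integral_cube_coord) (use \<rho> in auto)
  also have "(\<integral>\<^sup>+t. ennreal (g t) * indicator {- \<rho> / 2..\<rho> / 2} t \<partial>lborel) =
      (\<integral>\<^sup>+t. ennreal (indicator {- \<rho> / 2..\<rho> / 2} t * g t) \<partial>lborel)"
    by (intro nn_integral_cong) (auto simp: indicator_def)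
  also have "\<dots> = ennreal (LINT t|lborel. indicator {- \<rho> / 2..\<rho> / 2} t * g t)"
    by (intro nn_integral_eq_integral i) (use nn in \<open>auto simp: indicator_def\<close>)
  finally have "ennreal (cube_integral \<rho> (\<lambda>x::real^'n. g (x $ k))) =
      ennreal (\<rho> ^ (CARD('n) - 1) * (LINT t|lborel. indicator {- \<rho> / 2..\<rho> / 2} t * g t))"
    using \<rho> by (simp add: ennreal_power ennreal_mult')
  moreover have "0 \<le> cube_integral \<rho> (\<lambda>x::real^'n. g (x $ k))"
    by (rule cube_integral_nonneg) (use m nn in blast)
  moreover have "0 \<le> (LINT t|lborel. indicator {- \<rho> / 2..\<rho> / 2} t * g t)"
    using nn by (intro Bochner_Integration.integral_nonneg) (auto simp: indicator_def)
  ultimately show ?thesis using \<rho> by simp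
qed

text \<open>Adding a bound M for the absolute value of g on the interval reduces this to the
  nonnegative case, where the extended integrals factor.\<close>

lemma cube_integral_coord:
  fixes g :: "real \<Rightarrow> real" and k :: "'n::finite"
  assumes g: "continuous_on UNIV g" and \<rho>: "\<rho> \<ge> 0"
  shows "cube_integral \<rho> (\<lambda>x::real^'n. g (x $ k)) =
    \<rho> ^ (CARD('n) - 1) * (LINT t|lborel. indicator {- \<rho> / 2..\<rho> / 2} t * g t)"
proof -
  obtain M where M: "\<forall>t\<in>{- \<rho> / 2..\<rho> / 2}. \<bar>g t\<bar> \<le> M"
    using continuous_bounded_interval[OF continuous_on_subset[OF g subset_UNIV]] by blast
  have c: "continuous_on UNIV (\<lambda>x::real^'n. g (x $ k))"
    by (intro continuous_on_compose2[OF g]) (auto intro!: continuous_intros)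
  have i: "integrable lborel (\<lambda>t. indicator {- \<rho> / 2..\<rho> / 2} t * g t)"
    using borel_integrable_compact[of "{- \<rho> / 2..\<rho> / 2}" g] continuous_on_subset[OF g] by simp
  have "cube_integral \<rho> (\<lambda>x::real^'n. g (x $ k) + M) =
    \<rho> ^ (CARD('n) - 1) * (LINT t|lborel. indicator {- \<rho> / 2..\<rho> / 2} t * (g t + M))"
  proof (rule cube_integral_coord_nonneg)
    show "0 \<le> g t + M" if "t \<in> {- \<rho> / 2..\<rho> / 2}" for t
      using bspec[OF M that] by linarith
  qed (use \<rho> in \<open>auto intro!: continuous_intros g\<close>)
  also have "(LINT t|lborel. indicator {- \<rho> / 2..\<rho> / 2} t * (g t + M)) =
      (LINT t|lborel. indicator {- \<rho> / 2..\<rho> / 2} t * g t) + M * \<rho>"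
    using i \<rho> by (simp add: distrib_left measure_def)
  also have "cube_integral \<rho> (\<lambda>x::real^'n. g (x $ k) + M) = cube_integral \<rho> (\<lambda>x::real^'n. g (x $ k)) + M * \<rho> ^ CARD('n)"
    using cube_integral_add[OF c, of "\<lambda>_. M" \<rho>] \<rho> by (simp add: cube_integral_const)
  also have "\<rho> ^ CARD('n) = \<rho> ^ (CARD('n) - 1) * \<rho>"
    by (metis Suc_pred' power_Suc2 zero_less_card_finite)
  finally show ?thesis by (simp add: algebra_simps)
qed

lemma cube_integral_coord_deriv:
  fixes g :: "real \<Rightarrow> real" and k :: "'n::finite"
  assumes g: "continuous_on UNIV g" and \<rho>: "\<rho> \<ge> 0" and F: "\<And>t. (F has_real_derivative g t) (at t)"
  shows "cube_integral \<rho> (\<lambda>x::real^'n. g (x $ k)) = \<rho> ^ (CARD('n) - 1) * (F (\<rho> / 2) - F (- \<rho> / 2))"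
proof -
  have "(LINT t|lborel. indicator {- \<rho> / 2..\<rho> / 2} t *\<^sub>R g t) = F (\<rho> / 2) - F (- \<rho> / 2)"
    by (rule integral_FTC_atLeastAtMost)
      (use \<rho> F continuous_on_subset[OF g] in \<open>auto simp: has_real_derivative_iff_has_vector_derivative has_vector_derivative_at_within\<close>)
  then show ?thesis by (simp add: cube_integral_coord[OF g \<rho>])
qed

lemma power_diff_le:
  fixes a b M :: real
  assumes "0 \<le> b" "b \<le> a" "a \<le> M" "1 \<le> M"
  shows "a ^ n - b ^ n \<le> real n * (a - b) * M ^ n"
proof (induction n)
  case (Suc n)
  have "a ^ Suc n - b ^ Suc n = a * (a ^ n - b ^ n) + (a - b) * b ^ n" by (simp add: algebra_simps)
  also have "\<dots> \<le> M * (real n * (a - b) * M ^ n) + (a - b) * M ^ Suc n"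
  proof (intro add_mono mult_left_mono)
    have "0 \<le> a ^ n - b ^ n" using assms by (simp add: power_mono)
    then show "a * (a ^ n - b ^ n) \<le> M * (real n * (a - b) * M ^ n)"
      using Suc assms by (intro mult_mono) auto
    have "b ^ n \<le> M ^ n" using assms by (intro power_mono) auto
    also have "\<dots> \<le> M ^ Suc n" using assms by (intro power_increasing) auto
    finally show "b ^ n \<le> M ^ Suc n" .
  qed (use assms in auto)
  finally show ?case by (simp add: algebra_simps)
qed simp

text \<open>Made for \<open>power_diff_le\<close> with the sides
  \<open>\<rho> + 2 * \<delta>\<close> and \<open>\<rho> - 2 * \<delta>\<close>: they differ by
  \<open>4 * \<delta>\<close>, and \<open>2 * \<rho> + 1\<close> is at least 1 and bounds the larger
  side when \<open>2 * \<delta> \<le> \<rho>\<close>. The type argument passes the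
  dimension.\<close>

definition shell_const :: "'n itself \<Rightarrow> real \<Rightarrow> real" where
  "shell_const _ \<rho> = 4 * real CARD('n) * (2 * \<rho> + 1) ^ CARD('n)"

lemma shell_const_nonneg: "\<rho> \<ge> 0 \<Longrightarrow> shell_const TYPE('n::finite) \<rho> \<ge> 0"
  by (simp add: shell_const_def)

lemma emeasure_shell:
  assumes "\<delta> \<ge> 0" "2 * \<delta> \<le> \<rho>"
  shows "emeasure lborel (cube (\<rho> + 2 * \<delta>) - cube (\<rho> - 2 * \<delta>) :: (real^'n) set) \<le> ennreal (shell_const TYPE('n) \<rho> * \<delta>)"
proof -
  have "emeasure lborel (cube (\<rho> + 2 * \<delta>) - cube (\<rho> - 2 * \<delta>) :: (real^'n) set) =
      emeasure lborel (cube (\<rho> + 2 * \<delta>) :: (real^'n) set) - emeasure lborel (cube (\<rho> - 2 * \<delta>) :: (real^'n) set)"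
  proof (rule emeasure_Diff)
    have "(\<rho> - 2 * \<delta>) / 2 \<le> (\<rho> + 2 * \<delta>) / 2" using assms by simp
    then show "cube (\<rho> - 2 * \<delta>) \<subseteq> (cube (\<rho> + 2 * \<delta>) :: (real^'n) set)"
      unfolding subset_iff mem_cube by (meson order_trans)
  qed (use assms in \<open>auto simp: emeasure_cube\<close>)
  also have "\<dots> = ennreal ((\<rho> + 2 * \<delta>) ^ CARD('n) - (\<rho> - 2 * \<delta>) ^ CARD('n))"
    using assms by (simp add: emeasure_cube ennreal_minus)
  also have "\<dots> \<le> ennreal (shell_const TYPE('n) \<rho> * \<delta>)"
    using power_diff_le[of "\<rho> - 2 * \<delta>" "\<rho> + 2 * \<delta>" "2 * \<rho> + 1" "CARD('n)"] assms
    by (intro ennreal_leI) (simp add: shell_const_def algebra_simps)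
  finally show ?thesis .
qed

text \<open>The shell carries the jump of the indicator; in the interior the difference is controlled by
  \<open>\<eta>\<close>.\<close>
lemma translate_diff_cube:
  fixes f :: "real^'n \<Rightarrow> real"
  assumes z: "\<And>j. 0 \<le> z $ j \<and> z $ j < 1" and \<delta>: "\<delta> > 0" and f: "\<And>x. 0 \<le> f x" "\<And>x. f x \<le> K"
    and \<eta>: "\<And>x. x \<in> cube (\<rho> - 2 * \<delta>) \<Longrightarrow> \<bar>f (x - \<delta> *\<^sub>R z) - f x\<bar> \<le> \<eta> x" and \<eta>0: "\<And>x. \<eta> x \<ge> 0"
  shows "\<bar>indicator (cube \<rho>) (x - \<delta> *\<^sub>R z) * f (x - \<delta> *\<^sub>R z) - indicator (cube \<rho>) x * f x\<bar> \<le>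
    K * indicator (cube (\<rho> + 2 * \<delta>) - cube (\<rho> - 2 * \<delta>)) x + \<eta> x * indicator (cube (\<rho> - 2 * \<delta>)) x"
proof -
  have dz: "0 \<le> \<delta> * z $ j" "\<delta> * z $ j \<le> \<delta>" for j
    using z[of j] \<delta> by (auto simp: mult_left_le)
  have nth: "(x - \<delta> *\<^sub>R z) $ j = x $ j - \<delta> * z $ j" for j by simp
  have K: "K \<ge> 0" using f order_trans by blast
  consider "x \<in> cube (\<rho> - 2 * \<delta>)" | "x \<notin> cube (\<rho> + 2 * \<delta>)"
    | "x \<in> cube (\<rho> + 2 * \<delta>) - cube (\<rho> - 2 * \<delta>)" by blast
  then show ?thesis
  proof cases
    case 1
    then have b: "\<bar>x $ j\<bar> \<le> \<rho> / 2 - \<delta>" for j by (auto simp: mem_cube field_simps dest: spec[of _ j])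
    have "\<bar>x $ j\<bar> \<le> \<rho> / 2" "\<bar>x $ j - \<delta> * z $ j\<bar> \<le> \<rho> / 2" for j
      using b[of j] dz[of j] \<delta> by linarith+
    then have "x \<in> cube \<rho>" "x - \<delta> *\<^sub>R z \<in> cube \<rho>" unfolding mem_cube nth by blast+
    then show ?thesis using 1 \<eta>[OF 1] by simp
  next
    case 2
    then obtain j where "\<not> \<bar>x $ j\<bar> \<le> (\<rho> + 2 * \<delta>) / 2" unfolding mem_cube by blast
    then have j: "\<bar>x $ j\<bar> > \<rho> / 2 + \<delta>" by (simp add: field_simps)
    have "\<not> \<bar>x $ j\<bar> \<le> \<rho> / 2" "\<not> \<bar>x $ j - \<delta> * z $ j\<bar> \<le> \<rho> / 2"
      using j dz[of j] \<delta> by linarith+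
    then have "x \<notin> cube \<rho>" "x - \<delta> *\<^sub>R z \<notin> cube \<rho>" unfolding mem_cube nth by blast+
    then show ?thesis using K \<eta>0 by simp
  next
    case 3
    have "\<bar>indicator (cube \<rho>) (x - \<delta> *\<^sub>R z) * f (x - \<delta> *\<^sub>R z) - indicator (cube \<rho>) x * f x\<bar> \<le> K"
      using f[of x] f[of "x - \<delta> *\<^sub>R z"] K by (auto simp: indicator_def abs_le_iff)
    then show ?thesis using 3 by simp
  qed
qed

text \<open>The increment is an integral of the gradient along a segment of length at most
  \<open>\<delta> * CARD('n)\<close>. By Fubini and translation, each point s of the segment
  contributes at most the full integral of \<open>norm (grad v x)\<close>; taking x in the cube
  shrunk by \<delta> on each side keeps the segments inside the cube.\<close>

lemma nn_integral_translate_diff: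
  fixes v :: "real^'n \<Rightarrow> real"
  assumes v: "smooth v" and z: "\<And>j. 0 \<le> z $ j \<and> z $ j < 1" and \<delta>: "\<delta> > 0"
  shows "(\<integral>\<^sup>+x. ennreal \<bar>v (x - \<delta> *\<^sub>R z) - v x\<bar> * indicator (cube (\<rho> - 2 * \<delta>)) x \<partial>lborel)
    \<le> ennreal (\<delta> * CARD('n) * cube_integral \<rho> (\<lambda>x. norm (grad v x)))"
proof -
  let ?c = "\<delta> * real CARD('n)"
  have dz: "0 \<le> \<delta> * z $ j" "\<delta> * z $ j \<le> \<delta>" for j
    using z[of j] \<delta> by (auto simp: mult_left_le)
  have nz: "norm (\<delta> *\<^sub>R z) \<le> ?c"
  proof -
    have "norm (\<delta> *\<^sub>R z) \<le> (\<Sum>j\<in>UNIV. \<bar>(\<delta> *\<^sub>R z) $ j\<bar>)" by (rule norm_le_l1_cart)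
    also have "\<dots> \<le> (\<Sum>j\<in>(UNIV::'n set). \<delta>)" using dz by (intro sum_mono) simp
    finally show ?thesis by (simp add: mult.commute)
  qed
  have cg: "continuous_on UNIV (\<lambda>x. norm (grad v x))"
    by (intro continuous_on_norm continuous_on_grad v)
  have [measurable]: "v \<in> borel_measurable borel" "(\<lambda>x. norm (grad v x)) \<in> borel_measurable borel"
    using cg smooth_continuous_on[OF v] by (auto intro: borel_measurable_continuous_onI)
  have line: "ennreal \<bar>v (x - \<delta> *\<^sub>R z) - v x\<bar> \<le>
      (\<integral>\<^sup>+s. ennreal ?c * (ennreal (norm (grad v (x - s *\<^sub>R \<delta> *\<^sub>R z))) * indicator {0..1} s) \<partial>lborel)" for x
  proof -
    define f where "f s = grad v (x - s *\<^sub>R \<delta> *\<^sub>R z) \<bullet> (- (\<delta> *\<^sub>R z))" for s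
    have d: "((\<lambda>s. v (x - s *\<^sub>R \<delta> *\<^sub>R z)) has_real_derivative f s) (at s)" for s
    proof -
      have 1: "((\<lambda>s. x - s *\<^sub>R \<delta> *\<^sub>R z) has_derivative (\<lambda>h. - (h *\<^sub>R \<delta> *\<^sub>R z))) (at s)"
        by (auto intro!: derivative_eq_intros)
      have "((\<lambda>s. v (x - s *\<^sub>R \<delta> *\<^sub>R z)) has_derivative (\<lambda>h. grad v (x - s *\<^sub>R \<delta> *\<^sub>R z) \<bullet> - (h *\<^sub>R \<delta> *\<^sub>R z))) (at s)"
        by (rule has_derivative_compose[OF 1 has_derivative_grad[OF smooth_differentiable[OF v]]])
      moreover have "(\<lambda>h. grad v (x - s *\<^sub>R \<delta> *\<^sub>R z) \<bullet> - (h *\<^sub>R \<delta> *\<^sub>R z)) = (*) (f s)"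
        by (rule ext) (simp add: f_def)
      ultimately show ?thesis by (simp only: has_field_derivative_def)
    qed
    have cf: "continuous_on UNIV f"
      unfolding f_def
      by (intro continuous_intros continuous_on_compose2[OF continuous_on_grad[OF v, of UNIV]]) auto
    have "(LINT s|lborel. indicator {0..1} s *\<^sub>R f s) = v (x - 1 *\<^sub>R \<delta> *\<^sub>R z) - v (x - 0 *\<^sub>R \<delta> *\<^sub>R z)"
      by (rule integral_FTC_atLeastAtMost)
        (use d continuous_on_subset[OF cf] in \<open>auto simp: has_real_derivative_iff_has_vector_derivative has_vector_derivative_at_within\<close>)
    then have "ennreal \<bar>v (x - \<delta> *\<^sub>R z) - v x\<bar> = ennreal (norm (LINT s|lborel. indicator {0..1} s *\<^sub>R f s))"
      by simp
    also have "\<dots> \<le> (\<integral>\<^sup>+s. ennreal (norm (indicator {0..1} s *\<^sub>R f s)) \<partial>lborel)"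
      by (intro integral_norm_bound_ennreal borel_integrable_compact continuous_on_subset[OF cf]) auto
    also have "\<dots> \<le> (\<integral>\<^sup>+s. ennreal ?c * (ennreal (norm (grad v (x - s *\<^sub>R \<delta> *\<^sub>R z))) * indicator {0..1} s) \<partial>lborel)"
    proof (intro nn_integral_mono)
      fix s :: real
      have "\<bar>f s\<bar> \<le> norm (grad v (x - s *\<^sub>R \<delta> *\<^sub>R z)) * norm (- (\<delta> *\<^sub>R z))"
        unfolding f_def by (rule Cauchy_Schwarz_ineq2)
      also have "\<dots> \<le> norm (grad v (x - s *\<^sub>R \<delta> *\<^sub>R z)) * ?c"
        using nz by (intro mult_left_mono) auto
      finally have "ennreal \<bar>f s\<bar> \<le> ennreal (?c * norm (grad v (x - s *\<^sub>R \<delta> *\<^sub>R z)))"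
        by (intro ennreal_leI) (simp only: mult.commute)
      then have "ennreal \<bar>f s\<bar> \<le> ennreal ?c * ennreal (norm (grad v (x - s *\<^sub>R \<delta> *\<^sub>R z)))"
        using \<delta> by (subst ennreal_mult[symmetric]) auto
      then show "ennreal (norm (indicator {0..1} s *\<^sub>R f s)) \<le>
          ennreal ?c * (ennreal (norm (grad v (x - s *\<^sub>R \<delta> *\<^sub>R z))) * indicator {0..1} s)"
        by (simp add: indicator_def)
    qed
    finally show ?thesis .
  qed
  let ?J = "\<integral>\<^sup>+x. ennreal (norm (grad v x)) * indicator (cube \<rho>) x \<partial>lborel"
  have sh: "(\<integral>\<^sup>+x. ennreal (norm (grad v (x - s *\<^sub>R \<delta> *\<^sub>R z))) * indicator (cube (\<rho> - 2 * \<delta>)) x \<partial>lborel) \<le> ?J"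
    if s: "s \<in> {0..1}" for s
  proof -
    let ?w = "s *\<^sub>R \<delta> *\<^sub>R z"
    have "(\<integral>\<^sup>+x. ennreal (norm (grad v (x - ?w))) * indicator (cube (\<rho> - 2 * \<delta>)) x \<partial>lborel) =
       (\<integral>\<^sup>+x. ennreal (norm (grad v (?w + x - ?w))) * indicator (cube (\<rho> - 2 * \<delta>)) (?w + x) \<partial>lborel)"
      by (rule nn_integral_lborel_translate[symmetric]) measurable
    also have "\<dots> \<le> ?J"
    proof (intro nn_integral_mono)
      fix x
      have "x \<in> cube \<rho>" if "?w + x \<in> cube (\<rho> - 2 * \<delta>)"
        unfolding mem_cube
      proof
        fix j
        have "0 \<le> s" "s \<le> 1" using s by auto
        then have "0 \<le> s * (\<delta> * z $ j)" by (intro mult_nonneg_nonneg dz)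
        moreover have "s * (\<delta> * z $ j) \<le> 1 * \<delta>"
          using \<open>s \<le> 1\<close> by (intro mult_mono dz) auto
        moreover have "\<bar>s * (\<delta> * z $ j) + x $ j\<bar> \<le> \<rho> / 2 - \<delta>"
          using that by (auto simp: mem_cube field_simps dest: spec[of _ j])
        ultimately show "\<bar>x $ j\<bar> \<le> \<rho> / 2" by linarith
      qed
      then show "ennreal (norm (grad v (?w + x - ?w))) * indicator (cube (\<rho> - 2 * \<delta>)) (?w + x)
          \<le> ennreal (norm (grad v x)) * indicator (cube \<rho>) x"
        by (auto simp: indicator_def)
    qed
    finally show ?thesis .
  qed
  have [measurable]: "(\<lambda>(x, s). norm (grad v (x - s *\<^sub>R \<delta> *\<^sub>R z))) \<in> borel_measurable (lborel \<Otimes>\<^sub>M lborel)"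
    by measurable
  have "(\<integral>\<^sup>+x. ennreal \<bar>v (x - \<delta> *\<^sub>R z) - v x\<bar> * indicator (cube (\<rho> - 2 * \<delta>)) x \<partial>lborel) \<le>
    (\<integral>\<^sup>+x. (\<integral>\<^sup>+s. ennreal ?c * (ennreal (norm (grad v (x - s *\<^sub>R \<delta> *\<^sub>R z))) * indicator {0..1} s) \<partial>lborel)
       * indicator (cube (\<rho> - 2 * \<delta>)) x \<partial>lborel)"
    by (intro nn_integral_mono mult_right_mono line) simp
  also have "\<dots> = (\<integral>\<^sup>+x. (\<integral>\<^sup>+s. ennreal ?c * (ennreal (norm (grad v (x - s *\<^sub>R \<delta> *\<^sub>R z))) * indicator {0..1} s)
       * indicator (cube (\<rho> - 2 * \<delta>)) x \<partial>lborel) \<partial>lborel)"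
    by (intro nn_integral_cong nn_integral_multc[symmetric]) measurable
  also have "\<dots> = (\<integral>\<^sup>+s. (\<integral>\<^sup>+x. ennreal ?c * (ennreal (norm (grad v (x - s *\<^sub>R \<delta> *\<^sub>R z))) * indicator {0..1} s)
       * indicator (cube (\<rho> - 2 * \<delta>)) x \<partial>lborel) \<partial>lborel)"
    by (rule lborel_pair.Fubini'[symmetric]) measurable
  also have "\<dots> = (\<integral>\<^sup>+s. ennreal ?c * indicator {0..1} s *
      (\<integral>\<^sup>+x. ennreal (norm (grad v (x - s *\<^sub>R \<delta> *\<^sub>R z))) * indicator (cube (\<rho> - 2 * \<delta>)) x \<partial>lborel) \<partial>lborel)"
    by (subst nn_integral_cmult[symmetric]) (auto intro!: nn_integral_cong simp: mult_ac)
  also have "\<dots> \<le> (\<integral>\<^sup>+s. ennreal ?c * indicator {0..1} s * ?J \<partial>(lborel :: real measure))"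
    using sh by (intro nn_integral_mono) (auto simp: indicator_def intro: mult_left_mono)
  also have "\<dots> = ennreal ?c * ?J"
    by (simp add: nn_integral_multc nn_integral_cmult_indicator)
  also have "?J = ennreal (cube_integral \<rho> (\<lambda>x. norm (grad v x)))"
    by (rule ennreal_cube_integral[symmetric, OF cg]) simp
  also have "ennreal ?c * \<dots> = ennreal (?c * cube_integral \<rho> (\<lambda>x. norm (grad v x)))"
    using \<delta> by (intro ennreal_mult[symmetric] cube_integral_nonneg) auto
  finally show ?thesis .
qed

subsection \<open>The lower bound\<close>

context periodic_weight
begin

text \<open>Translation changes \<open>w (v x)\<close>, cut off to the cube, in two ways: by at most
  K in a shell of volume O(\<delta>) around the boundary, and by at most L times the increment of v
  inside. Both enter \<open>homogenization_estimate\<close>.\<close>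

lemma homogenization_smooth:
  fixes v :: "real^'n \<Rightarrow> real" and w :: "real \<Rightarrow> real"
  assumes v: "smooth v" and w0: "\<And>s. 0 \<le> w s" and wK: "\<And>s. w s \<le> K"
    and wL: "\<And>s t. \<bar>w s - w t\<bar> \<le> L * \<bar>s - t\<bar>" and \<delta>: "\<delta> > 0" "2 * \<delta> \<le> \<rho>"
  shows "cube_integral \<rho> (\<lambda>x. w (v x)) \<le> cube_integral \<rho> (\<lambda>x. w (v x) * \<theta> (x /\<^sub>R \<delta>))
    + \<Theta> * (K * shell_const TYPE('n) \<rho> * \<delta> + L * \<delta> * CARD('n) * cube_integral \<rho> (\<lambda>x. norm (grad v x)))"
proof -
  have L0: "L \<ge> 0" using wL by (rule lipschitz_const_nonneg)
  have K0: "K \<ge> 0" using w0 wK order_trans by blast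
  have cw: "continuous_on UNIV w"
    unfolding continuous_on_iff
  proof (intro ballI allI impI)
    fix x e :: real assume e: "0 < e"
    \<comment> \<open>L may be 0, hence the denominator L + 1.\<close>
    have "dist (w y) (w x) < e" if "dist y x < e / (L + 1)" for y
    proof -
      have "\<bar>w y - w x\<bar> \<le> (L + 1) * \<bar>y - x\<bar>" using wL[of y x] by (simp add: distrib_right)
      also have "\<dots> < e" using that L0 by (simp add: dist_real_def field_simps)
      finally show ?thesis by (simp add: dist_real_def)
    qed
    then show "\<exists>d>0. \<forall>x'\<in>UNIV. dist x' x < d \<longrightarrow> dist (w x') (w x) < e"
      using e L0 by (intro exI[of _ "e / (L + 1)"]) auto
  qed
  have cwv: "continuous_on UNIV (\<lambda>x. w (v x))"
    using continuous_on_compose2[OF cw smooth_continuous_on[OF v]] by auto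
  have cth: "continuous_on UNIV (\<lambda>x. \<theta> (x /\<^sub>R \<delta>))"
    by (intro continuous_on_compose2[OF cont]) (auto intro!: continuous_intros)
  have [measurable]: "(\<lambda>x. w (v x)) \<in> borel_measurable borel" "v \<in> borel_measurable borel"
    using cwv smooth_continuous_on[OF v] by (auto intro: borel_measurable_continuous_onI)
  let ?\<psi> = "\<lambda>x. indicator (cube \<rho>) x * w (v x)"
  let ?G = "cube_integral \<rho> (\<lambda>x. norm (grad v x))"
  let ?c = "K * shell_const TYPE('n) \<rho> * \<delta> + L * \<delta> * CARD('n) * ?G"
  have G0: "?G \<ge> 0" by (rule cube_integral_nonneg) simp
  have sc0: "shell_const TYPE('n) \<rho> \<ge> 0" using \<delta> by (intro shell_const_nonneg) simp
  have c0: "?c \<ge> 0"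
    using K0 L0 G0 \<delta> sc0 by simp
  let ?N = "cube (\<rho> + 2 * \<delta>) - cube (\<rho> - 2 * \<delta>) :: (real^'n) set"
  have osc: "(\<integral>\<^sup>+x. ennreal \<bar>?\<psi> (x - \<delta> *\<^sub>R z) - ?\<psi> x\<bar> \<partial>lborel) \<le> ennreal ?c" if "z \<in> cell" for z
  proof -
    have z: "0 \<le> z $ j \<and> z $ j < 1" for j using that by (simp add: cell_def)
    have "(\<integral>\<^sup>+x. ennreal \<bar>?\<psi> (x - \<delta> *\<^sub>R z) - ?\<psi> x\<bar> \<partial>lborel) \<le>
      (\<integral>\<^sup>+x. ennreal K * indicator ?N x + ennreal L * (ennreal \<bar>v (x - \<delta> *\<^sub>R z) - v x\<bar> * indicator (cube (\<rho> - 2 * \<delta>)) x) \<partial>lborel)"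
    proof (rule nn_integral_mono)
      fix x
      have "\<bar>?\<psi> (x - \<delta> *\<^sub>R z) - ?\<psi> x\<bar> \<le> K * indicator ?N x + L * \<bar>v (x - \<delta> *\<^sub>R z) - v x\<bar> * indicator (cube (\<rho> - 2 * \<delta>)) x"
        by (rule translate_diff_cube[OF z \<delta>(1) w0 wK wL]) (use L0 in simp)
      then have "ennreal \<bar>?\<psi> (x - \<delta> *\<^sub>R z) - ?\<psi> x\<bar> \<le> ennreal (K * indicator ?N x + L * \<bar>v (x - \<delta> *\<^sub>R z) - v x\<bar> * indicator (cube (\<rho> - 2 * \<delta>)) x)"
        by (rule ennreal_leI)
      then show "ennreal \<bar>?\<psi> (x - \<delta> *\<^sub>R z) - ?\<psi> x\<bar> \<le> ennreal K * indicator ?N x +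
          ennreal L * (ennreal \<bar>v (x - \<delta> *\<^sub>R z) - v x\<bar> * indicator (cube (\<rho> - 2 * \<delta>)) x)"
        using K0 L0 by (auto simp: indicator_def ennreal_mult)
    qed
    also have "\<dots> = ennreal K * emeasure lborel ?N +
       ennreal L * (\<integral>\<^sup>+x. ennreal \<bar>v (x - \<delta> *\<^sub>R z) - v x\<bar> * indicator (cube (\<rho> - 2 * \<delta>)) x \<partial>lborel)"
      by (simp add: nn_integral_add nn_integral_cmult nn_integral_cmult_indicator)
    also have "\<dots> \<le> ennreal K * ennreal (shell_const TYPE('n) \<rho> * \<delta>) + ennreal L * ennreal (\<delta> * CARD('n) * ?G)"
      by (intro add_mono mult_left_mono emeasure_shell nn_integral_translate_diff v z) (use \<delta> in auto)
    also have "\<dots> = ennreal ?c"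
      using K0 L0 G0 \<delta> sc0
      by (simp add: ennreal_mult[symmetric] ennreal_plus[symmetric] mult.assoc del: ennreal_plus)
    finally show ?thesis .
  qed
  have "(\<integral>\<^sup>+x. ennreal (?\<psi> x) \<partial>lborel) \<le> (\<integral>\<^sup>+x. ennreal (?\<psi> x * \<theta> (x /\<^sub>R \<delta>)) \<partial>lborel) + ennreal \<Theta> * ennreal ?c"
    by (rule homogenization_estimate(2)[OF _ _ \<delta>(1) osc]) (use w0 in \<open>auto simp: indicator_def\<close>)
  moreover have "(\<integral>\<^sup>+x. ennreal (?\<psi> x) \<partial>lborel) = ennreal (cube_integral \<rho> (\<lambda>x. w (v x)))"
    by (subst ennreal_cube_integral[OF cwv]) (auto intro!: nn_integral_cong simp: w0 indicator_def)
  moreover have "(\<integral>\<^sup>+x. ennreal (?\<psi> x * \<theta> (x /\<^sub>R \<delta>)) \<partial>lborel) = ennreal (cube_integral \<rho> (\<lambda>x. w (v x) * \<theta> (x /\<^sub>R \<delta>)))"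
    by (subst ennreal_cube_integral[OF continuous_on_mult[OF cwv cth]])
      (auto intro!: nn_integral_cong simp: w0 pos less_imp_le indicator_def)
  ultimately have "ennreal (cube_integral \<rho> (\<lambda>x. w (v x))) \<le> ennreal (cube_integral \<rho> (\<lambda>x. w (v x) * \<theta> (x /\<^sub>R \<delta>))) + ennreal (\<Theta> * ?c)"
    using c0 bound_pos by (simp add: ennreal_mult)
  also have "\<dots> = ennreal (cube_integral \<rho> (\<lambda>x. w (v x) * \<theta> (x /\<^sub>R \<delta>)) + \<Theta> * ?c)"
    using c0 bound_pos w0 pos by (intro ennreal_plus[symmetric] cube_integral_nonneg) (auto simp: less_imp_le)
  finally show ?thesis
    using c0 bound_pos w0 pos
    by (subst (asm) ennreal_le_iff) (auto intro!: add_nonneg_nonneg cube_integral_nonneg simp: less_imp_le)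
qed

text \<open>Calibration: \<open>\<epsilon> / 2 * a\<^sup>2 + w / \<epsilon> \<ge> sqrt (2 * w) * a\<close>, and the integral of
  \<open>\<partial>\<^sub>k (G \<circ> v)\<close> only depends on the boundary values.\<close>
lemma modica_mortola_smooth:
  fixes \<phi> :: "real^'n \<Rightarrow> real" and w q G :: "real \<Rightarrow> real" and k :: 'n
  assumes w0: "\<And>s. 0 \<le> w s" and cw: "continuous_on UNIV w"
    and G: "\<And>s. (G has_real_derivative sqrt (2 * w s)) (at s)"
    and q: "smooth q" and \<phi>: "test_function (interior (cube \<rho>)) \<phi>" and \<epsilon>: "\<epsilon> > 0" and \<rho>: "\<rho> > 0"
    and v: "\<And>x. v x = q (x $ k / \<epsilon>) + \<phi> x"
  shows "\<rho> ^ (CARD('n) - 1) * (G (q (\<rho> / 2 / \<epsilon>)) - G (q (- \<rho> / 2 / \<epsilon>))) \<le>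
    cube_integral \<rho> (\<lambda>x. \<epsilon> / 2 * (norm (grad v x))\<^sup>2 + 1 / \<epsilon> * w (v x))"
proof -
  define h where "h x = q (x $ k / \<epsilon>)" for x :: "real^'n"
  have sq: "smooth (\<lambda>t. q (t / \<epsilon>))" by (rule smooth_scaled(2)[OF q])
  have sh: "smooth h"
    unfolding h_def using smooth_comp[OF sq smooth_vec_nth] .
  have s\<phi>: "smooth \<phi>" using \<phi> by (rule test_function_smooth)
  have v_eq: "v = (\<lambda>x. h x + \<phi> x)" by (simp add: v h_def fun_eq_iff)
  have sv: "smooth v" unfolding v_eq by (intro smooth_add sh s\<phi>)
  have gv: "grad v x = grad h x + grad \<phi> x" for x
    unfolding v_eq by (intro grad_add smooth_differentiable sh s\<phi>)
  have out: "v x = h x" "grad v x = grad h x" if "x \<notin> interior (cube \<rho>)" for x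
    using test_function_grad_zero[OF \<phi> that] by (auto simp: v_eq gv[unfolded v_eq])
  \<comment> \<open>G is only continuously differentiable, since \<open>sqrt (2 * w s)\<close> is
    merely continuous. Still F has a continuous derivative, and it vanishes off the open cube, where
    v equals its boundary data.\<close>
  define F where "F x = G (v x) - G (h x)" for x
  have dG: "(\<lambda>x. G (u x)) differentiable (at x)" "grad (\<lambda>x. G (u x)) x = sqrt (2 * w (u x)) *\<^sub>R grad u x"
    if "smooth u" for u :: "real^'n \<Rightarrow> real" and x
  proof -
    have "u differentiable (at x)" using that by (rule smooth_differentiable)
    then have "((\<lambda>x. G (u x)) has_derivative (\<lambda>v. sqrt (2 * w (u x)) * (grad u x \<bullet> v))) (at x)"
      by (intro has_derivative_compose[OF has_derivative_grad G[unfolded has_field_derivative_def]])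
    then show "(\<lambda>x. G (u x)) differentiable (at x)" by (auto simp: differentiable_def)
    show "grad (\<lambda>x. G (u x)) x = sqrt (2 * w (u x)) *\<^sub>R grad u x"
      by (intro grad_comp G smooth_differentiable that)
  qed
  have dF: "F differentiable (at x)" "grad F x = sqrt (2 * w (v x)) *\<^sub>R grad v x - sqrt (2 * w (h x)) *\<^sub>R grad h x" for x
    unfolding F_def using dG[OF sv] dG[OF sh] by (auto intro!: differentiable_diff simp: grad_diff)
  have cu: "continuous_on UNIV (\<lambda>x. sqrt (2 * w (u x)) * grad u x $ k)" if "smooth u" for u :: "real^'n \<Rightarrow> real"
    by (intro continuous_intros continuous_on_compose2[OF cw] smooth_continuous_on that smooth_grad) auto
  have fr: "frechet_derivative F (at x) (axis k 1) = sqrt (2 * w (v x)) * grad v x $ k - sqrt (2 * w (h x)) * grad h x $ k" for x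
    using frechet_eq_grad[OF dF(1), of x "axis k 1"] by (simp add: dF(2) inner_axis)
  obtain r where r: "r > 0" "\<forall>x\<in>cube \<rho> :: (real^'n) set. norm x \<le> r"
    using bounded_cbox unfolding cube_def bounded_pos by blast
  have zero: "(LINT x|lborel. frechet_derivative F (at x) (axis k 1)) = 0"
  proof (rule integral_frechet_derivative_zero[where r = "r + 1"])
    show "continuous_on UNIV (\<lambda>x. frechet_derivative F (at x) (axis k 1))"
      unfolding fr by (intro continuous_on_diff cu sv sh)
    show "r + 1 > 0" using r by simp
    show "F x = 0" if "r + 1 \<le> norm x" for x
    proof -
      have "x \<notin> cube \<rho>" using that r(2) by force
      then have "x \<notin> interior (cube \<rho>)" using interior_subset by blast
      then show ?thesis using out by (simp add: F_def)
    qed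
  qed (rule dF)
  have "(LINT x|lborel. frechet_derivative F (at x) (axis k 1)) =
      (LINT x|lborel. indicator (cube \<rho>) x * (sqrt (2 * w (v x)) * grad v x $ k) - indicator (cube \<rho>) x * (sqrt (2 * w (h x)) * grad h x $ k))"
  proof (intro Bochner_Integration.integral_cong refl)
    fix x
    show "frechet_derivative F (at x) (axis k 1) = indicator (cube \<rho>) x * (sqrt (2 * w (v x)) * grad v x $ k) - indicator (cube \<rho>) x * (sqrt (2 * w (h x)) * grad h x $ k)"
    proof (cases "x \<in> cube \<rho>")
      case False
      then have "x \<notin> interior (cube \<rho>)" using interior_subset by blast
      then show ?thesis using out[of x] by (simp add: fr)
    qed (simp add: fr)
  qed
  also have "\<dots> = cube_integral \<rho> (\<lambda>x. sqrt (2 * w (v x)) * grad v x $ k) - cube_integral \<rho> (\<lambda>x. sqrt (2 * w (h x)) * grad h x $ k)"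
    unfolding cube_integral_def by (intro Bochner_Integration.integral_diff integrable_cube cu sv sh)
  finally have eq: "cube_integral \<rho> (\<lambda>x. sqrt (2 * w (v x)) * grad v x $ k) = cube_integral \<rho> (\<lambda>x. sqrt (2 * w (h x)) * grad h x $ k)"
    using zero by simp
  let ?g = "\<lambda>t. sqrt (2 * w (q (t / \<epsilon>))) * deriv (\<lambda>t. q (t / \<epsilon>)) t"
  have gh: "grad h x $ k = deriv (\<lambda>t. q (t / \<epsilon>)) (x $ k)" for x
    unfolding h_def by (subst grad_coordinate[OF smooth_DERIV[OF sq]]) simp
  have "cube_integral \<rho> (\<lambda>x. sqrt (2 * w (h x)) * grad h x $ k) = cube_integral \<rho> (\<lambda>x::real^'n. ?g (x $ k))"
    unfolding gh by (simp add: h_def)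
  also have "\<dots> = \<rho> ^ (CARD('n) - 1) * (G (q (\<rho> / 2 / \<epsilon>)) - G (q (- \<rho> / 2 / \<epsilon>)))"
  proof (rule cube_integral_coord_deriv)
    show "continuous_on UNIV ?g"
      by (intro continuous_intros continuous_on_compose2[OF cw] smooth_continuous_on sq smooth_deriv) auto
    show "((\<lambda>t. G (q (t / \<epsilon>))) has_real_derivative ?g t) (at t)" for t
      by (rule DERIV_chain2[OF G smooth_DERIV[OF sq]])
  qed (use \<rho> in simp)
  finally have bdry: "cube_integral \<rho> (\<lambda>x. sqrt (2 * w (v x)) * grad v x $ k) =
    \<rho> ^ (CARD('n) - 1) * (G (q (\<rho> / 2 / \<epsilon>)) - G (q (- \<rho> / 2 / \<epsilon>)))" using eq by simp
  have "cube_integral \<rho> (\<lambda>x. sqrt (2 * w (v x)) * grad v x $ k) \<le> cube_integral \<rho> (\<lambda>x. \<epsilon> / 2 * (norm (grad v x))\<^sup>2 + 1 / \<epsilon> * w (v x))"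
  proof (rule cube_integral_mono[OF cu[OF sv]])
    show "continuous_on UNIV (\<lambda>x. \<epsilon> / 2 * (norm (grad v x))\<^sup>2 + 1 / \<epsilon> * w (v x))"
      by (intro continuous_intros continuous_on_compose2[OF cw] smooth_continuous_on sv continuous_on_grad) auto
    fix x
    let ?a = "norm (grad v x)" and ?b = "sqrt (2 * w (v x))"
    have "?b * grad v x $ k \<le> ?b * ?a"
      using w0 component_le_norm_cart[of "grad v x" k] by (intro mult_left_mono) auto
    also have "\<dots> \<le> \<epsilon> / 2 * ?a\<^sup>2 + 1 / (2 * \<epsilon>) * ?b\<^sup>2"
    proof -
      have "0 \<le> (\<epsilon> * ?a - ?b)\<^sup>2 / (2 * \<epsilon>)" using \<epsilon> by simp
      also have "\<dots> = \<epsilon> / 2 * ?a\<^sup>2 + 1 / (2 * \<epsilon>) * ?b\<^sup>2 - ?b * ?a"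
        using \<epsilon> by (simp add: power2_diff power_mult_distrib field_simps power2_eq_square del: real_sqrt_mult_self real_sqrt_power)
      finally show ?thesis by simp
    qed
    also have "1 / (2 * \<epsilon>) * ?b\<^sup>2 = 1 / \<epsilon> * w (v x)"
      using w0 \<epsilon> by simp
    finally show "?b * grad v x $ k \<le> \<epsilon> / 2 * ?a\<^sup>2 + 1 / \<epsilon> * w (v x)" .
  qed
  then show ?thesis by (simp only: bdry)
qed

text \<open>First the shell, where the integrand may jump by K; then the share of the gradient error
  that the energy cannot absorb.\<close>

definition homog_error :: "real \<Rightarrow> real \<Rightarrow> real \<Rightarrow> real \<Rightarrow> real \<Rightarrow> real" where
  "homog_error K L \<rho> \<epsilon> \<delta> = \<Theta> * K * shell_const TYPE('n) \<rho> * (\<delta> / \<epsilon>) + \<Theta> * L * CARD('n) * \<rho> ^ CARD('n) / 2 * (\<delta> / \<epsilon>\<^sup>2)"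

lemma energy_lower_bound_smooth:
  fixes \<phi> :: "real^'n \<Rightarrow> real" and w q G :: "real \<Rightarrow> real" and k :: 'n
  assumes w0: "\<And>s. 0 \<le> w s" and wK: "\<And>s. w s \<le> K" and wL: "\<And>s t. \<bar>w s - w t\<bar> \<le> L * \<bar>s - t\<bar>"
    and cw: "continuous_on UNIV w"
    and G: "\<And>s. (G has_real_derivative sqrt (2 * w s)) (at s)"
    and q: "smooth q" and \<phi>: "test_function (interior (cube \<rho>)) \<phi>" and \<epsilon>: "\<epsilon> > 0" and \<rho>: "\<rho> > 0"
    and v: "\<And>x. v x = q (x $ k / \<epsilon>) + \<phi> x"
    and \<delta>: "\<delta> > 0" "2 * \<delta> \<le> \<rho>" and small: "\<Theta> * L * CARD('n) * (\<delta> / \<epsilon>) \<le> 1"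
  shows "(1 - \<Theta> * L * CARD('n) * (\<delta> / \<epsilon>)) * (\<rho> ^ (CARD('n) - 1) * (G (q (\<rho> / 2 / \<epsilon>)) - G (q (- \<rho> / 2 / \<epsilon>))))
      - homog_error K L \<rho> \<epsilon> \<delta>
    \<le> cube_integral \<rho> (\<lambda>x. \<epsilon> / 2 * (norm (grad v x))\<^sup>2 + 1 / \<epsilon> * \<theta> (x /\<^sub>R \<delta>) * w (v x))"
proof -
  let ?\<kappa> = "\<Theta> * L * CARD('n) * (\<delta> / \<epsilon>)"
  let ?I = "cube_integral \<rho> :: (real^'n \<Rightarrow> real) \<Rightarrow> real"
  have L0: "L \<ge> 0" using wL by (rule lipschitz_const_nonneg)
  have k0: "?\<kappa> \<ge> 0" using L0 \<delta> \<epsilon> bound_pos by simp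
  have sv: "smooth v"
  proof -
    have "smooth (\<lambda>t. q (t / \<epsilon>))" by (rule smooth_scaled(2)[OF q])
    from smooth_add[OF smooth_comp[OF this smooth_vec_nth[of k]] test_function_smooth[OF \<phi>]]
    show ?thesis by (simp add: v[abs_def])
  qed
  have cg: "continuous_on UNIV (\<lambda>x. norm (grad v x))"
    by (intro continuous_on_norm continuous_on_grad sv)
  have cg2: "continuous_on UNIV (\<lambda>x. \<epsilon> / 2 * (norm (grad v x))\<^sup>2)"
    by (intro continuous_intros cg)
  have cwv: "continuous_on UNIV (\<lambda>x. w (v x))"
    using continuous_on_compose2[OF cw smooth_continuous_on[OF sv]] by auto
  have cth: "continuous_on UNIV (\<lambda>x. \<theta> (x /\<^sub>R \<delta>))"
    by (intro continuous_on_compose2[OF cont]) (auto intro!: continuous_intros)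
  define P where "P = ?I (\<lambda>x. \<epsilon> / 2 * (norm (grad v x))\<^sup>2)"
  define A where "A = ?I (\<lambda>x. w (v x) * \<theta> (x /\<^sub>R \<delta>))"
  define B where "B = ?I (\<lambda>x. w (v x))"
  define D where "D = ?I (\<lambda>x. norm (grad v x))"
  have B0: "B \<ge> 0" unfolding B_def by (rule cube_integral_nonneg) (rule w0)
  have BA: "B \<le> A + \<Theta> * (K * shell_const TYPE('n) \<rho> * \<delta> + L * \<delta> * CARD('n) * D)"
    unfolding A_def B_def D_def by (rule homogenization_smooth[OF sv w0 wK wL \<delta>])
  \<comment> \<open>Arithmetic-geometric mean inequality in the form
    \<open>a \<le> \<epsilon> / 2 * a\<^sup>2 + 1 / (2 * \<epsilon>)\<close>. Its constant term is
    the source of \<open>\<delta> / \<epsilon>\<^sup>2\<close>.\<close>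
  have DP: "D \<le> P + \<rho> ^ CARD('n) / (2 * \<epsilon>)"
  proof -
    have "D \<le> ?I (\<lambda>x. \<epsilon> / 2 * (norm (grad v x))\<^sup>2 + 1 / (2 * \<epsilon>))"
      unfolding D_def
    proof (rule cube_integral_mono[OF cg])
      fix x
      let ?a = "norm (grad v x)"
      have "0 \<le> (\<epsilon> * ?a - 1)\<^sup>2 / (2 * \<epsilon>)" using \<epsilon> by simp
      also have "\<dots> = \<epsilon> / 2 * ?a\<^sup>2 + 1 / (2 * \<epsilon>) - ?a"
        using \<epsilon> by (simp add: power2_diff power_mult_distrib field_simps power2_eq_square)
      finally show "?a \<le> \<epsilon> / 2 * ?a\<^sup>2 + 1 / (2 * \<epsilon>)" by simp
    qed (intro continuous_intros cg)
    also have "\<dots> = P + ?I (\<lambda>x. 1 / (2 * \<epsilon>))"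
      unfolding P_def by (intro cube_integral_add cg2 continuous_intros)
    finally show ?thesis using \<rho> by (simp add: cube_integral_const)
  qed
  have split: "?I (\<lambda>x. \<epsilon> / 2 * (norm (grad v x))\<^sup>2 + 1 / \<epsilon> * \<theta> (x /\<^sub>R \<delta>) * w (v x)) = P + 1 / \<epsilon> * A"
  proof -
    have "?I (\<lambda>x. \<epsilon> / 2 * (norm (grad v x))\<^sup>2 + 1 / \<epsilon> * (w (v x) * \<theta> (x /\<^sub>R \<delta>))) = P + ?I (\<lambda>x. 1 / \<epsilon> * (w (v x) * \<theta> (x /\<^sub>R \<delta>)))"
      unfolding P_def by (intro cube_integral_add cg2 continuous_intros cwv cth)
    then show ?thesis unfolding A_def by (simp add: cube_integral_cmult[of \<rho> "1 / \<epsilon>", simplified] mult.commute[of "\<theta> _"])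
  qed
  have MM: "\<rho> ^ (CARD('n) - 1) * (G (q (\<rho> / 2 / \<epsilon>)) - G (q (- \<rho> / 2 / \<epsilon>))) \<le> P + 1 / \<epsilon> * B"
  proof -
    have "?I (\<lambda>x. \<epsilon> / 2 * (norm (grad v x))\<^sup>2 + 1 / \<epsilon> * w (v x)) = P + ?I (\<lambda>x. 1 / \<epsilon> * w (v x))"
      unfolding P_def by (intro cube_integral_add cg2 continuous_intros cwv)
    also have "\<dots> = P + 1 / \<epsilon> * B" unfolding B_def by (simp only: cube_integral_cmult)
    finally show ?thesis using modica_mortola_smooth[OF w0 cw G q \<phi> \<epsilon> \<rho> v] by simp
  qed
  \<comment> \<open>Giving up the factor \<open>1 - ?\<kappa>\<close> frees the amount
    \<open>?\<kappa> * P\<close>, which pays for the gradient part of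
    \<open>?\<kappa> * D\<close>.\<close>
  have "(1 - ?\<kappa>) * (\<rho> ^ (CARD('n) - 1) * (G (q (\<rho> / 2 / \<epsilon>)) - G (q (- \<rho> / 2 / \<epsilon>)))) \<le> (1 - ?\<kappa>) * (P + 1 / \<epsilon> * B)"
    using small by (intro mult_left_mono MM) simp
  also have "\<dots> \<le> P + 1 / \<epsilon> * B - ?\<kappa> * P"
  proof -
    have *: "(1 - a) * (p + b) \<le> p + b - a * p" if "a * b \<ge> 0" for a p b :: real
      using that by (simp add: algebra_simps)
    have "?\<kappa> * (1 / \<epsilon> * B) \<ge> 0" using B0 \<epsilon> by (intro mult_nonneg_nonneg[OF k0]) auto
    then show ?thesis by (rule *)
  qed
  also have "\<dots> \<le> P + 1 / \<epsilon> * A + \<Theta> * (K * shell_const TYPE('n) \<rho> * \<delta> + L * \<delta> * CARD('n) * D) / \<epsilon> - ?\<kappa> * P"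
  proof -
    have "B / \<epsilon> \<le> (A + \<Theta> * (K * shell_const TYPE('n) \<rho> * \<delta> + L * \<delta> * CARD('n) * D)) / \<epsilon>"
      using BA \<epsilon> by (intro divide_right_mono) auto
    then show ?thesis by (simp add: add_divide_distrib)
  qed
  also have "\<Theta> * (K * shell_const TYPE('n) \<rho> * \<delta> + L * \<delta> * CARD('n) * D) / \<epsilon> =
      \<Theta> * K * shell_const TYPE('n) \<rho> * (\<delta> / \<epsilon>) + ?\<kappa> * D"
    using \<epsilon> by (simp add: field_simps)
  also have "P + 1 / \<epsilon> * A + (\<Theta> * K * shell_const TYPE('n) \<rho> * (\<delta> / \<epsilon>) + ?\<kappa> * D) - ?\<kappa> * P \<le>
      P + 1 / \<epsilon> * A + \<Theta> * K * shell_const TYPE('n) \<rho> * (\<delta> / \<epsilon>) + ?\<kappa> * (\<rho> ^ CARD('n) / (2 * \<epsilon>))"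
    using mult_left_mono[OF DP k0] by (simp add: algebra_simps)
  also have "\<dots> = P + 1 / \<epsilon> * A + homog_error K L \<rho> \<epsilon> \<delta>"
    using \<epsilon> by (simp add: homog_error_def field_simps power2_eq_square)
  finally show ?thesis unfolding split by simp
qed

end

section \<open>Square integrable and weakly differentiable functions on the cube\<close>

lemma AE_interior_cube: "AE x in lebesgue_on (cube \<rho>). x \<in> interior (cube \<rho> :: (real^'n) set)"
proof -
  have "negligible (cube \<rho> - interior (cube \<rho>) :: (real^'n) set)"
    unfolding cube_def interior_cbox by (rule negligible_frontier_interval)
  then have "cube \<rho> - interior (cube \<rho>) \<in> null_sets (lebesgue :: (real^'n) measure)"
    by (simp add: negligible_iff_null_sets)
  then have "AE x::real^'n in lebesgue. x \<notin> cube \<rho> - interior (cube \<rho>)" by (rule AE_not_in)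
  then have "AE x::real^'n in lebesgue. x \<in> cube \<rho> \<longrightarrow> x \<in> interior (cube \<rho>)"
    by eventually_elim auto
  then show ?thesis
    by (subst AE_restrict_space_iff) (auto intro: sets_completionI_sets)
qed

lemma integrable_lebesgue_on_cube:
  fixes f :: "real^'n \<Rightarrow> 'b::euclidean_space"
  shows "continuous_on UNIV f \<Longrightarrow> integrable (lebesgue_on (cube \<rho>)) f"
  unfolding cube_def by (rule continuous_imp_integrable) (rule continuous_on_subset, auto)

lemma measurable_lebesgue_on_cube:
  fixes f :: "real^'n \<Rightarrow> 'b::euclidean_space"
  shows "continuous_on UNIV f \<Longrightarrow> f \<in> borel_measurable (lebesgue_on (cube \<rho>))"
  by (rule borel_measurable_integrable[OF integrable_lebesgue_on_cube])

lemma integral_lebesgue_on_cube: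
  fixes f :: "real^'n \<Rightarrow> real"
  shows "continuous_on UNIV f \<Longrightarrow> (LINT x|lebesgue_on (cube \<rho>). f x) = cube_integral \<rho> f"
  unfolding cube_integral_def by (simp add: integral_lebesgue_on_borel borel_measurable_continuous_onI)

lemma finite_measure_cube: "finite_measure (lebesgue_on (cube \<rho> :: (real^'n) set))"
  by (rule finite_measureI) (use emeasure_lborel_cbox_finite in \<open>auto simp: cube_def emeasure_restrict_space less_top[symmetric]\<close>)

lemma L2_on_continuous:
  fixes f :: "real^'n \<Rightarrow> 'b::euclidean_space"
  shows "continuous_on UNIV f \<Longrightarrow> L2_on (cube \<rho>) f"
  unfolding L2_on_def
  by (intro conjI measurable_lebesgue_on_cube integrable_lebesgue_on_cube) (auto intro!: continuous_intros)

lemma L2_on_nth: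
  fixes f :: "real^'n \<Rightarrow> real^'m"
  assumes "L2_on U f"
  shows "L2_on U (\<lambda>x. f x $ i)"
  unfolding L2_on_def
proof
  have [measurable]: "f \<in> borel_measurable (lebesgue_on U)" using assms by (simp add: L2_on_def)
  show m: "(\<lambda>x. f x $ i) \<in> borel_measurable (lebesgue_on U)"
    by (rule measurable_compose[OF _ borel_measurable_continuous_onI]) (auto intro!: continuous_intros)
  then have [measurable]: "(\<lambda>x. f x $ i) \<in> borel_measurable (lebesgue_on U)" .
  show "integrable (lebesgue_on U) (\<lambda>x. (norm (f x $ i))\<^sup>2)"
  proof (rule Bochner_Integration.integrable_bound)
    show "integrable (lebesgue_on U) (\<lambda>x. (norm (f x))\<^sup>2)" using assms by (simp add: L2_on_def)
    show "AE x in lebesgue_on U. norm ((norm (f x $ i))\<^sup>2) \<le> norm ((norm (f x))\<^sup>2)"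
    proof (rule AE_I2)
      fix x
      have "(norm (f x $ i))\<^sup>2 \<le> (norm (f x))\<^sup>2"
        by (rule power_mono) (simp_all add: component_le_norm_cart)
      then show "norm ((norm (f x $ i))\<^sup>2) \<le> norm ((norm (f x))\<^sup>2)" by simp
    qed
  qed measurable
qed

lemma L2_on_add_scale:
  fixes f g :: "real^'n \<Rightarrow> 'b::euclidean_space"
  assumes "L2_on U f" "L2_on U g"
  shows "L2_on U (\<lambda>x. f x + c *\<^sub>R g x)"
  unfolding L2_on_def
proof
  have [measurable]: "f \<in> borel_measurable (lebesgue_on U)" "g \<in> borel_measurable (lebesgue_on U)"
    using assms by (simp_all add: L2_on_def)
  show m: "(\<lambda>x. f x + c *\<^sub>R g x) \<in> borel_measurable (lebesgue_on U)" by measurable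
  show "integrable (lebesgue_on U) (\<lambda>x. (norm (f x + c *\<^sub>R g x))\<^sup>2)"
  proof (rule Bochner_Integration.integrable_bound)
    show "integrable (lebesgue_on U) (\<lambda>x. 2 * (norm (f x))\<^sup>2 + 2 * c\<^sup>2 * (norm (g x))\<^sup>2)"
      using assms by (simp add: L2_on_def)
    show "AE x in lebesgue_on U. norm ((norm (f x + c *\<^sub>R g x))\<^sup>2) \<le> norm (2 * (norm (f x))\<^sup>2 + 2 * c\<^sup>2 * (norm (g x))\<^sup>2)"
    proof (rule AE_I2)
      fix x
      have "(norm (f x + c *\<^sub>R g x))\<^sup>2 \<le> (norm (f x) + norm (c *\<^sub>R g x))\<^sup>2"
        by (intro power_mono norm_triangle_ineq) simp
      also have "\<dots> \<le> 2 * (norm (f x))\<^sup>2 + 2 * (norm (c *\<^sub>R g x))\<^sup>2"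
        using sum_squares_bound[of "norm (f x)" "norm (c *\<^sub>R g x)"] by (simp add: power2_sum)
      also have "\<dots> = 2 * (norm (f x))\<^sup>2 + 2 * c\<^sup>2 * (norm (g x))\<^sup>2"
        by (simp add: power_mult_distrib)
      finally show "norm ((norm (f x + c *\<^sub>R g x))\<^sup>2) \<le> norm (2 * (norm (f x))\<^sup>2 + 2 * c\<^sup>2 * (norm (g x))\<^sup>2)"
        by simp
    qed
  qed measurable
qed

lemma L2_on_diff:
  fixes f g :: "real^'n \<Rightarrow> 'b::euclidean_space"
  shows "L2_on U f \<Longrightarrow> L2_on U g \<Longrightarrow> L2_on U (\<lambda>x. f x - g x)"
  using L2_on_add_scale[of U f g "-1"] by simp

lemma L2_on_mult_integrable:
  fixes f g :: "real^'n \<Rightarrow> real"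
  assumes "L2_on U f" "L2_on U g"
  shows "integrable (lebesgue_on U) (\<lambda>x. f x * g x)"
proof (rule Bochner_Integration.integrable_bound)
  have [measurable]: "f \<in> borel_measurable (lebesgue_on U)" "g \<in> borel_measurable (lebesgue_on U)"
    using assms by (simp_all add: L2_on_def)
  show "(\<lambda>x. f x * g x) \<in> borel_measurable (lebesgue_on U)" by measurable
  show "integrable (lebesgue_on U) (\<lambda>x. (norm (f x))\<^sup>2 + (norm (g x))\<^sup>2)"
    using assms by (simp add: L2_on_def)
  show "AE x in lebesgue_on U. norm (f x * g x) \<le> norm ((norm (f x))\<^sup>2 + (norm (g x))\<^sup>2)"
  proof (rule AE_I2)
    fix x
    have "2 * \<bar>f x\<bar> * \<bar>g x\<bar> \<le> \<bar>f x\<bar>\<^sup>2 + \<bar>g x\<bar>\<^sup>2" by (rule sum_squares_bound)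
    moreover have "0 \<le> \<bar>f x\<bar> * \<bar>g x\<bar>" by simp
    ultimately show "norm (f x * g x) \<le> norm ((norm (f x))\<^sup>2 + (norm (g x))\<^sup>2)"
      unfolding real_norm_def abs_mult abs_of_nonneg[OF add_nonneg_nonneg[OF zero_le_power2 zero_le_power2]] by linarith
  qed
qed

lemma test_function_outside_cube:
  assumes "test_function (interior (cube \<rho>)) \<phi>" "x \<notin> cube \<rho>"
  shows "\<phi> x = 0" "grad \<phi> x = (0 :: real^'n)"
  using test_function_grad_zero[OF assms(1)] assms(2) interior_subset by blast+

text \<open>The product of h with a test function has compact support, so its derivatives integrate
  to 0. Hence the classical gradient of a smooth function is a weak gradient, whatever the boundary
  values.\<close>

lemma integral_by_parts_test_function:
  fixes h \<phi> :: "real^'n \<Rightarrow> real"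
  assumes h: "smooth h" and \<phi>: "test_function (interior (cube \<rho>)) \<phi>"
  shows "(LINT x|lebesgue_on (cube \<rho>). h x * grad \<phi> x $ i) = - (LINT x|lebesgue_on (cube \<rho>). grad h x $ i * \<phi> x)"
proof -
  have s: "smooth \<phi>" using \<phi> by (rule test_function_smooth)
  have t: "test_function (interior (cube \<rho>)) (\<lambda>x. h x * \<phi> x)" by (rule test_function_mult[OF h \<phi>])
  have gr: "frechet_derivative (\<lambda>x. h x * \<phi> x) (at x) (axis i 1) = h x * grad \<phi> x $ i + grad h x $ i * \<phi> x" for x
    by (subst frechet_eq_grad)
      (simp_all add: smooth_differentiable smooth_mult h s grad_mult inner_axis mult.commute)
  have c: "continuous_on UNIV (\<lambda>x. h x * grad \<phi> x $ i)" "continuous_on UNIV (\<lambda>x. grad h x $ i * \<phi> x)"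
    by (intro continuous_on_mult smooth_continuous_on h s smooth_grad)+
  obtain r where r: "r > 0" "\<forall>x\<in>cube \<rho> :: (real^'n) set. norm x \<le> r"
    using bounded_cbox unfolding cube_def bounded_pos by blast
  have "(LINT x|lborel. frechet_derivative (\<lambda>x. h x * \<phi> x) (at x) (axis i 1)) = 0"
  proof (rule integral_frechet_derivative_zero[where r = "r + 1"])
    show "h x * \<phi> x = 0" if "r + 1 \<le> norm x" for x
      using test_function_outside_cube(1)[OF \<phi>, of x] r(2) that by force
  qed (use r smooth_mult[OF h s] in \<open>auto intro: smooth_differentiable smooth_continuous_on smooth_frechet\<close>)
  also have "(LINT x|lborel. frechet_derivative (\<lambda>x. h x * \<phi> x) (at x) (axis i 1)) =
      cube_integral \<rho> (\<lambda>x. h x * grad \<phi> x $ i + grad h x $ i * \<phi> x)"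
    unfolding cube_integral_def gr
    using test_function_outside_cube[OF \<phi>] by (intro Bochner_Integration.integral_cong) (auto simp: indicator_def)
  also have "\<dots> = cube_integral \<rho> (\<lambda>x. h x * grad \<phi> x $ i) + cube_integral \<rho> (\<lambda>x. grad h x $ i * \<phi> x)"
    by (rule cube_integral_add[OF c])
  finally show ?thesis using c by (simp add: integral_lebesgue_on_cube)
qed

lemma H1_smooth:
  fixes h :: "real^'n \<Rightarrow> real"
  assumes "smooth h"
  shows "H1 (cube \<rho>) h (grad h)"
  unfolding H1_def
  using L2_on_continuous[OF smooth_continuous_on[OF assms]] L2_on_continuous[OF continuous_on_grad[OF assms]]
    integral_by_parts_test_function[OF assms] by blast

lemma H1_diff:
  assumes "H1 (cube \<rho>) u Du" "H1 (cube \<rho>) v Dv"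
  shows "H1 (cube \<rho>) (\<lambda>x. u x - v x) (\<lambda>x. Du x - Dv x :: real^'n)"
  unfolding H1_def
proof (intro conjI allI impI)
  fix \<phi> :: "real^'n \<Rightarrow> real" and i assume t: "test_function (interior (cube \<rho>)) \<phi>"
  have s: "smooth \<phi>" using t by (rule test_function_smooth)
  have l: "L2_on (cube \<rho>) \<phi>" "L2_on (cube \<rho>) (\<lambda>x. grad \<phi> x $ i)"
    by (intro L2_on_continuous smooth_continuous_on s smooth_grad)+
  have I: "integrable (lebesgue_on (cube \<rho>)) (\<lambda>x. u x * grad \<phi> x $ i)" "integrable (lebesgue_on (cube \<rho>)) (\<lambda>x. v x * grad \<phi> x $ i)"
    "integrable (lebesgue_on (cube \<rho>)) (\<lambda>x. Du x $ i * \<phi> x)" "integrable (lebesgue_on (cube \<rho>)) (\<lambda>x. Dv x $ i * \<phi> x)"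
    using assms l by (auto simp: H1_def intro!: L2_on_mult_integrable L2_on_nth)
  show "(LINT x|lebesgue_on (cube \<rho>). (u x - v x) * grad \<phi> x $ i) = - (LINT x|lebesgue_on (cube \<rho>). (Du x - Dv x) $ i * \<phi> x)"
    using assms t I by (simp add: H1_def left_diff_distrib)
qed (use assms in \<open>auto simp: H1_def intro!: L2_on_diff\<close>)

text \<open>The products of f with cut-offs are test functions and converge to f in the interior,
  while the faces form a null set. Applied to a weak gradient of 0, this takes the place of the
  uniqueness of weak gradients.\<close>

lemma weak_zero_orthogonal:
  fixes g f :: "real^'n \<Rightarrow> real"
  assumes g: "L2_on (cube \<rho>) g"
    and orth: "\<And>\<phi>. test_function (interior (cube \<rho>)) \<phi> \<Longrightarrow> (LINT x|lebesgue_on (cube \<rho>). g x * \<phi> x) = 0"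
    and f: "smooth f"
  shows "(LINT x|lebesgue_on (cube \<rho>). g x * f x) = 0"
proof -
  let ?M = "lebesgue_on (cube \<rho>) :: (real^'n) measure"
  have [measurable]: "g \<in> borel_measurable ?M" using g by (simp add: L2_on_def)
  have [measurable]: "f \<in> borel_measurable ?M" using f by (intro measurable_lebesgue_on_cube smooth_continuous_on)
  have [measurable]: "cutoff \<rho> \<tau> \<in> borel_measurable ?M" for \<tau>
    by (intro measurable_lebesgue_on_cube smooth_continuous_on smooth_cutoff)
  let ?c = "\<lambda>j. cutoff \<rho> (1 / real (Suc j))"
  have "(\<lambda>j. LINT x|?M. g x * (f x * ?c j x)) \<longlonglongrightarrow> (LINT x|?M. g x * f x)"
  proof (rule integral_dominated_convergence[where w = "\<lambda>x. \<bar>g x * f x\<bar>"])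
    show "integrable ?M (\<lambda>x. \<bar>g x * f x\<bar>)"
      by (intro integrable_abs L2_on_mult_integrable g L2_on_continuous smooth_continuous_on f)
    show "AE x in ?M. (\<lambda>j. g x * (f x * ?c j x)) \<longlonglongrightarrow> g x * f x"
      using AE_interior_cube
    proof eventually_elim
      case (elim x)
      \<comment> \<open>The distance to the nearest face; the cut-off is 1 at x once its width is
        below d / 2.\<close>
      define d where "d = Min (range (\<lambda>i. \<rho> / 2 - \<bar>x $ i\<bar>))"
      have d: "d \<le> \<rho> / 2 - \<bar>x $ i\<bar>" for i unfolding d_def by (intro Min_le) auto
      have "d > 0" unfolding d_def using elim by (subst Min_gr_iff) (auto simp: mem_interior_cube)
      then have "\<forall>\<^sub>F j in sequentially. 1 / real (Suc j) < d / 2"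
        by (intro order_tendstoD(2)[OF LIMSEQ_Suc[OF lim_1_over_n]]) simp
      then have "\<forall>\<^sub>F j in sequentially. g x * f x = g x * (f x * ?c j x)"
      proof eventually_elim
        case (elim j)
        have "?c j x = 1"
        proof (rule cutoff_eq_1)
          show "\<bar>x $ i\<bar> \<le> \<rho> / 2 - 2 * (1 / real (Suc j))" for i
            using d[of i] elim by linarith
        qed simp
        then show ?case by simp
      qed
      then show ?case by (rule tendsto_eventually[OF eventually_mono]) simp
    qed
    show "AE x in ?M. norm (g x * (f x * ?c j x)) \<le> \<bar>g x * f x\<bar>" for j
    proof (rule AE_I2)
      fix x
      have "\<bar>g x * f x\<bar> * \<bar>?c j x\<bar> \<le> \<bar>g x * f x\<bar> * 1"
        by (intro mult_left_mono) (auto simp: cutoff_nonneg cutoff_le_1)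
      then show "norm (g x * (f x * ?c j x)) \<le> \<bar>g x * f x\<bar>" by (simp add: abs_mult)
    qed
  qed measurable
  moreover have "(LINT x|?M. g x * (f x * ?c j x)) = 0" for j
    by (intro orth test_function_mult f test_function_cutoff) simp
  ultimately show ?thesis by (simp add: LIMSEQ_const_iff)
qed

context periodic_weight
begin

text \<open>\<open>u\<close> is approximated by \<open>v = h + \<phi>\<close>. The weak gradient is \<open>\<nabla>v + e + g\<close> with \<open>e\<close> small in \<open>L\<^sup>2\<close>
  and \<open>g\<close> a weak gradient of \<open>0\<close>; since \<open>g\<close> is orthogonal to \<open>\<nabla>v\<close>, its vanishing is not needed.\<close>
lemma energy_lower_bound_H1:
  fixes u h :: "real^'n \<Rightarrow> real" and w :: "real \<Rightarrow> real"
  assumes u: "H1 (cube \<rho>) u Du" and bd: "eq_on_boundary (cube \<rho>) u h" and h: "smooth h"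
    and w0: "\<And>s. 0 \<le> w s" and wK: "\<And>s. w s \<le> K" and wL: "\<And>s t. \<bar>w s - w t\<bar> \<le> L * \<bar>s - t\<bar>"
    and cw: "continuous_on UNIV w" and \<epsilon>: "\<epsilon> > 0" and \<rho>: "\<rho> > 0"
    and low: "\<And>\<phi>. test_function (interior (cube \<rho>)) \<phi> \<Longrightarrow>
      low \<le> cube_integral \<rho> (\<lambda>x. \<epsilon> / 2 * (norm (grad (\<lambda>x. h x + \<phi> x) x))\<^sup>2 + 1 / \<epsilon> * \<theta> (x /\<^sub>R \<delta>) * w (h x + \<phi> x))"
  shows "ennreal low \<le> (\<integral>\<^sup>+x. ennreal (\<epsilon> / 2 * (norm (Du x))\<^sup>2 + 1 / \<epsilon> * \<theta> (x /\<^sub>R \<delta>) * w (u x)) \<partial>lebesgue_on (cube \<rho>))"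
proof -
  let ?M = "lebesgue_on (cube \<rho>) :: (real^'n) measure"
  interpret M: finite_measure ?M by (rule finite_measure_cube)
  obtain Dw \<phi> where Dw: "H1 (cube \<rho>) (\<lambda>x. u x - h x) Dw"
    and t: "\<And>m. test_function (interior (cube \<rho>)) (\<phi> m)"
    and lim1: "(\<lambda>m. LINT x|?M. (u x - h x - \<phi> m x)\<^sup>2) \<longlonglongrightarrow> 0"
    and lim2: "(\<lambda>m. LINT x|?M. (norm (Dw x - grad (\<phi> m) x))\<^sup>2) \<longlonglongrightarrow> 0"
    using bd unfolding eq_on_boundary_def H1_0_def by auto
  have s\<phi>: "smooth (\<phi> m)" for m using t by (rule test_function_smooth)
  define g where "g x = Du x - Dw x - grad h x" for x
  define v where "v m = (\<lambda>x. h x + \<phi> m x)" for m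
  define e where "e m x = Dw x - grad (\<phi> m) x" for m x
  have sv: "smooth (v m)" for m unfolding v_def by (intro smooth_add h s\<phi>)
  have gv: "grad (v m) x = grad h x + grad (\<phi> m) x" for m x
    unfolding v_def by (intro grad_add smooth_differentiable h s\<phi>)
  have Du: "Du x = grad (v m) x + (e m x + g x)" for m x by (simp add: gv e_def g_def)
  \<comment> \<open>\<open>Dw\<close> comes with the boundary condition and \<open>Du\<close> with
    u. Since \<open>Dw\<close> and \<open>Du x - grad h x\<close> are weak gradients of the same
    function, their difference g is one of 0.\<close>
  have "H1 (cube \<rho>) (\<lambda>x. u x - (u x - h x) - h x) g"
    unfolding g_def by (intro H1_diff u Dw H1_smooth h)
  then have H0: "H1 (cube \<rho>) (\<lambda>x. 0) g" by simp
  then have gL2: "L2_on (cube \<rho>) g" by (simp add: H1_def)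
  have orth: "(LINT x|?M. g x $ i * f x) = 0" if "smooth f" for f i
    by (rule weak_zero_orthogonal[OF L2_on_nth[OF gL2] _ that]) (use H0 in \<open>simp add: H1_def\<close>)
  have uL2: "L2_on (cube \<rho>) u" "L2_on (cube \<rho>) Du" "L2_on (cube \<rho>) Dw"
    using u Dw by (simp_all add: H1_def)
  have hL2: "L2_on (cube \<rho>) h" by (intro L2_on_continuous smooth_continuous_on h)
  have aL2: "L2_on (cube \<rho>) (\<lambda>x. u x - h x - \<phi> m x)" for m
    by (intro L2_on_diff uL2 hL2 L2_on_continuous smooth_continuous_on s\<phi>)
  have eL2: "L2_on (cube \<rho>) (e m)" for m
    unfolding e_def by (intro L2_on_diff uL2 L2_on_continuous continuous_on_grad s\<phi>)
  have cth: "continuous_on UNIV (\<lambda>x. \<theta> (x /\<^sub>R \<delta>))"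
    by (intro continuous_on_compose2[OF cont]) (auto intro!: continuous_intros)
  have [measurable]: "u \<in> borel_measurable ?M" "w \<in> borel_measurable borel" "(\<lambda>x. \<theta> (x /\<^sub>R \<delta>)) \<in> borel_measurable ?M"
    using uL2(1) cw cth by (auto simp: L2_on_def intro: borel_measurable_continuous_onI measurable_lebesgue_on_cube)
  have L0: "L \<ge> 0" using wL by (rule lipschitz_const_nonneg)
  define J where "J = (LINT x|?M. \<epsilon> / 2 * (norm (Du x))\<^sup>2 + 1 / \<epsilon> * \<theta> (x /\<^sub>R \<delta>) * w (u x))"
  have iJ: "integrable ?M (\<lambda>x. \<epsilon> / 2 * (norm (Du x))\<^sup>2 + 1 / \<epsilon> * \<theta> (x /\<^sub>R \<delta>) * w (u x))"
  proof (intro Bochner_Integration.integrable_add)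
    show "integrable ?M (\<lambda>x. \<epsilon> / 2 * (norm (Du x))\<^sup>2)" using uL2(2) by (simp add: L2_on_def)
    show "integrable ?M (\<lambda>x. 1 / \<epsilon> * \<theta> (x /\<^sub>R \<delta>) * w (u x))"
    proof (rule M.integrable_const_bound[where B = "1 / \<epsilon> * \<Theta> * K"])
      show "AE x in ?M. norm (1 / \<epsilon> * \<theta> (x /\<^sub>R \<delta>) * w (u x)) \<le> 1 / \<epsilon> * \<Theta> * K"
      proof (rule AE_I2)
        fix x
        have "norm (1 / \<epsilon> * \<theta> (x /\<^sub>R \<delta>) * w (u x)) = 1 / \<epsilon> * \<theta> (x /\<^sub>R \<delta>) * w (u x)"
          using w0[of "u x"] pos[of "x /\<^sub>R \<delta>"] \<epsilon> by simp
        also have "\<dots> \<le> 1 / \<epsilon> * \<Theta> * K"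
          using w0 pos bound wK bound_pos \<epsilon> by (intro mult_mono mult_left_mono) (auto simp: less_imp_le)
        finally show "norm (1 / \<epsilon> * \<theta> (x /\<^sub>R \<delta>) * w (u x)) \<le> 1 / \<epsilon> * \<Theta> * K" .
      qed
    qed measurable
  qed
  let ?F = "\<lambda>m x. \<epsilon> / 2 * (norm (grad (v m) x))\<^sup>2 + 1 / \<epsilon> * \<theta> (x /\<^sub>R \<delta>) * w (v m x)"
  let ?V = "measure ?M (space ?M)"
  have cF: "continuous_on UNIV (?F m)" for m
    by (intro continuous_intros continuous_on_compose2[OF cw] smooth_continuous_on sv continuous_on_grad cth) auto
  \<comment> \<open>l is the parameter of two Young inequalities, one for the cross term with e, one
    for the distance between u and \<open>v m\<close>.\<close>
  have ineq: "(1 - l) * low - \<epsilon> / (2 * l) * (LINT x|?M. (norm (e m x))\<^sup>2)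
      - \<Theta> * L / \<epsilon> * (l * ?V + 1 / l * (LINT x|?M. (u x - h x - \<phi> m x)\<^sup>2)) \<le> J"
    if l: "0 < l" "l < 1" for l m
  proof -
    let ?a = "\<lambda>x. u x - h x - \<phi> m x"
    let ?R = "\<lambda>x. (1 - l) * ?F m x + \<epsilon> * (\<Sum>i\<in>UNIV. g x $ i * grad (v m) x $ i) - \<epsilon> / (2 * l) * (norm (e m x))\<^sup>2
      - \<Theta> * L / \<epsilon> * (l + 1 / l * (?a x)\<^sup>2)"
    have point: "?R x \<le> \<epsilon> / 2 * (norm (Du x))\<^sup>2 + 1 / \<epsilon> * \<theta> (x /\<^sub>R \<delta>) * w (u x)" for x
    proof -
      \<comment> \<open>The square of e + g is dropped; the cross term with g disappears after
        integration.\<close>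
      have "(norm (Du x))\<^sup>2 = (norm (grad (v m) x))\<^sup>2 + (norm (e m x + g x))\<^sup>2 + 2 * (grad (v m) x \<bullet> (e m x + g x))"
        unfolding Du[of x m] by (simp only: power2_norm_eq_inner inner_add_left inner_add_right inner_commute) simp
      then have "(norm (Du x))\<^sup>2 \<ge> (norm (grad (v m) x))\<^sup>2 + 2 * (grad (v m) x \<bullet> e m x) + 2 * (grad (v m) x \<bullet> g x)"
        by (simp add: inner_add_right)
      moreover have "2 * (grad (v m) x \<bullet> e m x) \<ge> - l * (norm (grad (v m) x))\<^sup>2 - 1 / l * (norm (e m x))\<^sup>2"
      proof -
        have "0 \<le> (norm (l *\<^sub>R grad (v m) x + e m x))\<^sup>2 / l" using l by simp
        also have "\<dots> = l * (norm (grad (v m) x))\<^sup>2 + 1 / l * (norm (e m x))\<^sup>2 + 2 * (grad (v m) x \<bullet> e m x)"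
        proof -
          have "(norm (l *\<^sub>R grad (v m) x + e m x))\<^sup>2 = l\<^sup>2 * (norm (grad (v m) x))\<^sup>2 + 2 * l * (grad (v m) x \<bullet> e m x) + (norm (e m x))\<^sup>2"
            unfolding power2_norm_eq_inner
            by (simp add: inner_add_left inner_add_right inner_commute power2_eq_square)
          then show ?thesis using l by (simp only:) (simp add: field_simps power2_eq_square)
        qed
        finally show ?thesis by simp
      qed
      ultimately have "(norm (Du x))\<^sup>2 \<ge> (1 - l) * (norm (grad (v m) x))\<^sup>2 + 2 * (grad (v m) x \<bullet> g x) - 1 / l * (norm (e m x))\<^sup>2"
        by (simp add: left_diff_distrib)
      then have D: "\<epsilon> / 2 * (norm (Du x))\<^sup>2 \<ge> \<epsilon> / 2 * ((1 - l) * (norm (grad (v m) x))\<^sup>2 + 2 * (grad (v m) x \<bullet> g x) - 1 / l * (norm (e m x))\<^sup>2)"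
        using \<epsilon> by (intro mult_left_mono) auto
      have ip: "grad (v m) x \<bullet> g x = (\<Sum>i\<in>UNIV. g x $ i * grad (v m) x $ i)"
        by (simp add: inner_vec_def mult.commute)
      let ?th = "\<theta> (x /\<^sub>R \<delta>)"
      have "w (v m x) - w (u x) \<le> L * \<bar>v m x - u x\<bar>" using wL[of "v m x" "u x"] by linarith
      also have "\<bar>v m x - u x\<bar> = \<bar>?a x\<bar>" by (simp add: v_def)
      also have "\<bar>?a x\<bar> \<le> l + 1 / l * (?a x)\<^sup>2"
      proof -
        have "0 \<le> (l - \<bar>?a x\<bar>)\<^sup>2 / l" using l by simp
        also have "\<dots> = l + 1 / l * (?a x)\<^sup>2 - 2 * \<bar>?a x\<bar>"
          using l by (simp add: power2_diff add_divide_distrib diff_divide_distrib) (simp add: power2_eq_square)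
        finally have "0 \<le> l + 1 / l * (?a x)\<^sup>2 - 2 * \<bar>?a x\<bar>" .
        moreover have "b \<le> a" if "0 \<le> a - 2 * b" "0 \<le> b" for a b :: real using that by linarith
        ultimately show ?thesis using abs_ge_zero[of "?a x"] by blast
      qed
      finally have "w (v m x) - w (u x) \<le> L * (l + 1 / l * (?a x)\<^sup>2)" using L0 by (simp add: mult_left_mono)
      then have "?th * (w (v m x) - w (u x)) \<le> ?th * (L * (l + 1 / l * (?a x)\<^sup>2))"
        using pos by (intro mult_left_mono) (auto simp: less_imp_le)
      also have "\<dots> \<le> \<Theta> * (L * (l + 1 / l * (?a x)\<^sup>2))"
        using l L0 by (intro mult_right_mono bound) auto
      finally have "1 / \<epsilon> * (?th * (w (v m x) - w (u x))) \<le> 1 / \<epsilon> * (\<Theta> * (L * (l + 1 / l * (?a x)\<^sup>2)))"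
        using \<epsilon> by (intro mult_left_mono) auto
      then have W: "1 / \<epsilon> * ?th * w (v m x) - \<Theta> * L / \<epsilon> * (l + 1 / l * (?a x)\<^sup>2) \<le> 1 / \<epsilon> * ?th * w (u x)"
        by (simp add: right_diff_distrib diff_divide_distrib)
      have "l * (1 / \<epsilon> * ?th * w (v m x)) \<ge> 0" using l \<epsilon> pos[of "x /\<^sub>R \<delta>"] w0 by simp
      then have "(1 - l) * (1 / \<epsilon> * ?th * w (v m x)) - \<Theta> * L / \<epsilon> * (l + 1 / l * (?a x)\<^sup>2) \<le> 1 / \<epsilon> * ?th * w (u x)"
        using W by (simp only: left_diff_distrib, linarith?)
      moreover have "\<epsilon> / 2 * ((1 - l) * (norm (grad (v m) x))\<^sup>2 + 2 * (grad (v m) x \<bullet> g x) - 1 / l * (norm (e m x))\<^sup>2) =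
          (1 - l) * (\<epsilon> / 2 * (norm (grad (v m) x))\<^sup>2) + \<epsilon> * (grad (v m) x \<bullet> g x) - \<epsilon> / (2 * l) * (norm (e m x))\<^sup>2"
        using l by (simp add: field_simps)
      ultimately show ?thesis using D unfolding ip distrib_left by linarith
    qed
    have i1: "integrable ?M (?F m)" by (rule integrable_lebesgue_on_cube[OF cF])
    have i2: "integrable ?M (\<lambda>x. g x $ i * grad (v m) x $ i)" for i
      by (intro L2_on_mult_integrable L2_on_nth gL2 L2_on_continuous continuous_on_grad sv)
    have i3: "integrable ?M (\<lambda>x. (norm (e m x))\<^sup>2)" using eL2 by (simp add: L2_on_def)
    have i4: "integrable ?M (\<lambda>x. (?a x)\<^sup>2)" using aL2[of m] by (simp add: L2_on_def)
    have "(LINT x|?M. ?R x) = (1 - l) * (LINT x|?M. ?F m x) + \<epsilon> * (\<Sum>i\<in>UNIV. LINT x|?M. g x $ i * grad (v m) x $ i)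
      - \<epsilon> / (2 * l) * (LINT x|?M. (norm (e m x))\<^sup>2) - \<Theta> * L / \<epsilon> * (l * ?V + 1 / l * (LINT x|?M. (?a x)\<^sup>2))"
      using i1 i2 i3 i4 by (simp add: Bochner_Integration.integral_sum)
    also have "(\<Sum>i\<in>UNIV. LINT x|?M. g x $ i * grad (v m) x $ i) = 0"
      by (intro sum.neutral ballI orth smooth_grad sv)
    finally have R: "(LINT x|?M. ?R x) = (1 - l) * (LINT x|?M. ?F m x)
      - \<epsilon> / (2 * l) * (LINT x|?M. (norm (e m x))\<^sup>2) - \<Theta> * L / \<epsilon> * (l * ?V + 1 / l * (LINT x|?M. (?a x)\<^sup>2))"
      by simp
    have "(LINT x|?M. ?R x) \<le> J"
      unfolding J_def
    proof (rule integral_mono[OF _ iJ point])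
      show "integrable ?M ?R" using i1 i2 i3 i4 by simp
    qed
    moreover have "low \<le> (LINT x|?M. ?F m x)"
      using low[OF t[of m]] unfolding integral_lebesgue_on_cube[OF cF] by (simp add: v_def)
    then have "(1 - l) * low \<le> (1 - l) * (LINT x|?M. ?F m x)" using l by (intro mult_left_mono) auto
    ultimately show ?thesis using R by linarith
  qed
  \<comment> \<open>The limit in m is taken at fixed l and removes the terms with 1 / l; only then
    does l tend to 0.\<close>
  have ineq2: "(1 - l) * low - \<Theta> * L / \<epsilon> * (l * ?V) \<le> J" if l: "0 < l" "l < 1" for l
  proof (rule tendsto_upperbound)
    show "(\<lambda>m. (1 - l) * low - \<epsilon> / (2 * l) * (LINT x|?M. (norm (e m x))\<^sup>2)
      - \<Theta> * L / \<epsilon> * (l * ?V + 1 / l * (LINT x|?M. (u x - h x - \<phi> m x)\<^sup>2)))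
      \<longlonglongrightarrow> (1 - l) * low - \<Theta> * L / \<epsilon> * (l * ?V)"
      unfolding e_def by (rule tendsto_eq_intros lim1 lim2 refl | simp)+
  qed (use ineq[OF l] in auto)
  have "low \<le> J"
  proof (rule tendsto_upperbound)
    show "((\<lambda>l. (1 - l) * low - \<Theta> * L / \<epsilon> * (l * ?V)) \<longlongrightarrow> low) (at_right 0)"
      by (rule tendsto_eq_intros refl | simp)+
    show "\<forall>\<^sub>F l in at_right 0. (1 - l) * low - \<Theta> * L / \<epsilon> * (l * ?V) \<le> J"
      unfolding eventually_at_right_field using ineq2 by (intro exI[of _ 1]) auto
  qed simp
  then have "ennreal low \<le> ennreal J" by (rule ennreal_leI)
  also have "\<dots> = (\<integral>\<^sup>+x. ennreal (\<epsilon> / 2 * (norm (Du x))\<^sup>2 + 1 / \<epsilon> * \<theta> (x /\<^sub>R \<delta>) * w (u x)) \<partial>?M)"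
    unfolding J_def using w0 pos \<epsilon>
    by (intro nn_integral_eq_integral[OF iJ, symmetric] AE_I2) (simp add: less_imp_le)
  finally show ?thesis .
qed

end

section \<open>Lipschitz minorants and the lower bound for weak competitors\<close>

lemma antiderivative_exists:
  fixes f :: "real \<Rightarrow> real"
  assumes "continuous_on UNIV f"
  obtains G where "\<And>x. (G has_real_derivative f x) (at x)"
proof (rule that)
  fix x :: real
  define M where "M = \<bar>x\<bar> + 1"
  have c: "continuous_on A f" for A using assms continuous_on_subset by blast
  have i: "f integrable_on {a..b}" for a b by (rule integrable_continuous_real[OF c])
  \<comment> \<open>The difference on the right is the oriented integral from 0 to y, as one of the
    two intervals is empty or a point. On the window around x it differs by a constant from the
    integral started at -M.\<close>
  have eq: "integral {-M..y} f - integral {-M..0} f = integral {0..y} f - integral {y..0} f" if "y \<in> {-M<..<M}" for y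
  proof (cases "y \<ge> 0")
    case True
    then have "integral {-M..0} f + integral {0..y} f = integral {-M..y} f"
      by (intro Henstock_Kurzweil_Integration.integral_combine i) (auto simp: M_def)
    moreover have "integral {y..0} f = 0" using True by (cases "y = 0") auto
    ultimately show ?thesis by simp
  next
    case False
    then have "integral {-M..y} f + integral {y..0} f = integral {-M..0} f"
      using that by (intro Henstock_Kurzweil_Integration.integral_combine i) auto
    then show ?thesis using False by simp
  qed
  have "((\<lambda>y. integral {-M..y} f) has_real_derivative f x) (at x within {-M..M})"
    by (rule integral_has_real_derivative[OF c]) (auto simp: M_def)
  moreover have "at x within {-M..M} = at x"
    by (rule at_within_interior) (auto simp: M_def interior_atLeastAtMost_real)
  ultimately have "((\<lambda>y. integral {-M..y} f - integral {-M..0} f) has_real_derivative f x - 0) (at x)"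
    by (intro DERIV_diff DERIV_const) simp
  then show "((\<lambda>y. integral {0..y} f - integral {y..0} f) has_real_derivative f x) (at x)"
    unfolding diff_0_right
    by (rule has_field_derivative_transform_within_open[where S = "{-M<..<M}"])
      (use eq in \<open>auto simp: M_def\<close>)
qed

lemma antiderivative_diff:
  fixes f :: "real \<Rightarrow> real"
  assumes "\<And>x. (G has_real_derivative f x) (at x)" "a \<le> b"
  shows "integral {a..b} f = G b - G a"
  by (rule integral_unique, rule fundamental_theorem_of_calculus)
    (use assms in \<open>auto simp: has_real_derivative_iff_has_vector_derivative has_vector_derivative_at_within\<close>)

text \<open>Weierstrass approximation from below, continued constantly outside \<open>[-1, 1]\<close>, where \<open>W\<close> vanishes
  at the end points.\<close>
lemma lipschitz_minorant:
  fixes W :: "real \<Rightarrow> real"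
  assumes cW: "continuous_on UNIV W" and W0: "\<And>s. W s \<ge> 0" and zero: "W (-1) = 0" "W 1 = 0" and \<eta>: "\<eta> > 0"
  obtains w K L where "\<And>s. 0 \<le> w s" "\<And>s. w s \<le> K" "\<And>s. w s \<le> W s" "continuous_on UNIV w"
    "\<And>s t. \<bar>w s - w t\<bar> \<le> L * \<bar>s - t\<bar>" "\<And>s. s \<in> {-1..1} \<Longrightarrow> W s - \<eta> \<le> w s"
proof -
  \<comment> \<open>Approximating W - \<eta> / 2 within \<eta> / 2 places p between W - \<eta> and
    W.\<close>
  obtain p where p: "real_polynomial_function p" "\<And>s. s \<in> {-1..1} \<Longrightarrow> \<bar>(W s - \<eta> / 2) - p s\<bar> < \<eta> / 2"
  proof (rule Stone_Weierstrass_real_polynomial_function[of "{-1..1}" "\<lambda>s. W s - \<eta> / 2" "\<eta> / 2"])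
    show "continuous_on {-1..1} (\<lambda>s. W s - \<eta> / 2)"
      by (intro continuous_intros continuous_on_subset[OF cW]) simp
  qed (use \<eta> in auto)
  have sp: "smooth p" using p(1) by (rule smooth_real_polynomial)
  obtain L K where L: "\<forall>s\<in>{-1..1}. \<bar>deriv p s\<bar> \<le> L" and K: "\<forall>s\<in>{-1..1}. \<bar>p s\<bar> \<le> K"
    using continuous_bounded_interval[OF smooth_continuous_on[OF smooth_deriv[OF sp]]]
      continuous_bounded_interval[OF smooth_continuous_on[OF sp]] by metis
  have K0: "K \<ge> 0" using K by (auto dest: bspec[where x = 0])
  have L0: "L \<ge> 0" using L by (auto dest: bspec[where x = 0])
  define cl :: "real \<Rightarrow> real" where "cl s = max (-1) (min 1 s)" for s
  have cl: "cl s \<in> {-1..1}" for s by (auto simp: cl_def)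
  have cl_lip: "\<bar>cl s - cl t\<bar> \<le> \<bar>s - t\<bar>" for s t by (auto simp: cl_def max_def min_def)
  define w where "w s = max 0 (p (cl s))" for s
  have pl: "\<bar>p a - p b\<bar> \<le> L * \<bar>a - b\<bar>" if "a \<in> {-1..1}" "b \<in> {-1..1}" for a b
    using field_differentiable_bound[of "{-1..1}" p "deriv p" L a b] that L smooth_DERIV[OF sp]
    by (auto simp: has_field_derivative_at_within)
  have lip: "\<bar>w s - w t\<bar> \<le> L * \<bar>s - t\<bar>" for s t
  proof -
    have "\<bar>w s - w t\<bar> \<le> \<bar>p (cl s) - p (cl t)\<bar>" by (auto simp: w_def)
    also have "\<dots> \<le> L * \<bar>cl s - cl t\<bar>" by (intro pl cl)
    also have "\<dots> \<le> L * \<bar>s - t\<bar>" using L0 cl_lip by (intro mult_left_mono)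
    finally show ?thesis .
  qed
  show ?thesis
  proof (rule that[of w K L])
    show "0 \<le> w s" for s by (simp add: w_def)
    show "w s \<le> K" for s using K K0 cl[of s] by (auto simp: w_def abs_le_iff)
    show "continuous_on UNIV w"
      unfolding w_def cl_def
      by (intro continuous_intros continuous_on_compose2[OF smooth_continuous_on[OF sp, of UNIV]]) auto
    show "w s \<le> W s" for s
    proof (cases "s \<in> {-1..1}")
      case True
      then have "cl s = s" by (auto simp: cl_def)
      moreover have "p s \<le> W s" using p(2)[OF True] by linarith
      ultimately show ?thesis using W0[of s] by (simp add: w_def)
    next
      case False
      \<comment> \<open>The clamped argument is an end point, where p lies below W = 0; so w is 0
        outside the interval.\<close>
      then have "cl s = 1 \<or> cl s = -1" by (auto simp: cl_def)
      moreover have "\<bar>(W 1 - \<eta> / 2) - p 1\<bar> < \<eta> / 2" "\<bar>(W (-1) - \<eta> / 2) - p (-1)\<bar> < \<eta> / 2"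
        by (intro p(2), simp)+
      then have "p 1 \<le> 0" "p (-1) \<le> 0" using zero by linarith+
      ultimately have "p (cl s) \<le> 0" by auto
      then show ?thesis using W0[of s] by (simp add: w_def)
    qed
    show "W s - \<eta> \<le> w s" if "s \<in> {-1..1}" for s
    proof -
      have "cl s = s" using that by (auto simp: cl_def)
      moreover have "W s - \<eta> \<le> p s" using p(2)[OF that] by linarith
      ultimately show ?thesis by (simp add: w_def)
    qed
  qed (rule lip)
qed

context periodic_weight
begin

text \<open>For fixed c there is room to replace W: a minorant w close to W keeps the integral of
  \<open>sqrt (2 * w s)\<close> above c, and for this one w all homogenization errors vanish with
  \<epsilon>.\<close>

lemma sigma_cell_lower:
  fixes W q :: "real \<Rightarrow> real" and \<theta>s :: "real^'n \<Rightarrow> real" and k :: 'n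
  assumes cW: "continuous_on UNIV W" and W0: "\<And>s. W s \<ge> 0" and zero: "W (-1) = 0" "W 1 = 0"
    and q: "smooth q" "(q \<longlongrightarrow> 1) at_top" "(q \<longlongrightarrow> -1) at_bot"
    and \<theta>s: "\<And>y. \<theta> y \<le> \<theta>s y"
    and \<delta>: "\<And>\<epsilon>. \<epsilon> > 0 \<Longrightarrow> \<delta> \<epsilon> > 0" "((\<lambda>\<epsilon>. \<delta> \<epsilon> / \<epsilon>\<^sup>2) \<longlongrightarrow> 0) (at_right 0)"
    and \<rho>: "\<rho> > 0" and c: "c < sigma_W W"
  shows "\<forall>\<^sub>F \<epsilon> in at_right 0. ennreal (\<rho> ^ (CARD('n) - 1) * c) \<le> sigma_cell W q \<theta>s \<epsilon> (\<delta> \<epsilon>) (axis k 1) (cube \<rho>)"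
proof -
  \<comment> \<open>Subadditivity of the root bounds the loss at each point by
    \<open>sqrt (2 * \<eta>)\<close>, a quarter of the gap \<open>sigma_W W - c\<close>; over an
    interval of length 2 this is half of the gap.\<close>
  define \<eta> where "\<eta> = ((sigma_W W - c) / 4)\<^sup>2 / 2"
  have \<eta>: "\<eta> > 0" using c by (simp add: \<eta>_def)
  have sq\<eta>: "sqrt (2 * \<eta>) = (sigma_W W - c) / 4" using c by (simp add: \<eta>_def)
  obtain w K L where w: "\<And>s. 0 \<le> w s" "\<And>s. w s \<le> K" "\<And>s. w s \<le> W s" "continuous_on UNIV w"
    "\<And>s t. \<bar>w s - w t\<bar> \<le> L * \<bar>s - t\<bar>" "\<And>s. s \<in> {-1..1} \<Longrightarrow> W s - \<eta> \<le> w s"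
    using lipschitz_minorant[OF cW W0 zero \<eta>] by blast
  have cs: "continuous_on UNIV (\<lambda>s. sqrt (2 * w s))" "continuous_on UNIV (\<lambda>s. sqrt (2 * W s))"
    by (intro continuous_intros w(4) cW)+
  obtain G where G: "\<And>s. (G has_real_derivative sqrt (2 * w s)) (at s)"
    using antiderivative_exists[OF cs(1)] by blast
  have "sigma_W W - 2 * sqrt (2 * \<eta>) = integral {-1..1} (\<lambda>s. sqrt (2 * W s) - sqrt (2 * \<eta>))"
    unfolding sigma_W_def
    by (subst Henstock_Kurzweil_Integration.integral_diff)
      (auto intro!: integrable_continuous_real continuous_on_subset[OF cs(2)])
  also have "\<dots> \<le> integral {-1..1} (\<lambda>s. sqrt (2 * w s))"
  proof (rule integral_le)
    show "sqrt (2 * W s) - sqrt (2 * \<eta>) \<le> sqrt (2 * w s)" if "s \<in> {-1..1}" for s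
    proof -
      have "sqrt (2 * W s) \<le> sqrt (2 * w s + 2 * \<eta>)" using w(6)[OF that] by simp
      also have "\<dots> \<le> sqrt (2 * w s) + sqrt (2 * \<eta>)" using w(1) \<eta> by (intro sqrt_add_le_add_sqrt) auto
      finally show ?thesis by simp
    qed
  qed (auto intro!: integrable_continuous_real continuous_intros continuous_on_subset[OF cs(1)] continuous_on_subset[OF cW])
  also have "\<dots> = G 1 - G (-1)" by (rule antiderivative_diff[OF G]) simp
  finally have G1: "c < G 1 - G (-1)" using c unfolding sq\<eta> by (simp add: field_simps)
  have \<delta>1: "((\<lambda>\<epsilon>. \<delta> \<epsilon> / \<epsilon>) \<longlongrightarrow> 0) (at_right 0)"
    by (rule tendsto_times_ident[OF \<delta>(2)]) (simp add: power2_eq_square)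
  have \<delta>0: "(\<delta> \<longlongrightarrow> 0) (at_right 0)"
    by (rule tendsto_times_ident[OF \<delta>1]) simp
  have top: "filterlim (\<lambda>\<epsilon>. \<rho> / 2 / \<epsilon>) at_top (at_right 0)"
    unfolding divide_inverse[of "\<rho> / 2"]
    by (rule filterlim_tendsto_pos_mult_at_top[OF tendsto_const _ filterlim_inverse_at_top_right]) (use \<rho> in simp)
  have bot: "filterlim (\<lambda>\<epsilon>. - \<rho> / 2 / \<epsilon>) at_bot (at_right 0)"
    using top by (simp add: filterlim_uminus_at_top)
  have cG: "isCont G x" for x using G DERIV_isCont by blast
  have Glim: "((\<lambda>\<epsilon>. G (q (\<rho> / 2 / \<epsilon>))) \<longlongrightarrow> G 1) (at_right 0)" "((\<lambda>\<epsilon>. G (q (- \<rho> / 2 / \<epsilon>))) \<longlongrightarrow> G (-1)) (at_right 0)"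
    by (intro isCont_tendsto_compose[OF cG] filterlim_compose[OF q(2) top] filterlim_compose[OF q(3) bot])+
  define low where "low \<epsilon> = (1 - \<Theta> * L * CARD('n) * (\<delta> \<epsilon> / \<epsilon>)) * (\<rho> ^ (CARD('n) - 1) * (G (q (\<rho> / 2 / \<epsilon>)) - G (q (- \<rho> / 2 / \<epsilon>))))
      - homog_error K L \<rho> \<epsilon> (\<delta> \<epsilon>)" for \<epsilon>
  have "(low \<longlongrightarrow> (1 - \<Theta> * L * CARD('n) * 0) * (\<rho> ^ (CARD('n) - 1) * (G 1 - G (-1)))
      - (\<Theta> * K * shell_const TYPE('n) \<rho> * 0 + \<Theta> * L * CARD('n) * \<rho> ^ CARD('n) / 2 * 0)) (at_right 0)"
    unfolding low_def[abs_def] homog_error_def by (intro tendsto_intros \<delta>1 \<delta>(2) Glim)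
  then have lowlim: "(low \<longlongrightarrow> \<rho> ^ (CARD('n) - 1) * (G 1 - G (-1))) (at_right 0)" by simp
  have "\<rho> ^ (CARD('n) - 1) * c < \<rho> ^ (CARD('n) - 1) * (G 1 - G (-1))" using G1 \<rho> by simp
  from order_tendstoD(1)[OF lowlim this]
  have e1: "\<forall>\<^sub>F \<epsilon> in at_right 0. \<rho> ^ (CARD('n) - 1) * c < low \<epsilon>" .
  have e2: "\<forall>\<^sub>F \<epsilon> in at_right 0. \<delta> \<epsilon> < \<rho> / 2"
    using order_tendstoD(2)[OF \<delta>0, of "\<rho> / 2"] \<rho> by simp
  have e3: "\<forall>\<^sub>F \<epsilon> in at_right 0. \<Theta> * L * CARD('n) * (\<delta> \<epsilon> / \<epsilon>) < 1"
    using order_tendstoD(2)[OF tendsto_mult[OF tendsto_const[of "\<Theta> * L * CARD('n)"] \<delta>1], of 1] by simp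
  show ?thesis
    using e1 e2 e3 eventually_at_right_less[of 0]
  proof eventually_elim
    case (elim \<epsilon>)
    have \<epsilon>: "\<epsilon> > 0" and \<delta>e: "\<delta> \<epsilon> > 0" "2 * \<delta> \<epsilon> \<le> \<rho>" using elim \<delta>(1) by auto
    let ?h = "\<lambda>x::real^'n. q ((x \<bullet> axis k 1) / \<epsilon>)"
    have h: "?h = (\<lambda>x. q (x $ k / \<epsilon>))" by (simp add: inner_axis)
    have sh: "smooth ?h"
    proof -
      have "smooth (\<lambda>t. q (t / \<epsilon>))"
        by (rule smooth_scaled(2)[OF q(1)])
      from smooth_comp[OF this smooth_vec_nth] show ?thesis by (simp add: h)
    qed
    show ?case
      unfolding sigma_cell_def
    proof (rule Inf_greatest)
      fix E assume "E \<in> {energy \<epsilon> (\<delta> \<epsilon>) \<theta>s W (cube \<rho>) u Du |u Du. H1 (cube \<rho>) u Du \<and> eq_on_boundary (cube \<rho>) u ?h}"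
      then obtain u Du where E: "E = energy \<epsilon> (\<delta> \<epsilon>) \<theta>s W (cube \<rho>) u Du"
        and u: "H1 (cube \<rho>) u Du" "eq_on_boundary (cube \<rho>) u ?h" by blast
      have "ennreal (\<rho> ^ (CARD('n) - 1) * c) \<le> ennreal (low \<epsilon>)" using elim by (intro ennreal_leI) simp
      also have "\<dots> \<le> (\<integral>\<^sup>+x. ennreal (\<epsilon> / 2 * (norm (Du x))\<^sup>2 + 1 / \<epsilon> * \<theta> (x /\<^sub>R \<delta> \<epsilon>) * w (u x)) \<partial>lebesgue_on (cube \<rho>))"
      proof (rule energy_lower_bound_H1[OF u sh w(1,2,5,4) \<epsilon> \<rho>])
        fix \<phi> :: "real^'n \<Rightarrow> real" assume t: "test_function (interior (cube \<rho>)) \<phi>"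
        show "low \<epsilon> \<le> cube_integral \<rho> (\<lambda>x. \<epsilon> / 2 * (norm (grad (\<lambda>x. ?h x + \<phi> x) x))\<^sup>2 + 1 / \<epsilon> * \<theta> (x /\<^sub>R \<delta> \<epsilon>) * w (?h x + \<phi> x))"
          unfolding low_def
          by (rule energy_lower_bound_smooth[OF w(1,2,5,4) G q(1) t \<epsilon> \<rho> _ \<delta>e less_imp_le[OF elim(3)]]) (simp add: inner_axis)
      qed
      also have "\<dots> \<le> E"
        unfolding E energy_def
      proof (intro nn_integral_mono ennreal_leI add_left_mono)
        fix x
        have "1 / \<epsilon> * \<theta> (x /\<^sub>R \<delta> \<epsilon>) * w (u x) \<le> 1 / \<epsilon> * \<theta>s (x /\<^sub>R \<delta> \<epsilon>) * W (u x)"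
          using \<epsilon> \<theta>s w(1,3) pos order_trans[OF less_imp_le[OF pos] \<theta>s]
          by (intro mult_mono mult_left_mono mult_nonneg_nonneg) auto
        then show "1 / \<epsilon> * \<theta> (x /\<^sub>R \<delta> \<epsilon>) * w (u x) \<le> 1 / \<epsilon> * \<theta>s (x /\<^sub>R \<delta> \<epsilon>) * W (u x)" .
      qed
      finally show "ennreal (\<rho> ^ (CARD('n) - 1) * c) \<le> E" .
    qed
  qed
qed

end

subsection \<open>The optimal profile\<close>

text \<open>Separation of variables: \<tau> is the time at which s is reached, and \<gamma> is its
  inverse. The bound B on the speed makes \<tau> grow at least linearly, so that it is onto.\<close>

lemma smooth_autonomous_flow:
  fixes F :: "real \<Rightarrow> real"
  assumes F: "smooth F" and pos: "\<And>s. F s > 0" and bd: "\<And>s. F s \<le> B"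
  obtains \<gamma> where "smooth \<gamma>" "\<And>t. (\<gamma> has_real_derivative F (\<gamma> t)) (at t)" "surj \<gamma>" "strict_mono \<gamma>"
proof -
  have B: "B > 0" using pos bd by (meson less_le_trans)
  obtain \<tau> where \<tau>: "\<And>s. (\<tau> has_real_derivative inverse (F s)) (at s)"
  proof (rule antiderivative_exists[of "\<lambda>s. inverse (F s)"])
    show "continuous_on UNIV (\<lambda>s. inverse (F s))"
      using smooth_continuous_on[OF F] pos by (intro continuous_on_inverse) (auto simp: less_imp_neq[symmetric])
  qed blast
  have mono: "\<tau> a < \<tau> b" if "a < b" for a b
    by (rule DERIV_pos_imp_increasing[OF that]) (use \<tau> pos in \<open>meson positive_imp_inverse_positive\<close>)
  have smono: "strict_mono \<tau>" using mono by (rule strict_monoI)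
  have inj: "inj \<tau>" using smono by (rule strict_mono_imp_inj_on)
  have cont: "isCont \<tau> s" for s using \<tau> DERIV_isCont by blast
  have grow: "\<tau> b - \<tau> a \<ge> (b - a) / B" if "a \<le> b" for a b
  proof (cases "a = b")
    case False
    then have "a < b" using that by simp
    from MVT2[OF this \<tau>] obtain z where z: "\<tau> b - \<tau> a = (b - a) * inverse (F z)" by blast
    have "inverse B \<le> inverse (F z)" using pos bd by (simp add: le_imp_inverse_le)
    then have "(b - a) * inverse B \<le> (b - a) * inverse (F z)" using that by (intro mult_left_mono) auto
    then show ?thesis using z by (simp add: divide_inverse)
  qed simp
  have surj: "\<exists>s. \<tau> s = y" for y
  proof -
    define x where "x = B * \<bar>y - \<tau> 0\<bar>"
    have x: "x \<ge> 0" "x / B = \<bar>y - \<tau> 0\<bar>" using B by (auto simp: x_def)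
    have "\<tau> x \<ge> y" using grow[of 0 x] x by simp
    moreover have "\<tau> (- x) \<le> y" using grow[of "- x" 0] x by simp
    ultimately show ?thesis
      using IVT[of \<tau> "- x" y x] cont x(1) by auto
  qed
  define \<gamma> where "\<gamma> = inv \<tau>"
  have \<tau>\<gamma>: "\<tau> (\<gamma> y) = y" for y unfolding \<gamma>_def using surj by (metis f_inv_into_f rangeI)
  have \<gamma>\<tau>: "\<gamma> (\<tau> s) = s" for s unfolding \<gamma>_def using inj by (rule inv_f_f)
  have c\<gamma>: "isCont \<gamma> y" for y
    using isCont_inverse_function[of 1 "\<gamma> y" \<gamma> \<tau>] \<gamma>\<tau> cont by (simp add: \<tau>\<gamma>)
  have d: "(\<gamma> has_real_derivative F (\<gamma> t)) (at t)" for t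
  proof -
    have "(\<gamma> has_real_derivative inverse (inverse (F (\<gamma> t)))) (at t)"
      by (rule DERIV_inverse_function[OF \<tau> _ _ _ \<tau>\<gamma> c\<gamma>, of t "t - 1" "t + 1"])
        (use pos[of "\<gamma> t"] in auto)
    then show ?thesis by simp
  qed
  \<comment> \<open>Bootstrap: if \<gamma> has order n, so has \<open>F (\<gamma> t)\<close>, which
    is its derivative.\<close>
  have "Ck n \<gamma>" for n
  proof (induction n)
    case (Suc n)
    have "deriv \<gamma> = (\<lambda>t. F (\<gamma> t))" using d DERIV_imp_deriv by blast
    moreover have "Ck n (\<lambda>t. F (\<gamma> t))" using F Suc unfolding smooth_iff_Ck by (blast intro: Ck_comp[of n F \<gamma>])
    ultimately show ?case using d unfolding Ck_Suc_real by (auto simp: real_differentiable_def)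
  qed simp
  then have "smooth \<gamma>" by (simp add: smooth_iff_Ck)
  moreover have "surj \<gamma>" using \<gamma>\<tau> by (metis surjI)
  moreover have "strict_mono \<gamma>"
    by (rule strict_monoI) (metis \<tau>\<gamma> smono strict_mono_less)
  ultimately show ?thesis using d that by blast
qed

text \<open>The flow passes -1 and 1 at positive speed. Running it along a clock that starts and
  stops smoothly makes the profile constant outside a bounded interval;
  \<open>deriv \<kappa> t \<le> 1\<close> keeps the kinetic term from growing, and the delay is only
  \<open>2 * r\<close>.\<close>

lemma smooth_clock:
  fixes T r :: real
  assumes T: "T > 0" and r: "r > 0"
  obtains \<kappa> where "smooth \<kappa>" "\<And>t. t \<le> 0 \<Longrightarrow> \<kappa> t = 0" "\<And>t. t \<ge> T + 2 * r \<Longrightarrow> \<kappa> t = T"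
    "\<And>t. 0 \<le> deriv \<kappa> t" "\<And>t. deriv \<kappa> t \<le> 1" "\<And>t. 0 \<le> \<kappa> t" "\<And>t. \<kappa> t \<le> T"
proof -
  define M where "M = T + 2 * r"
  define b where "b t = step (1 / r * t + 0) * step (- 1 / r * t + M / r)" for t
  have sb: "smooth b"
    unfolding b_def by (intro smooth_mult smooth_comp[OF smooth_step] smooth_affine)
  have b01: "0 \<le> b t" "b t \<le> 1" for t
    by (auto simp: b_def step_nonneg step_le_1 mult_le_one)
  have b0: "b t = 0" if "t \<le> 0 \<or> t \<ge> M" for t
    using that
  proof
    assume "t \<le> 0"
    then have "1 / r * t + 0 \<le> 0" using r by (simp add: divide_nonpos_pos)
    then show ?thesis by (simp only: b_def step_0)
  next
    assume "t \<ge> M"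
    then have "- 1 / r * t + M / r \<le> 0" using r by (simp add: field_simps)
    then show ?thesis by (simp only: b_def step_0 mult_zero_right)
  qed
  have b1: "b t = 1" if "r \<le> t" "t \<le> M - r" for t
  proof -
    have "1 / r * t + 0 \<ge> 1" "- 1 / r * t + M / r \<ge> 1" using that r by (simp_all add: field_simps)
    then show ?thesis by (simp only: b_def step_1)
  qed
  obtain K0 where K0: "\<And>t. (K0 has_real_derivative b t) (at t)"
    using antiderivative_exists[OF smooth_continuous_on[OF sb]] by blast
  define K where "K t = K0 t - K0 0" for t
  have K: "(K has_real_derivative b t) (at t)" for t
    unfolding K_def by (rule DERIV_cong[OF DERIV_diff[OF K0 DERIV_const]]) simp
  have mono: "K s \<le> K t" if "s \<le> t" for s t
    using that by (rule DERIV_nonneg_imp_nondecreasing) (use K b01 in blast)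
  have mvt: "\<exists>z. s < z \<and> z < t \<and> K t - K s = (t - s) * b z" if "s < t" for s t
    by (rule MVT2[OF that]) (rule K)
  have low: "K t = 0" if "t \<le> 0" for t
  proof (cases "t = 0")
    case False
    then show ?thesis using mvt[of t 0] b0 that by (auto simp: K_def)
  qed (simp add: K_def)
  have high: "K t = K M" if "t \<ge> M" for t
  proof (cases "t = M")
    case False
    then show ?thesis using mvt[of M t] b0 that by auto
  qed simp
  have "K (M - r) - K r = T"
  proof -
    obtain z where "r < z" "z < M - r" "K (M - r) - K r = (M - r - r) * b z"
      using mvt[of r "M - r"] T by (auto simp: M_def)
    then show ?thesis using b1[of z] by (simp add: M_def)
  qed
  moreover have "K r \<ge> 0" using mono[of 0 r] low[of 0] r by simp
  moreover have "K (M - r) \<le> K M" using r by (intro mono) simp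
  ultimately have KM: "K M \<ge> T" by simp
  \<comment> \<open>\<open>K M \<ge> T\<close> because b is 1 on an interval of length T.
    Normalising to the exact end value T therefore only slows the clock down.\<close>
  define c where "c = T / K M"
  have c: "0 \<le> c" "c \<le> 1" "c * K M = T" using KM T by (auto simp: c_def)
  define \<kappa> where "\<kappa> t = c * K t" for t
  have d: "(\<kappa> has_real_derivative c * b t) (at t)" for t
    unfolding \<kappa>_def by (rule DERIV_cmult[OF K])
  then have dk: "deriv \<kappa> t = c * b t" for t by (rule DERIV_imp_deriv)
  show ?thesis
  proof (rule that[of \<kappa>])
    show "smooth \<kappa>"
      by (rule smooth_antiderivative[OF smooth_mult[OF smooth_const sb] d])
    show "\<kappa> t = 0" if "t \<le> 0" for t using low[OF that] by (simp add: \<kappa>_def)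
    show "\<kappa> t = T" if "t \<ge> T + 2 * r" for t using high[of t] that c by (simp add: \<kappa>_def M_def)
    show "0 \<le> deriv \<kappa> t" "deriv \<kappa> t \<le> 1" for t
      using b01[of t] c by (auto simp: dk mult_le_one)
    have K0: "0 \<le> K t" for t using mono[of 0 t] low[of 0] low[of t] by (cases "t \<ge> 0") auto
    have K1: "K t \<le> K M" for t using mono[of t M] high[of t] by (cases "t \<ge> M") auto
    show "0 \<le> \<kappa> t" for t using K0 c by (simp add: \<kappa>_def)
    show "\<kappa> t \<le> T" for t using mult_left_mono[OF K1 c(1)] c(3) by (simp add: \<kappa>_def)
  qed
qed

text \<open>The flow needs a smooth positive speed on the whole line. On [-1, 1] it is a polynomial
  squeezed between \<open>sqrt (2 * W s)\<close> and that plus \<mu>; just beyond, where the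
  polynomial is still positive by continuity, it is blended into the constant 1.\<close>

lemma smooth_speed:
  fixes W :: "real \<Rightarrow> real"
  assumes cW: "continuous_on UNIV W" and W0: "\<And>s. W s \<ge> 0" and \<mu>: "\<mu> > 0"
  obtains F B where "smooth F" "\<And>s. F s > 0" "\<And>s. F s \<le> B"
    "\<And>s. s \<in> {-1..1} \<Longrightarrow> sqrt (2 * W s) \<le> F s" "\<And>s. s \<in> {-1..1} \<Longrightarrow> F s \<le> sqrt (2 * W s) + \<mu>"
proof -
  have cs: "continuous_on UNIV (\<lambda>s. sqrt (2 * W s))" by (intro continuous_intros cW)
  obtain p where p: "real_polynomial_function p" "\<And>s. s \<in> {-1..1} \<Longrightarrow> \<bar>(sqrt (2 * W s) + \<mu> / 2) - p s\<bar> < \<mu> / 2"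
  proof (rule Stone_Weierstrass_real_polynomial_function[of "{-1..1}" "\<lambda>s. sqrt (2 * W s) + \<mu> / 2" "\<mu> / 2"])
    show "continuous_on {-1..1} (\<lambda>s. sqrt (2 * W s) + \<mu> / 2)"
      by (intro continuous_on_add continuous_on_const continuous_on_subset[OF cs]) simp
  qed (use \<mu> in auto)
  have sp: "smooth p" using p(1) by (rule smooth_real_polynomial)
  have lo: "sqrt (2 * W s) < p s" and hi: "p s < sqrt (2 * W s) + \<mu>" if "s \<in> {-1..1}" for s
    using p(2)[OF that] by linarith+
  have ppos: "p s > 0" if "s \<in> {-1..1}" for s using lo[OF that] W0[of s] real_sqrt_ge_zero[of "2 * W s"] by linarith
  have op: "open (p -` {0<..})"
    using smooth_continuous_on[OF sp, of UNIV] by (simp add: open_vimage)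
  have "1 \<in> p -` {0<..}" "-1 \<in> p -` {0<..}" using ppos[of 1] ppos[of "-1"] by auto
  then obtain r1 r2 where r1: "r1 > 0" "ball 1 r1 \<subseteq> p -` {0<..}" and r2: "r2 > 0" "ball (-1) r2 \<subseteq> p -` {0<..}"
    using op by (meson openE)
  define r where "r = min r1 r2"
  have r: "r > 0" using r1 r2 by (simp add: r_def)
  have pr: "p s > 0" if "-1 - r < s" "s < 1 + r" for s
  proof -
    have "s \<in> {-1..1} \<or> \<bar>1 - s\<bar> < r1 \<or> \<bar>- 1 - s\<bar> < r2"
      using that unfolding r_def atLeastAtMost_iff by linarith
    then have "s \<in> {-1..1} \<or> s \<in> ball 1 r1 \<or> s \<in> ball (-1) r2"
      by (simp only: mem_ball dist_real_def)
    then show ?thesis using ppos r1(2) r2(2) by blast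
  qed
  define cut where "cut s = step (1 / r * s + (1 + r) / r) * step (- 1 / r * s + (1 + r) / r)" for s
  have scut: "smooth cut"
    unfolding cut_def by (intro smooth_mult smooth_comp[OF smooth_step] smooth_affine)
  have cut01: "0 \<le> cut s" "cut s \<le> 1" for s
    by (auto simp: cut_def step_nonneg step_le_1 mult_le_one)
  have cut1: "cut s = 1" if "s \<in> {-1..1}" for s
  proof -
    have "1 / r * s + (1 + r) / r \<ge> 1" "- 1 / r * s + (1 + r) / r \<ge> 1" using that r by (simp_all add: field_simps)
    then show ?thesis by (simp only: cut_def step_1)
  qed
  have cut0: "cut s = 0" if "\<not> (-1 - r < s \<and> s < 1 + r)" for s
  proof -
    have e: "1 / r * s + (1 + r) / r = (s + (1 + r)) / r" "- 1 / r * s + (1 + r) / r = (1 + r - s) / r"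
      by (simp_all add: add_divide_distrib diff_divide_distrib)
    have "s + (1 + r) \<le> 0 \<or> 1 + r - s \<le> 0" using that by linarith
    then have "1 / r * s + (1 + r) / r \<le> 0 \<or> - 1 / r * s + (1 + r) / r \<le> 0"
      unfolding e using r by (meson divide_nonpos_pos)
    then show ?thesis unfolding cut_def using step_0 by (metis mult_zero_left mult_zero_right)
  qed
  define F where "F s = cut s * p s + (1 - cut s)" for s
  have sF: "smooth F" unfolding F_def by (intro smooth_add smooth_mult smooth_diff scut sp smooth_const)
  have F1: "F s = p s" if "s \<in> {-1..1}" for s using cut1[OF that] by (simp add: F_def)
  have Fpos: "F s > 0" for s
  proof (cases "-1 - r < s \<and> s < 1 + r")
    case True
    then have "p s > 0" using pr by blast
    then show ?thesis
      using cut01[of s] by (cases "cut s = 0") (auto simp: F_def intro!: add_pos_nonneg)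
  qed (simp add: F_def cut0)
  obtain B0 where B0: "\<forall>s\<in>{-1 - r..1 + r}. \<bar>F s\<bar> \<le> B0"
    using continuous_bounded_interval[OF smooth_continuous_on[OF sF]] by blast
  have FB: "F s \<le> max 1 B0" for s
  proof (cases "-1 - r < s \<and> s < 1 + r")
    case True
    then have "F s \<le> B0" using B0 by (force simp: abs_le_iff)
    then show ?thesis by simp
  qed (simp add: F_def cut0)
  show ?thesis
    by (rule that[OF sF Fpos FB]) (use F1 lo hi in \<open>auto simp: less_imp_le\<close>)
qed

text \<open>Equipartition: when \<gamma> moves with speed F close to \<open>sqrt (2 * W s)\<close>,
  the two parts of the density nearly agree and the total is the integral of F over [-1, 1], up to
  the cost of slowing the clock.\<close>

lemma optimal_profile:
  fixes W :: "real \<Rightarrow> real"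
  assumes cW: "continuous_on UNIV W" and W0: "\<And>s. W s \<ge> 0" and \<eta>: "\<eta> > 0"
  obtains \<gamma> M where "smooth \<gamma>" "M > 0" "\<And>t. t \<le> 0 \<Longrightarrow> \<gamma> t = -1" "\<And>t. t \<ge> M \<Longrightarrow> \<gamma> t = 1"
    "\<And>t. \<gamma> t \<in> {-1..1}" "integral {0..M} (\<lambda>t. (deriv \<gamma> t)\<^sup>2 / 2 + W (\<gamma> t)) \<le> sigma_W W + \<eta>"
proof -
  \<comment> \<open>Half of \<eta> goes to the excess \<mu> of F over an interval of length 2, the
    other half to the clock, which costs \<open>B\<^sup>2 * r\<close>.\<close>
  define \<mu> where "\<mu> = \<eta> / 4"
  obtain F B where F: "smooth F" "\<And>s. F s > 0" "\<And>s. F s \<le> B"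
    "\<And>s. s \<in> {-1..1} \<Longrightarrow> sqrt (2 * W s) \<le> F s" "\<And>s. s \<in> {-1..1} \<Longrightarrow> F s \<le> sqrt (2 * W s) + \<mu>"
    using smooth_speed[OF cW W0, of \<mu>] \<eta> unfolding \<mu>_def by (metis zero_less_divide_iff zero_less_numeral)
  have B: "B > 0" using F(2,3) by (meson less_le_trans)
  obtain \<gamma>0 where \<gamma>0: "smooth \<gamma>0" "\<And>t. (\<gamma>0 has_real_derivative F (\<gamma>0 t)) (at t)" "surj \<gamma>0" "strict_mono \<gamma>0"
    using smooth_autonomous_flow[OF F(1-3)] by blast
  obtain a b where ab: "\<gamma>0 a = -1" "\<gamma>0 b = 1" using \<gamma>0(3) by (metis surjD)
  define T where "T = b - a"
  have T: "T > 0" using strict_mono_less[OF \<gamma>0(4), of a b] ab by (simp add: T_def)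
  define r where "r = \<eta> / (2 * B\<^sup>2)"
  have r: "r > 0" using \<eta> B by (simp add: r_def)
  obtain \<kappa> where \<kappa>: "smooth \<kappa>" "\<And>t. t \<le> 0 \<Longrightarrow> \<kappa> t = 0" "\<And>t. t \<ge> T + 2 * r \<Longrightarrow> \<kappa> t = T"
    "\<And>t. 0 \<le> deriv \<kappa> t" "\<And>t. deriv \<kappa> t \<le> 1" "\<And>t. 0 \<le> \<kappa> t" "\<And>t. \<kappa> t \<le> T"
    using smooth_clock[OF T r] by blast
  define M where "M = T + 2 * r"
  define \<gamma> where "\<gamma> t = \<gamma>0 (\<kappa> t + a)" for t
  have s\<gamma>: "smooth \<gamma>"
    unfolding \<gamma>_def by (intro smooth_comp[OF \<gamma>0(1)] smooth_add \<kappa>(1) smooth_const)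
  have d: "(\<gamma> has_real_derivative F (\<gamma> t) * deriv \<kappa> t) (at t)" for t
    unfolding \<gamma>_def
    using DERIV_chain2[OF \<gamma>0(2) DERIV_add[OF smooth_DERIV[OF \<kappa>(1)] DERIV_const]] by simp
  have range: "\<gamma> t \<in> {-1..1}" for t
  proof -
    have "\<gamma>0 a \<le> \<gamma> t" "\<gamma> t \<le> \<gamma>0 b"
      unfolding \<gamma>_def using \<kappa>(6,7)[of t] by (auto intro!: strict_mono_leD[OF \<gamma>0(4)] simp: T_def)
    then show ?thesis by (simp add: ab)
  qed
  have start: "\<gamma> t = -1" if "t \<le> 0" for t using \<kappa>(2)[OF that] ab by (simp add: \<gamma>_def)
  have stop: "\<gamma> t = 1" if "t \<ge> M" for t using \<kappa>(3)[of t] that ab by (simp add: \<gamma>_def M_def T_def)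
  obtain H where H: "\<And>s. (H has_real_derivative F s) (at s)"
    using antiderivative_exists[OF smooth_continuous_on[OF F(1)]] by blast
  \<comment> \<open>A majorant with an explicit antiderivative: the first term is the derivative of
    \<open>H (\<gamma> t)\<close>, the second pays for the time \<open>2 * r\<close> that the clock
    loses.\<close>
  let ?G = "\<lambda>t. F (\<gamma> t) * (F (\<gamma> t) * deriv \<kappa> t) + B\<^sup>2 / 2 * (1 - deriv \<kappa> t)"
  have FTC: "integral {0..M} ?G = (H (\<gamma> M) + B\<^sup>2 / 2 * (M - \<kappa> M)) - (H (\<gamma> 0) + B\<^sup>2 / 2 * (0 - \<kappa> 0))"
  proof (rule antiderivative_diff)
    show "((\<lambda>t. H (\<gamma> t) + B\<^sup>2 / 2 * (t - \<kappa> t)) has_real_derivative ?G t) (at t)" for t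
      by (intro DERIV_add DERIV_cmult DERIV_diff DERIV_ident smooth_DERIV \<kappa>(1) DERIV_chain2[OF H d])
    show "0 \<le> M" using T r by (simp add: M_def)
  qed
  have c\<gamma>: "continuous_on A \<gamma>" "continuous_on A (deriv \<gamma>)" "continuous_on A (deriv \<kappa>)" for A
    by (intro smooth_continuous_on smooth_deriv s\<gamma> \<kappa>(1))+
  have cF: "continuous_on A (\<lambda>t. F (\<gamma> t))" for A
    by (intro smooth_continuous_on smooth_comp[OF F(1)] s\<gamma>)
  have "integral {0..M} (\<lambda>t. (deriv \<gamma> t)\<^sup>2 / 2 + W (\<gamma> t)) \<le> integral {0..M} ?G"
  proof (rule integral_le)
    show "(\<lambda>t. (deriv \<gamma> t)\<^sup>2 / 2 + W (\<gamma> t)) integrable_on {0..M}"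
      by (intro integrable_continuous_real continuous_intros c\<gamma> continuous_on_compose2[OF cW c\<gamma>(1)]) auto
    show "?G integrable_on {0..M}"
      by (intro integrable_continuous_real continuous_intros c\<gamma> cF)
    show "(deriv \<gamma> t)\<^sup>2 / 2 + W (\<gamma> t) \<le> ?G t" for t
    proof -
      let ?f = "F (\<gamma> t)" and ?k = "deriv \<kappa> t"
      have e1: "deriv \<gamma> t = ?f * ?k" using d by (rule DERIV_imp_deriv)
      have e2: "2 * W (\<gamma> t) \<le> ?f\<^sup>2"
        using F(4)[OF range[of t]] W0[of "\<gamma> t"] by (metis F(2) less_imp_le real_sqrt_le_iff real_sqrt_unique)
      have e3: "(?f * ?k)\<^sup>2 \<le> ?f\<^sup>2 * ?k"
      proof -
        have "?k * ?k \<le> ?k * 1" using \<kappa>(4,5)[of t] by (intro mult_left_mono)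
        then have "?f\<^sup>2 * (?k * ?k) \<le> ?f\<^sup>2 * (?k * 1)" by (rule mult_left_mono) simp
        moreover have "(?f * ?k)\<^sup>2 = ?f\<^sup>2 * (?k * ?k)" by (simp add: power2_eq_square mult_ac)
        ultimately show ?thesis by (simp only: mult_1_right)
      qed
      have e4: "?f\<^sup>2 * (1 - ?k) \<le> B\<^sup>2 * (1 - ?k)"
        using \<kappa>(5)[of t] F(2,3)[of "\<gamma> t"] by (intro mult_right_mono power_mono) auto
      have e5: "?f\<^sup>2 * (1 - ?k) = ?f\<^sup>2 - ?f\<^sup>2 * ?k" by (simp add: algebra_simps)
      have e6: "?f * (?f * ?k) = ?f\<^sup>2 * ?k" by (simp add: power2_eq_square)
      have "X / 2 + w \<le> Y + Z / 2"
        if "2 * w \<le> f" "X \<le> Y" "f - Y \<le> Z" for X Y Z f w :: real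
        using that by linarith
      from this[OF e2 e3 e4[unfolded e5]] show ?thesis unfolding e1 e6 by simp
    qed
  qed
  also have "\<dots> = H 1 - H (-1) + B\<^sup>2 * r"
    unfolding FTC using start[of 0] stop[of M] \<kappa>(2)[of 0] \<kappa>(3)[of M] by (simp add: M_def)
  also have "H 1 - H (-1) = integral {-1..1} F"
    by (rule antiderivative_diff[OF H, symmetric]) simp
  also have "\<dots> \<le> integral {-1..1} (\<lambda>s. sqrt (2 * W s) + \<mu>)"
  proof (rule integral_le)
    show "F integrable_on {-1..1}" by (intro integrable_continuous_real smooth_continuous_on F(1))
    show "(\<lambda>s. sqrt (2 * W s) + \<mu>) integrable_on {-1..1}"
      by (intro integrable_continuous_real continuous_intros continuous_on_subset[OF cW]) simp
  qed (rule F(5))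
  also have "\<dots> = sigma_W W + 2 * \<mu>"
    unfolding sigma_W_def
    by (subst Henstock_Kurzweil_Integration.integral_add)
      (auto intro!: integrable_continuous_real continuous_intros continuous_on_subset[OF cW])
  also have "sigma_W W + 2 * \<mu> + B\<^sup>2 * r = sigma_W W + \<eta>"
    using B by (simp add: \<mu>_def r_def)
  finally have "integral {0..M} (\<lambda>t. (deriv \<gamma> t)\<^sup>2 / 2 + W (\<gamma> t)) \<le> sigma_W W + \<eta>" by simp
  moreover have "M > 0" using T r by (simp add: M_def)
  ultimately show ?thesis using that s\<gamma> start stop range by blast
qed

subsection \<open>The upper bound\<close>

lemma H1_0_test_function:
  assumes "test_function (interior (cube \<rho>)) \<phi>"
  shows "H1_0 (cube \<rho>) \<phi> (grad \<phi> :: real^'n \<Rightarrow> real^'n)"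
  unfolding H1_0_def
  using assms H1_smooth[OF test_function_smooth[OF assms]]
  by (intro conjI exI[of _ "\<lambda>_. \<phi>"]) auto

text \<open>Boundary data plus a test function satisfy the boundary condition with a constant
  approximating sequence.\<close>

lemma sigma_cell_le_energy:
  fixes h \<phi> :: "real^'n \<Rightarrow> real"
  assumes h: "h = (\<lambda>x. q ((x \<bullet> e) / \<epsilon>))" "smooth h" and \<phi>: "test_function (interior (cube \<rho>)) \<phi>"
  shows "sigma_cell W q \<theta> \<epsilon> \<delta> e (cube \<rho>) \<le> energy \<epsilon> \<delta> \<theta> W (cube \<rho>) (\<lambda>x. h x + \<phi> x) (grad (\<lambda>x. h x + \<phi> x))"
  unfolding sigma_cell_def
proof (rule Inf_lower, rule CollectI, intro exI conjI refl)
  show "H1 (cube \<rho>) (\<lambda>x. h x + \<phi> x) (grad (\<lambda>x. h x + \<phi> x))"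
    by (intro H1_smooth smooth_add h test_function_smooth[OF \<phi>])
  show "eq_on_boundary (cube \<rho>) (\<lambda>x. h x + \<phi> x) (\<lambda>x. q ((x \<bullet> e) / \<epsilon>))"
    unfolding eq_on_boundary_def h(1)[symmetric] using H1_0_test_function[OF \<phi>]
    by (intro exI[of _ "grad \<phi>"]) (simp add: h(1))
qed (rule refl)

lemma energy_cube_eq:
  fixes u :: "real^'n \<Rightarrow> real"
  assumes [measurable]: "\<theta> \<in> borel_measurable borel" and u: "smooth u" and cW: "continuous_on UNIV W"
  shows "energy \<epsilon> \<delta> \<theta> W (cube \<rho>) u (grad u) =
    (\<integral>\<^sup>+x. ennreal (\<epsilon> / 2 * (norm (grad u x))\<^sup>2 + 1 / \<epsilon> * \<theta> (x /\<^sub>R \<delta>) * W (u x)) * indicator (cube \<rho>) x \<partial>lborel)"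
proof -
  have [measurable]: "u \<in> borel_measurable borel" "W \<in> borel_measurable borel" "grad u \<in> borel_measurable borel"
    using cW smooth_continuous_on[OF u] continuous_on_grad[OF u] by (auto intro: borel_measurable_continuous_onI)
  show ?thesis unfolding energy_def by (rule nn_integral_lebesgue_on_borel) measurable
qed

lemma square_sum3_le: "(a + b + c)\<^sup>2 \<le> 3 * (a\<^sup>2 + b\<^sup>2 + (c::real)\<^sup>2)"
proof -
  have "0 \<le> (a - b)\<^sup>2 + (b - c)\<^sup>2 + (a - c)\<^sup>2" by simp
  then show ?thesis by (simp add: power2_eq_square algebra_simps)
qed

text \<open>The strip has width l along the two faces normal to i. For i = k it misses the
  transition zone \<open>{-\<kappa><..<\<kappa>}\<close>, so only A contributes; for other i the
  integral factors.\<close>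

lemma nn_integral_strip:
  fixes F :: "real \<Rightarrow> ennreal" and i k :: "'n::finite"
  assumes F: "F = (\<lambda>t. ennreal (A + B * indicator {-\<kappa><..<\<kappa>} t))" "A \<ge> 0" "B \<ge> 0"
    and \<rho>: "\<rho> > 0" and l: "0 \<le> l" "\<kappa> > 0" "\<kappa> + l \<le> \<rho> / 2"
  shows "(\<integral>\<^sup>+x. F (x $ k) * indicator {t. \<bar>t\<bar> > \<rho> / 2 - l} (x $ i) * indicator (cube \<rho>) x \<partial>(lborel :: (real^'n) measure))
    \<le> ennreal (2 * l * (A * \<rho> ^ (CARD('n) - 1) + 2 * \<kappa> * B * \<rho> ^ (CARD('n) - 2)))"
proof -
  let ?S = "{t. \<bar>t\<bar> > \<rho> / 2 - l}" and ?I = "{- \<rho> / 2..\<rho> / 2}"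
  have [measurable]: "F \<in> borel_measurable borel" unfolding F(1) by measurable
  have S: "emeasure lborel (?S \<inter> ?I) \<le> ennreal (2 * l)"
  proof -
    have "emeasure lborel (?S \<inter> ?I) \<le> emeasure lborel ({- \<rho> / 2..- \<rho> / 2 + l} \<union> {\<rho> / 2 - l..\<rho> / 2})"
      by (intro emeasure_mono) auto
    also have "\<dots> \<le> emeasure lborel {- \<rho> / 2..- \<rho> / 2 + l} + emeasure lborel {\<rho> / 2 - l..\<rho> / 2}"
      by (intro emeasure_subadditive) auto
    also have "\<dots> = ennreal (2 * l)"
      using l by (simp add: ennreal_plus[symmetric] del: ennreal_plus)
    finally show ?thesis .
  qed
  have hS: "(\<integral>\<^sup>+t. indicator ?S t * indicator ?I t \<partial>lborel) = emeasure lborel (?S \<inter> ?I)"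
    by (simp add: indicator_inter_arith[symmetric])
  show ?thesis
  proof (cases "i = k")
    case True
    have "(\<integral>\<^sup>+x. F (x $ k) * indicator ?S (x $ i) * indicator (cube \<rho>) x \<partial>(lborel :: (real^'n) measure)) =
      ennreal \<rho> ^ (CARD('n) - 1) * (\<integral>\<^sup>+t. F t * indicator ?S t * indicator ?I t \<partial>lborel)"
      unfolding True using nn_integral_cube_coord[of "\<lambda>t. F t * indicator ?S t" \<rho> k] \<rho> by simp
    also have "(\<integral>\<^sup>+t. F t * indicator ?S t * indicator ?I t \<partial>lborel) = (\<integral>\<^sup>+t. ennreal A * indicator (?S \<inter> ?I) t \<partial>lborel)"
      using l by (intro nn_integral_cong) (auto simp: F(1) indicator_def)
    also have "\<dots> \<le> ennreal A * ennreal (2 * l)"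
      using S by (subst nn_integral_cmult_indicator) (auto intro: mult_left_mono)
    also have "ennreal \<rho> ^ (CARD('n) - 1) * (ennreal A * ennreal (2 * l)) = ennreal (2 * l * (A * \<rho> ^ (CARD('n) - 1)))"
      using \<rho> l F by (simp add: ennreal_power ennreal_mult[symmetric] mult_ac)
    also have "\<dots> \<le> ennreal (2 * l * (A * \<rho> ^ (CARD('n) - 1) + 2 * \<kappa> * B * \<rho> ^ (CARD('n) - 2)))"
      using \<rho> l F by (intro ennreal_leI mult_left_mono) auto
    finally show ?thesis by (simp add: mult_left_mono)
  next
    case False
    have n2: "CARD('n) \<ge> 2"
    proof -
      have "card {i, k} \<le> CARD('n)" by (intro card_mono) auto
      then show ?thesis using False by simp
    qed
    have "(\<integral>\<^sup>+t. F t * indicator ?I t \<partial>lborel) \<le> (\<integral>\<^sup>+t. ennreal A * indicator ?I t + ennreal B * indicator {-\<kappa><..<\<kappa>} t \<partial>lborel)"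
      using F by (intro nn_integral_mono) (auto simp: indicator_def)
    also have "\<dots> = ennreal (A * \<rho> + B * (2 * \<kappa>))"
      using F \<rho> l by (simp add: nn_integral_add nn_integral_cmult_indicator ennreal_mult[symmetric] ennreal_plus[symmetric] del: ennreal_plus)
    finally have I: "(\<integral>\<^sup>+t. F t * indicator ?I t \<partial>lborel) \<le> ennreal (A * \<rho> + B * (2 * \<kappa>))" .
    have "(\<integral>\<^sup>+x. F (x $ k) * indicator ?S (x $ i) * indicator (cube \<rho>) x \<partial>(lborel :: (real^'n) measure)) =
      ennreal \<rho> ^ (CARD('n) - 2) * (\<integral>\<^sup>+t. F t * indicator ?I t \<partial>lborel) * (\<integral>\<^sup>+t. indicator ?S t * indicator ?I t \<partial>lborel)"
      by (rule nn_integral_cube_coord2) (use \<rho> False in auto)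
    also have "\<dots> \<le> ennreal \<rho> ^ (CARD('n) - 2) * ennreal (A * \<rho> + B * (2 * \<kappa>)) * ennreal (2 * l)"
      unfolding hS by (intro mult_mono order_refl I S) auto
    also have "\<dots> = ennreal (2 * l * (A * (\<rho> ^ (CARD('n) - 2) * \<rho>) + 2 * \<kappa> * B * \<rho> ^ (CARD('n) - 2)))"
      using \<rho> l F by (simp add: ennreal_power ennreal_mult[symmetric] algebra_simps)
    also have "\<rho> ^ (CARD('n) - 2) * \<rho> = \<rho> ^ (CARD('n) - 1)"
      using n2 by (metis Suc_diff_Suc Suc_1 Suc_le_lessD power_Suc2)
    finally show ?thesis .
  qed
qed

context periodic_weight
begin

text \<open>The gradient part e carries no weight; only P is homogenized. As P varies in a slab of
  width \<open>M * \<epsilon> + \<delta>\<close>, division by \<epsilon> leaves \<omega> times a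
  bounded width, besides the shell.\<close>

lemma interior_energy_bound:
  fixes P e :: "real \<Rightarrow> real" and k :: 'n
  assumes cP: "continuous_on UNIV P" and P0: "\<And>t. 0 \<le> P t" and PK: "\<And>t. P t \<le> K"
    and Pout: "\<And>t. t \<le> 0 \<or> t \<ge> M \<Longrightarrow> P t = 0"
    and ce: "continuous_on UNIV e" and e0: "\<And>t. 0 \<le> e t" and eout: "\<And>t. t < 0 \<or> t > M \<Longrightarrow> e t = 0"
    and \<omega>: "\<And>s t. \<bar>s - t\<bar> \<le> \<delta> / \<epsilon> \<Longrightarrow> \<bar>P s - P t\<bar> \<le> \<omega>" and \<omega>0: "\<omega> \<ge> 0"
    and \<epsilon>: "\<epsilon> > 0" and \<delta>: "\<delta> > 0" "2 * \<delta> \<le> \<rho>" and M: "M > 0"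
  shows "(\<integral>\<^sup>+x. ennreal (1 / \<epsilon> * e ((x $ k - r) / \<epsilon>) + 1 / \<epsilon> * \<theta> (x /\<^sub>R \<delta>) * P ((x $ k - r) / \<epsilon>)) * indicator (cube \<rho>) x \<partial>lborel)
    \<le> ennreal (\<rho> ^ (CARD('n) - 1) * integral {0..M} (\<lambda>t. e t + P t)
      + \<Theta> * (K * shell_const TYPE('n) \<rho> * (\<delta> / \<epsilon>) + \<omega> * \<rho> ^ (CARD('n) - 1) * (M + \<delta> / \<epsilon>)))"
proof -
  have \<rho>: "\<rho> > 0" using \<delta> by simp
  have [measurable]: "P \<in> borel_measurable borel" "e \<in> borel_measurable borel"
    using cP ce by (auto intro: borel_measurable_continuous_onI)
  have K0: "K \<ge> 0" using P0 PK order_trans by blast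
  let ?p = "\<lambda>x::real^'n. P ((x $ k - r) / \<epsilon>)"
  let ?\<psi> = "\<lambda>x. indicator (cube \<rho>) x * ?p x"
  let ?N = "cube (\<rho> + 2 * \<delta>) - cube (\<rho> - 2 * \<delta>) :: (real^'n) set"
  \<comment> \<open>The translation goes back by at most \<delta>, hence the extra \<delta> at the
    far end only.\<close>
  let ?A = "{r..r + M * \<epsilon> + \<delta>}"
  define c where "c = K * shell_const TYPE('n) \<rho> * \<delta> + \<omega> * \<rho> ^ (CARD('n) - 1) * (M * \<epsilon> + \<delta>)"
  have sc0: "shell_const TYPE('n) \<rho> \<ge> 0" using \<rho> by (intro shell_const_nonneg) simp
  have c0: "c \<ge> 0" unfolding c_def using K0 sc0 \<delta> \<omega>0 \<rho> M \<epsilon> by (intro add_nonneg_nonneg mult_nonneg_nonneg) auto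
  have osc: "(\<integral>\<^sup>+x. ennreal \<bar>?\<psi> (x - \<delta> *\<^sub>R z) - ?\<psi> x\<bar> \<partial>lborel) \<le> ennreal c" if "z \<in> cell" for z
  proof -
    have z: "0 \<le> z $ j \<and> z $ j < 1" for j using that by (simp add: cell_def)
    have dz: "0 \<le> \<delta> * z $ k" "\<delta> * z $ k \<le> \<delta>"
      using z[of k] \<delta> by (auto simp: mult_left_le)
    have diff: "\<bar>?p (x - \<delta> *\<^sub>R z) - ?p x\<bar> \<le> \<omega> * indicator ?A (x $ k)" for x
    proof (cases "x $ k \<in> ?A")
      case True
      have "\<bar>(x $ k - \<delta> * z $ k - r) / \<epsilon> - (x $ k - r) / \<epsilon>\<bar> = \<delta> * z $ k / \<epsilon>"
        using dz \<epsilon> by (simp add: diff_divide_distrib)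
      also have "\<dots> \<le> \<delta> / \<epsilon>" using dz \<epsilon> by (intro divide_right_mono) auto
      finally show ?thesis using \<omega> True by simp
    next
      case False
      then consider "x $ k < r" | "x $ k > r + M * \<epsilon> + \<delta>" by fastforce
      then have "?p x = 0 \<and> ?p (x - \<delta> *\<^sub>R z) = 0"
      proof cases
        case 1
        then have "(x $ k - r) / \<epsilon> \<le> 0" "(x $ k - \<delta> * z $ k - r) / \<epsilon> \<le> 0"
          using dz \<epsilon> by (auto simp: divide_nonpos_pos)
        then show ?thesis using Pout by simp
      next
        case 2
        then have "(x $ k - r) / \<epsilon> \<ge> M" "(x $ k - \<delta> * z $ k - r) / \<epsilon> \<ge> M"
          unfolding pos_le_divide_eq[OF \<epsilon>] using dz \<delta> by linarith+
        then show ?thesis using Pout by simp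
      qed
      then show ?thesis using False by simp
    qed
    have "(\<integral>\<^sup>+x. ennreal \<bar>?\<psi> (x - \<delta> *\<^sub>R z) - ?\<psi> x\<bar> \<partial>lborel) \<le>
      (\<integral>\<^sup>+x. ennreal K * indicator ?N x + ennreal \<omega> * (indicator ?A (x $ k) * indicator (cube \<rho>) x) \<partial>lborel)"
    proof (rule nn_integral_mono)
      fix x :: "real^'n"
      have sub: "cube (\<rho> - 2 * \<delta>) \<subseteq> (cube \<rho> :: (real^'n) set)"
      proof
        fix y :: "real^'n" assume "y \<in> cube (\<rho> - 2 * \<delta>)"
        moreover have "(\<rho> - 2 * \<delta>) / 2 \<le> \<rho> / 2" using \<delta> by simp
        ultimately show "y \<in> cube \<rho>" unfolding mem_cube by (meson order_trans)
      qed
      have "\<bar>?\<psi> (x - \<delta> *\<^sub>R z) - ?\<psi> x\<bar> \<le> K * indicator ?N x + \<omega> * indicator ?A (x $ k) * indicator (cube (\<rho> - 2 * \<delta>)) x"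
        by (rule translate_diff_cube[where f = ?p and \<eta> = "\<lambda>x. \<omega> * indicator ?A (x $ k)"])
          (rule z \<delta>(1) P0 PK diff | use \<omega>0 in simp)+
      also have "\<dots> \<le> K * indicator ?N x + \<omega> * (indicator ?A (x $ k) * indicator (cube \<rho>) x)"
        using sub \<omega>0 by (auto simp: indicator_def)
      finally have "ennreal \<bar>?\<psi> (x - \<delta> *\<^sub>R z) - ?\<psi> x\<bar> \<le> ennreal (K * indicator ?N x + \<omega> * (indicator ?A (x $ k) * indicator (cube \<rho>) x))"
        by (rule ennreal_leI)
      then show "ennreal \<bar>?\<psi> (x - \<delta> *\<^sub>R z) - ?\<psi> x\<bar> \<le> ennreal K * indicator ?N x + ennreal \<omega> * (indicator ?A (x $ k) * indicator (cube \<rho>) x)"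
        using K0 \<omega>0 by (auto simp: indicator_def)
    qed
    also have "\<dots> = ennreal K * emeasure lborel ?N + ennreal \<omega> * (\<integral>\<^sup>+x. indicator ?A (x $ k) * indicator (cube \<rho>) x \<partial>(lborel :: (real^'n) measure))"
      by (simp add: nn_integral_add nn_integral_cmult nn_integral_cmult_indicator)
    also have "(\<integral>\<^sup>+x. indicator ?A (x $ k) * indicator (cube \<rho>) x \<partial>(lborel :: (real^'n) measure)) =
       ennreal \<rho> ^ (CARD('n) - 1) * (\<integral>\<^sup>+t. indicator ?A t * indicator {- \<rho> / 2..\<rho> / 2} t \<partial>lborel)"
      by (rule nn_integral_cube_coord) (use \<rho> in auto)
    also have "(\<integral>\<^sup>+t. indicator ?A t * indicator {- \<rho> / 2..\<rho> / 2} t \<partial>lborel) \<le> (\<integral>\<^sup>+t. indicator ?A t \<partial>lborel)"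
      by (intro nn_integral_mono) (auto simp: indicator_def)
    also have "\<dots> = ennreal (M * \<epsilon> + \<delta>)"
      using M \<epsilon> \<delta> by simp
    also have "ennreal K * emeasure lborel ?N + ennreal \<omega> * (ennreal \<rho> ^ (CARD('n) - 1) * ennreal (M * \<epsilon> + \<delta>)) \<le>
        ennreal K * ennreal (shell_const TYPE('n) \<rho> * \<delta>) + ennreal \<omega> * (ennreal \<rho> ^ (CARD('n) - 1) * ennreal (M * \<epsilon> + \<delta>))"
      by (intro add_mono mult_left_mono emeasure_shell order_refl) (use \<delta> in auto)
    also have "\<dots> = ennreal c"
      unfolding c_def using K0 sc0 \<delta> \<omega>0 \<rho> M \<epsilon>
      by (simp add: ennreal_power ennreal_mult[symmetric] ennreal_plus[symmetric] mult.assoc del: ennreal_plus)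
    finally show ?thesis by (simp add: add_left_mono mult_left_mono)
  qed
  have hom: "(\<integral>\<^sup>+x. ennreal (?\<psi> x * \<theta> (x /\<^sub>R \<delta>)) \<partial>lborel) \<le> (\<integral>\<^sup>+x. ennreal (?\<psi> x) \<partial>lborel) + ennreal \<Theta> * ennreal c"
    by (rule homogenization_estimate(1)[OF _ _ \<delta>(1) osc]) (use P0 in \<open>auto simp: indicator_def\<close>)
  let ?E = "\<lambda>x::real^'n. ennreal (1 / \<epsilon> * e ((x $ k - r) / \<epsilon>)) * indicator (cube \<rho>) x"
  have "(\<integral>\<^sup>+x. ennreal (1 / \<epsilon> * e ((x $ k - r) / \<epsilon>) + 1 / \<epsilon> * \<theta> (x /\<^sub>R \<delta>) * ?p x) * indicator (cube \<rho>) x \<partial>lborel) =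
      (\<integral>\<^sup>+x. ?E x + ennreal (1 / \<epsilon>) * ennreal (?\<psi> x * \<theta> (x /\<^sub>R \<delta>)) \<partial>lborel)"
    using e0 P0 pos \<epsilon> by (intro nn_integral_cong) (auto simp: indicator_def ennreal_mult[symmetric] less_imp_le mult_ac)
  also have "\<dots> = (\<integral>\<^sup>+x. ?E x \<partial>lborel) + ennreal (1 / \<epsilon>) * (\<integral>\<^sup>+x. ennreal (?\<psi> x * \<theta> (x /\<^sub>R \<delta>)) \<partial>lborel)"
    by (simp add: nn_integral_add nn_integral_cmult)
  also have "\<dots> \<le> (\<integral>\<^sup>+x. ?E x \<partial>lborel) + ennreal (1 / \<epsilon>) * ((\<integral>\<^sup>+x. ennreal (?\<psi> x) \<partial>lborel) + ennreal \<Theta> * ennreal c)"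
    by (intro add_left_mono mult_left_mono hom) simp
  also have "\<dots> = ((\<integral>\<^sup>+x. ?E x \<partial>lborel) + ennreal (1 / \<epsilon>) * (\<integral>\<^sup>+x. ennreal (?\<psi> x) \<partial>lborel)) + ennreal (1 / \<epsilon>) * (ennreal \<Theta> * ennreal c)"
    by (simp add: distrib_left add.assoc)
  also have "(\<integral>\<^sup>+x. ?E x \<partial>lborel) + ennreal (1 / \<epsilon>) * (\<integral>\<^sup>+x. ennreal (?\<psi> x) \<partial>lborel) =
      (\<integral>\<^sup>+x. ?E x + ennreal (1 / \<epsilon>) * ennreal (?\<psi> x) \<partial>lborel)"
    by (simp add: nn_integral_add nn_integral_cmult)
  also have "\<dots> = (\<integral>\<^sup>+x. (ennreal (1 / \<epsilon>) * ennreal (e ((x $ k - r) / \<epsilon>) + P ((x $ k - r) / \<epsilon>))) * indicator (cube \<rho>) x \<partial>lborel)"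
    using e0 P0 \<epsilon> by (intro nn_integral_cong) (auto simp: indicator_def ennreal_mult[symmetric] distrib_left ennreal_plus[symmetric] add_divide_distrib simp del: ennreal_plus)
  also have "\<dots> = ennreal \<rho> ^ (CARD('n) - 1) * (\<integral>\<^sup>+t. (ennreal (1 / \<epsilon>) * ennreal (e ((t - r) / \<epsilon>) + P ((t - r) / \<epsilon>))) * indicator {- \<rho> / 2..\<rho> / 2} t \<partial>lborel)"
    by (rule nn_integral_cube_coord) (use \<rho> in auto)
  also have "(\<integral>\<^sup>+t. (ennreal (1 / \<epsilon>) * ennreal (e ((t - r) / \<epsilon>) + P ((t - r) / \<epsilon>))) * indicator {- \<rho> / 2..\<rho> / 2} t \<partial>lborel)
     \<le> (\<integral>\<^sup>+t. ennreal (1 / \<epsilon>) * ennreal (e ((t - r) / \<epsilon>) + P ((t - r) / \<epsilon>)) \<partial>lborel)"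
    by (intro nn_integral_mono) (auto simp: indicator_def)
  also have "\<dots> = ennreal (1 / \<epsilon>) * (\<integral>\<^sup>+t. ennreal (e ((t - r) / \<epsilon>) + P ((t - r) / \<epsilon>)) \<partial>lborel)"
    by (rule nn_integral_cmult) measurable
  also have "(\<integral>\<^sup>+t. ennreal (e ((t - r) / \<epsilon>) + P ((t - r) / \<epsilon>)) \<partial>lborel) = ennreal \<epsilon> * (\<integral>\<^sup>+t. ennreal (e t + P t) \<partial>lborel)"
    using \<epsilon> by (subst nn_integral_real_affine[where c = \<epsilon> and t = r]) auto
  also have "(\<integral>\<^sup>+t. ennreal (e t + P t) \<partial>lborel) = ennreal (integral {0..M} (\<lambda>t. e t + P t))"
  proof -
    have cc: "continuous_on {0..M} (\<lambda>t. e t + P t)"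
      by (intro continuous_on_add continuous_on_subset[OF ce] continuous_on_subset[OF cP]) auto
    have "((\<lambda>t. e t + P t) has_integral integral {0..M} (\<lambda>t. e t + P t)) {0..M}"
      by (rule integrable_integral[OF integrable_continuous_real[OF cc]])
    then have "(\<integral>\<^sup>+t. ennreal (e t + P t) * indicator {0..M} t \<partial>lborel) = ennreal (integral {0..M} (\<lambda>t. e t + P t))"
      by (intro nn_integral_has_integral_lebesgue') (use e0 P0 in auto)
    moreover have "(\<integral>\<^sup>+t. ennreal (e t + P t) \<partial>lborel) = (\<integral>\<^sup>+t. ennreal (e t + P t) * indicator {0..M} t \<partial>lborel)"
      by (intro nn_integral_cong) (auto simp: indicator_def eout Pout)
    ultimately show ?thesis by simp
  qed
  finally have *: "(\<integral>\<^sup>+x. ennreal (1 / \<epsilon> * e ((x $ k - r) / \<epsilon>) + 1 / \<epsilon> * \<theta> (x /\<^sub>R \<delta>) * ?p x) * indicator (cube \<rho>) x \<partial>lborel) \<le>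
      ennreal \<rho> ^ (CARD('n) - 1) * (ennreal (1 / \<epsilon>) * (ennreal \<epsilon> * ennreal (integral {0..M} (\<lambda>t. e t + P t))))
      + ennreal (1 / \<epsilon>) * (ennreal \<Theta> * ennreal c)"
    by (simp add: mult_left_mono add_right_mono)
  have I0: "integral {0..M} (\<lambda>t. e t + P t) \<ge> 0"
    by (rule Henstock_Kurzweil_Integration.integral_nonneg)
      (use e0 P0 in \<open>auto intro!: integrable_continuous_real continuous_on_add continuous_on_subset[OF ce] continuous_on_subset[OF cP]\<close>)
  have "ennreal \<rho> ^ (CARD('n) - 1) * (ennreal (1 / \<epsilon>) * (ennreal \<epsilon> * ennreal (integral {0..M} (\<lambda>t. e t + P t)))) =
      ennreal (\<rho> ^ (CARD('n) - 1) * integral {0..M} (\<lambda>t. e t + P t))"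
    using \<rho> \<epsilon> I0 by (simp add: ennreal_power ennreal_mult[symmetric])
  moreover have "ennreal (1 / \<epsilon>) * (ennreal \<Theta> * ennreal c) =
      ennreal (\<Theta> * (K * shell_const TYPE('n) \<rho> * (\<delta> / \<epsilon>) + \<omega> * \<rho> ^ (CARD('n) - 1) * (M + \<delta> / \<epsilon>)))"
  proof -
    have "1 / \<epsilon> * (\<Theta> * c) = \<Theta> * (K * shell_const TYPE('n) \<rho> * (\<delta> / \<epsilon>) + \<omega> * \<rho> ^ (CARD('n) - 1) * (M + \<delta> / \<epsilon>))"
      using \<epsilon> by (simp add: c_def field_simps)
    then show ?thesis using \<epsilon> c0 bound_pos by (simp add: ennreal_mult[symmetric])
  qed
  moreover have "0 \<le> \<Theta> * (K * shell_const TYPE('n) \<rho> * (\<delta> / \<epsilon>) + \<omega> * \<rho> ^ (CARD('n) - 1) * (M + \<delta> / \<epsilon>))"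
    using bound_pos K0 sc0 \<delta> \<omega>0 \<rho> M \<epsilon> by (intro add_nonneg_nonneg mult_nonneg_nonneg) auto
  ultimately show ?thesis using * I0 \<rho> by (simp add: ennreal_plus[symmetric] del: ennreal_plus)
qed


text \<open>In the boundary layer the cut-off costs \<open>(g - h)\<^sup>2 / (s * \<epsilon>)\<^sup>2\<close>, and \<open>g - h\<close> is small away from
  \<open>x\<^sub>k = 0\<close>.\<close>
lemma layer_energy_density:
  fixes \<gamma> q W :: "real \<Rightarrow> real" and k :: 'n and x :: "real^'n"
  assumes \<gamma>: "smooth \<gamma>" "\<And>t. \<gamma> t \<in> {-1..1}" "\<And>t. \<bar>deriv \<gamma> t\<bar> \<le> C"
    and q: "smooth q" "\<And>t. q t \<in> {-1..1}" "\<And>t. \<bar>deriv q t\<bar> \<le> C"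
    and W: "\<And>s. s \<in> {-1..1} \<Longrightarrow> W s \<le> K" "\<And>s. 0 \<le> W s"
    and cut: "\<And>x. norm (grad (cutoff \<rho> (s * \<epsilon>)) x :: real^'n) \<le> Cc / (s * \<epsilon>)"
    and \<epsilon>: "\<epsilon> > 0" and s: "s > 0" and \<theta>s: "0 \<le> \<theta>s" "\<theta>s \<le> 2 * \<Theta>"
    and u: "u = (\<lambda>x::real^'n. q (x $ k / \<epsilon>) + (\<gamma> ((x $ k - r) / \<epsilon>) - q (x $ k / \<epsilon>)) * cutoff \<rho> (s * \<epsilon>) x)"
    and D: "(\<gamma> ((x $ k - r) / \<epsilon>) - q (x $ k / \<epsilon>))\<^sup>2 \<le> D"
  shows "\<epsilon> / 2 * (norm (grad u x))\<^sup>2 + 1 / \<epsilon> * \<theta>s * W (u x) \<le> (3 * C\<^sup>2 + 2 * \<Theta> * K) / \<epsilon> + 3 / 2 * Cc\<^sup>2 / s\<^sup>2 * D / \<epsilon>"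
proof -
  let ?h = "\<lambda>x::real^'n. q (x $ k / \<epsilon>)" and ?g = "\<lambda>x::real^'n. \<gamma> ((x $ k - r) / \<epsilon>)" and ?c = "cutoff \<rho> (s * \<epsilon>) :: real^'n \<Rightarrow> real"
  have sq: "smooth (\<lambda>t. q (t / \<epsilon>))" by (rule smooth_scaled(2)[OF q(1)])
  have sg: "smooth (\<lambda>t. \<gamma> ((t - r) / \<epsilon>))" by (rule smooth_scaled(1)[OF \<gamma>(1)])
  have sh: "smooth ?h" "smooth ?g"
    by (rule smooth_comp[OF sq smooth_vec_nth] smooth_comp[OF sg smooth_vec_nth])+
  have dq: "((\<lambda>t. q (t / \<epsilon>)) has_real_derivative deriv q (t / \<epsilon>) * (1 / \<epsilon>)) (at t)" for t
    by (rule DERIV_chain2[OF smooth_DERIV[OF q(1)]]) (use \<epsilon> in \<open>auto intro!: derivative_eq_intros\<close>)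
  have dg: "((\<lambda>t. \<gamma> ((t - r) / \<epsilon>)) has_real_derivative deriv \<gamma> ((t - r) / \<epsilon>) * (1 / \<epsilon>)) (at t)" for t
    by (rule DERIV_chain2[OF smooth_DERIV[OF \<gamma>(1)]]) (use \<epsilon> in \<open>auto intro!: derivative_eq_intros\<close>)
  have gh: "grad ?h x = (deriv q (x $ k / \<epsilon>) * (1 / \<epsilon>)) *\<^sub>R axis k 1"
    by (rule grad_coordinate[OF dq])
  have gg: "grad ?g x = (deriv \<gamma> ((x $ k - r) / \<epsilon>) * (1 / \<epsilon>)) *\<^sub>R axis k 1"
    by (rule grad_coordinate[OF dg])
  have C0: "C \<ge> 0" using q(3)[of 0] by linarith
  have nh: "norm (grad ?h x) \<le> C / \<epsilon>" and ng: "norm (grad ?g x) \<le> C / \<epsilon>"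
    using q(3)[of "x $ k / \<epsilon>"] \<gamma>(3)[of "(x $ k - r) / \<epsilon>"] \<epsilon> by (simp_all add: gh gg divide_right_mono)
  let ?d = "?g x - ?h x"
  have sd: "smooth (\<lambda>x. ?g x - ?h x)" by (intro smooth_diff sh)
  have "grad u x = grad ?h x + ((?g x - ?h x) *\<^sub>R grad ?c x + ?c x *\<^sub>R grad (\<lambda>x. ?g x - ?h x) x)"
    unfolding u
    by (subst grad_add, (intro smooth_differentiable sh smooth_mult sd smooth_cutoff)+,
        subst grad_mult, (intro smooth_differentiable sd smooth_cutoff)+) simp
  also have "grad (\<lambda>x. ?g x - ?h x) x = grad ?g x - grad ?h x"
    by (intro grad_diff smooth_differentiable sh)
  \<comment> \<open>A convex combination of the two gradients plus the mismatch times the gradient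
    of the cut-off. Only the last term brings in a factor 1 / s.\<close>
  finally have gu: "grad u x = (1 - ?c x) *\<^sub>R grad ?h x + ?c x *\<^sub>R grad ?g x + ?d *\<^sub>R grad ?c x"
    by (simp add: algebra_simps)
  have "norm (grad u x) \<le> norm ((1 - ?c x) *\<^sub>R grad ?h x) + norm (?c x *\<^sub>R grad ?g x) + norm (?d *\<^sub>R grad ?c x)"
    unfolding gu by (intro norm_triangle_le add_mono norm_triangle_ineq order_refl)
  also have "\<dots> \<le> C / \<epsilon> + C / \<epsilon> + \<bar>?d\<bar> * (Cc / (s * \<epsilon>))"
  proof (intro add_mono)
    have c01: "0 \<le> ?c x" "?c x \<le> 1" by (rule cutoff_nonneg cutoff_le_1)+
    have "(1 - ?c x) * norm (grad ?h x) \<le> 1 * (C / \<epsilon>)" using c01 nh by (intro mult_mono) auto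
    then show "norm ((1 - ?c x) *\<^sub>R grad ?h x) \<le> C / \<epsilon>" using c01 by simp
    have "?c x * norm (grad ?g x) \<le> 1 * (C / \<epsilon>)" using c01 ng by (intro mult_mono) auto
    then show "norm (?c x *\<^sub>R grad ?g x) \<le> C / \<epsilon>" using c01 by simp
    show "norm (?d *\<^sub>R grad ?c x) \<le> \<bar>?d\<bar> * (Cc / (s * \<epsilon>))"
      unfolding norm_scaleR by (intro mult_left_mono cut) auto
  qed
  finally have "(norm (grad u x))\<^sup>2 \<le> (C / \<epsilon> + C / \<epsilon> + \<bar>?d\<bar> * (Cc / (s * \<epsilon>)))\<^sup>2"
    by (intro power_mono) auto
  also have "\<dots> \<le> 3 * ((C / \<epsilon>)\<^sup>2 + (C / \<epsilon>)\<^sup>2 + (\<bar>?d\<bar> * (Cc / (s * \<epsilon>)))\<^sup>2)" by (rule square_sum3_le)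
  also have "\<dots> = 6 * C\<^sup>2 / \<epsilon>\<^sup>2 + 3 * (Cc\<^sup>2 / (s\<^sup>2 * \<epsilon>\<^sup>2) * ?d\<^sup>2)"
    by (simp add: power_mult_distrib power_divide)
  also have "\<dots> \<le> 6 * C\<^sup>2 / \<epsilon>\<^sup>2 + 3 * (Cc\<^sup>2 / (s\<^sup>2 * \<epsilon>\<^sup>2) * D)"
    using D by (intro add_left_mono mult_left_mono) auto
  finally have "\<epsilon> / 2 * (norm (grad u x))\<^sup>2 \<le> \<epsilon> / 2 * (6 * C\<^sup>2 / \<epsilon>\<^sup>2 + 3 * (Cc\<^sup>2 / (s\<^sup>2 * \<epsilon>\<^sup>2) * D))"
    using \<epsilon> by (intro mult_left_mono) auto
  also have "\<dots> = 3 * C\<^sup>2 / \<epsilon> + 3 / 2 * Cc\<^sup>2 / s\<^sup>2 * D / \<epsilon>"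
    using \<epsilon> s by (simp add: field_simps power2_eq_square)
  finally have A: "\<epsilon> / 2 * (norm (grad u x))\<^sup>2 \<le> 3 * C\<^sup>2 / \<epsilon> + 3 / 2 * Cc\<^sup>2 / s\<^sup>2 * D / \<epsilon>" .
  have "u x = (1 - ?c x) * ?h x + ?c x * ?g x" by (simp add: u algebra_simps)
  moreover have "(1 - ?c x) * ?h x + ?c x * ?g x \<in> {-1..1}"
  proof -
    have "(1 - ?c x) *\<^sub>R ?h x + ?c x *\<^sub>R ?g x \<in> {-1..1}"
      by (rule convexD_alt) (use \<gamma>(2) q(2) cutoff_nonneg cutoff_le_1 in auto)
    then show ?thesis by simp
  qed
  ultimately have "W (u x) \<le> K" using W(1) by simp
  then have "\<theta>s * W (u x) \<le> 2 * \<Theta> * K"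
    using \<theta>s W(2) bound_pos by (intro mult_mono) auto
  then have "1 / \<epsilon> * (\<theta>s * W (u x)) \<le> 1 / \<epsilon> * (2 * \<Theta> * K)" using \<epsilon> by (intro mult_left_mono) auto
  then have "1 / \<epsilon> * \<theta>s * W (u x) \<le> 2 * \<Theta> * K / \<epsilon>" by simp
  then show ?thesis using A unfolding add_divide_distrib by linarith
qed

text \<open>Where the cut-off is 1, u is the profile itself; the rest of the cube is covered by
  strips of width \<open>2 * (s * \<epsilon>)\<close> along the faces. Multiplied by that width, the
  layer density of order \<open>1 / \<epsilon>\<close> leaves terms in s,
  \<open>\<kappa>\<^sup>2 / s\<close> and \<open>\<kappa> / s\<close>.\<close>

lemma energy_upper_bound:
  fixes \<gamma> q W S :: "real \<Rightarrow> real" and k :: 'n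
  assumes \<gamma>: "smooth \<gamma>" "\<And>t. \<gamma> t \<in> {-1..1}" "\<And>t. \<bar>deriv \<gamma> t\<bar> \<le> C" "\<And>t. t \<le> 0 \<Longrightarrow> \<gamma> t = -1" "\<And>t. t \<ge> M \<Longrightarrow> \<gamma> t = 1"
    and q: "smooth q" "\<And>t. q t \<in> {-1..1}" "\<And>t. \<bar>deriv q t\<bar> \<le> C"
    and W: "continuous_on UNIV W" "\<And>s. s \<in> {-1..1} \<Longrightarrow> W s \<le> K" "\<And>s. 0 \<le> W s" "W 1 = 0" "W (-1) = 0"
    and cut: "\<And>x. norm (grad (cutoff \<rho> (s * \<epsilon>)) x :: real^'n) \<le> Cc / (s * \<epsilon>)"
    and \<epsilon>: "\<epsilon> > 0" and s: "s > 0" and \<delta>: "\<delta> > 0" "2 * \<delta> \<le> \<rho>" and M: "M > 0"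
    and S: "S \<in> borel_measurable borel" "\<And>t. S t \<in> {1, 2}" "\<And>t. t \<in> {r..r + M * \<epsilon>} \<Longrightarrow> S (t / \<delta>) = 1"
    and u: "u = (\<lambda>x::real^'n. q (x $ k / \<epsilon>) + (\<gamma> ((x $ k - r) / \<epsilon>) - q (x $ k / \<epsilon>)) * cutoff \<rho> (s * \<epsilon>) x)"
    and \<kappa>: "\<kappa> > 0" "\<kappa> + 2 * (s * \<epsilon>) \<le> \<rho> / 2"
    and near: "\<And>t. \<bar>t\<bar> \<ge> \<kappa> \<Longrightarrow> \<bar>\<gamma> ((t - r) / \<epsilon>) - q (t / \<epsilon>)\<bar> \<le> \<kappa>"
    and \<omega>: "\<And>s t. \<bar>s - t\<bar> \<le> \<delta> / \<epsilon> \<Longrightarrow> \<bar>W (\<gamma> s) - W (\<gamma> t)\<bar> \<le> \<omega>"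
  shows "energy \<epsilon> \<delta> (\<lambda>y. S (y $ k) * \<theta> y) W (cube \<rho>) u (grad u) \<le>
    ennreal (\<rho> ^ (CARD('n) - 1) * integral {0..M} (\<lambda>t. (deriv \<gamma> t)\<^sup>2 / 2 + W (\<gamma> t))
      + \<Theta> * (K * shell_const TYPE('n) \<rho> * (\<delta> / \<epsilon>) + \<omega> * \<rho> ^ (CARD('n) - 1) * (M + \<delta> / \<epsilon>))
      + CARD('n) * (4 * ((3 * C\<^sup>2 + 2 * \<Theta> * K) * s + 3 / 2 * Cc\<^sup>2 * \<kappa>\<^sup>2 / s) * \<rho> ^ (CARD('n) - 1)
          + 48 * Cc\<^sup>2 * \<kappa> / s * \<rho> ^ (CARD('n) - 2)))"
proof -
  have \<rho>: "\<rho> > 0" using \<delta> by simp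
  have K0: "K \<ge> 0" using W(2,3)[of 1] by simp
  have \<omega>0: "\<omega> \<ge> 0" using \<omega>[of 0 0] \<delta> \<epsilon> by simp
  let ?g = "\<lambda>x::real^'n. \<gamma> ((x $ k - r) / \<epsilon>)"
  let ?\<theta>s = "\<lambda>y. S (y $ k) * \<theta> y"
  let ?e = "\<lambda>t. (deriv \<gamma> t)\<^sup>2 / 2" and ?P = "\<lambda>t. W (\<gamma> t)"
  define A where "A = (3 * C\<^sup>2 + 2 * \<Theta> * K) / \<epsilon> + 3 / 2 * Cc\<^sup>2 / s\<^sup>2 * \<kappa>\<^sup>2 / \<epsilon>"
  define B where "B = 3 / 2 * Cc\<^sup>2 / s\<^sup>2 * 4 / \<epsilon>"
  define F where "F = (\<lambda>t. ennreal (A + B * indicator {-\<kappa><..<\<kappa>} t))"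
  have AB: "A \<ge> 0" "B \<ge> 0" using K0 bound_pos \<epsilon> s by (auto simp: A_def B_def)
  have S0: "0 \<le> S t" "S t \<le> 2" for t using S(2)[of t] by auto
  have [measurable]: "S \<in> borel_measurable borel" by (rule S(1))
  have [measurable]: "F \<in> borel_measurable borel" unfolding F_def by measurable
  have sg: "smooth (\<lambda>t. \<gamma> ((t - r) / \<epsilon>))" by (rule smooth_scaled(1)[OF \<gamma>(1)])
  have sq: "smooth (\<lambda>t. q (t / \<epsilon>))" by (rule smooth_scaled(2)[OF q(1)])
  have su: "smooth u"
    unfolding u
    by (intro smooth_add smooth_mult smooth_diff smooth_cutoff smooth_comp[OF sq smooth_vec_nth] smooth_comp[OF sg smooth_vec_nth])
  have sgx: "smooth ?g" by (rule smooth_comp[OF sg smooth_vec_nth])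
  have dg: "((\<lambda>t. \<gamma> ((t - r) / \<epsilon>)) has_real_derivative deriv \<gamma> ((t - r) / \<epsilon>) * (1 / \<epsilon>)) (at t)" for t
    by (rule DERIV_chain2[OF smooth_DERIV[OF \<gamma>(1)]]) (use \<epsilon> in \<open>auto intro!: derivative_eq_intros\<close>)
  have gg: "grad ?g x = (deriv \<gamma> ((x $ k - r) / \<epsilon>) * (1 / \<epsilon>)) *\<^sub>R axis k 1" for x
    by (rule grad_coordinate[OF dg])
  let ?dens = "\<lambda>x. \<epsilon> / 2 * (norm (grad u x))\<^sup>2 + 1 / \<epsilon> * ?\<theta>s (x /\<^sub>R \<delta>) * W (u x)"
  let ?in = "\<lambda>x::real^'n. 1 / \<epsilon> * ?e ((x $ k - r) / \<epsilon>) + 1 / \<epsilon> * \<theta> (x /\<^sub>R \<delta>) * ?P ((x $ k - r) / \<epsilon>)"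
  let ?strip = "{t. \<bar>t\<bar> > \<rho> / 2 - 2 * (s * \<epsilon>)}"
  have inner: "?dens x = ?in x" if "\<And>i. \<bar>x $ i\<bar> \<le> \<rho> / 2 - 2 * (s * \<epsilon>)" for x
  proof -
    have se: "s * \<epsilon> > 0" using s \<epsilon> by simp
    have c1: "cutoff \<rho> (s * \<epsilon>) x = 1" and c0: "grad (cutoff \<rho> (s * \<epsilon>)) x = 0"
      using cutoff_eq_1[OF se] grad_cutoff_zero[OF se] that by blast+
    let ?h = "\<lambda>x::real^'n. q (x $ k / \<epsilon>)"
    have sh: "smooth ?h" by (rule smooth_comp[OF sq smooth_vec_nth])
    have sd: "smooth (\<lambda>x. ?g x - ?h x)" by (intro smooth_diff sgx sh)
    have ux: "u x = ?g x" by (simp add: u c1)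
    have "grad u x = grad ?h x + ((?g x - ?h x) *\<^sub>R grad (cutoff \<rho> (s * \<epsilon>)) x + cutoff \<rho> (s * \<epsilon>) x *\<^sub>R grad (\<lambda>x. ?g x - ?h x) x)"
      unfolding u
      by (subst grad_add, (intro smooth_differentiable sh smooth_mult sd smooth_cutoff)+,
          subst grad_mult, (intro smooth_differentiable sd smooth_cutoff)+) simp
    also have "grad (\<lambda>x. ?g x - ?h x) x = grad ?g x - grad ?h x"
      by (intro grad_diff smooth_differentiable sgx sh)
    finally have gu: "grad u x = grad ?g x" by (simp add: c0 c1)
    have "\<epsilon> / 2 * (norm (grad u x))\<^sup>2 = 1 / \<epsilon> * ?e ((x $ k - r) / \<epsilon>)"
      using \<epsilon> by (simp add: gu gg power_mult_distrib power_divide) (simp add: power2_eq_square)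
    \<comment> \<open>Inside the window the pattern is 1; outside it the profile sits at a zero of
      W, so that both sides vanish.\<close>
    moreover have "1 / \<epsilon> * ?\<theta>s (x /\<^sub>R \<delta>) * W (u x) = 1 / \<epsilon> * \<theta> (x /\<^sub>R \<delta>) * ?P ((x $ k - r) / \<epsilon>)"
    proof (cases "x $ k \<in> {r..r + M * \<epsilon>}")
      case True
      then have "S (x $ k / \<delta>) = 1" by (rule S(3))
      then show ?thesis by (simp add: ux divide_inverse_commute)
    next
      case False
      then consider "x $ k - r < 0" | "x $ k - r > M * \<epsilon>" by fastforce
      then have "\<gamma> ((x $ k - r) / \<epsilon>) = -1 \<or> \<gamma> ((x $ k - r) / \<epsilon>) = 1"
      proof cases
        case 1
        then show ?thesis using \<gamma>(4) \<epsilon> by (simp add: divide_nonpos_pos)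
      next
        case 2
        then show ?thesis using \<gamma>(5)[of "(x $ k - r) / \<epsilon>"] \<epsilon> by (simp add: pos_le_divide_eq)
      qed
      then show ?thesis using W(4,5) by (auto simp: ux)
    qed
    ultimately show ?thesis by simp
  qed
  have layer: "ennreal (?dens x) \<le> F (x $ k)" for x
  proof -
    let ?d = "\<gamma> ((x $ k - r) / \<epsilon>) - q (x $ k / \<epsilon>)"
    \<comment> \<open>Near \<open>x $ k = 0\<close> the mismatch is bounded only by 2, elsewhere by
      \<kappa>.\<close>
    have D: "?d\<^sup>2 \<le> \<kappa>\<^sup>2 + 4 * indicator {-\<kappa><..<\<kappa>} (x $ k)"
    proof (cases "x $ k \<in> {-\<kappa><..<\<kappa>}")
      case True
      have "\<bar>?d\<bar> \<le> 2" using \<gamma>(2)[of "(x $ k - r) / \<epsilon>"] q(2)[of "x $ k / \<epsilon>"] by auto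
      then have "\<bar>?d\<bar>\<^sup>2 \<le> 2\<^sup>2" by (intro power_mono) auto
      then have "?d\<^sup>2 \<le> 4" by simp
      then show ?thesis using True by (simp add: add_increasing)
    next
      case False
      then have "\<bar>x $ k\<bar> \<ge> \<kappa>" by auto
      from power_mono[OF near[OF this], of 2] show ?thesis using False by simp
    qed
    have "?dens x \<le> (3 * C\<^sup>2 + 2 * \<Theta> * K) / \<epsilon> + 3 / 2 * Cc\<^sup>2 / s\<^sup>2 * (\<kappa>\<^sup>2 + 4 * indicator {-\<kappa><..<\<kappa>} (x $ k)) / \<epsilon>"
    proof (rule layer_energy_density[OF \<gamma>(1-3) q W(2,3) cut \<epsilon> s _ _ u D])
      show "0 \<le> ?\<theta>s (x /\<^sub>R \<delta>)" using S0 pos by (intro mult_nonneg_nonneg) (auto simp: less_imp_le)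
      show "?\<theta>s (x /\<^sub>R \<delta>) \<le> 2 * \<Theta>" using S0 pos bound by (intro mult_mono) (auto simp: less_imp_le)
    qed
    also have "\<dots> = A + B * indicator {-\<kappa><..<\<kappa>} (x $ k)"
      by (simp add: A_def B_def distrib_left add_divide_distrib)
    finally show ?thesis unfolding F_def by (rule ennreal_leI)
  qed
  have point: "ennreal (?dens x) * indicator (cube \<rho>) x \<le> ennreal (?in x) * indicator (cube \<rho>) x
      + (\<Sum>i\<in>UNIV. F (x $ k) * indicator ?strip (x $ i) * indicator (cube \<rho>) x)" for x
  proof (cases "\<forall>i. \<bar>x $ i\<bar> \<le> \<rho> / 2 - 2 * (s * \<epsilon>)")
    case True
    then show ?thesis by (subst inner) (auto intro: add_increasing2)
  next
    case False
    then obtain i where "x $ i \<in> ?strip" by (auto simp: not_le)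
    then have "ennreal (?dens x) * indicator (cube \<rho>) x \<le> F (x $ k) * indicator ?strip (x $ i) * indicator (cube \<rho>) x"
      using layer[of x] by (simp add: mult_right_mono)
    also have "\<dots> \<le> (\<Sum>i\<in>UNIV. F (x $ k) * indicator ?strip (x $ i) * indicator (cube \<rho>) x)"
      by (rule member_le_sum) auto
    finally show ?thesis by (simp add: add_increasing)
  qed
  have cP: "continuous_on UNIV ?P"
    using continuous_on_compose2[OF W(1) smooth_continuous_on[OF \<gamma>(1)]] by auto
  have ce: "continuous_on UNIV ?e"
    by (intro continuous_intros smooth_continuous_on smooth_deriv \<gamma>(1)) simp
  have dout: "deriv \<gamma> t = 0" if "t < 0 \<or> t > M" for t
  proof -
    have "(\<gamma> has_real_derivative 0) (at t)"
      using that
    proof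
      assume "t < 0"
      then show ?thesis
        by (intro has_field_derivative_transform_within_open[OF DERIV_const[of "-1"], where S = "{..<0}"]) (use \<gamma>(4) in auto)
    next
      assume "t > M"
      then show ?thesis
        by (intro has_field_derivative_transform_within_open[OF DERIV_const[of "1"], where S = "{M<..}"]) (use \<gamma>(5) in auto)
    qed
    then show ?thesis by (rule DERIV_imp_deriv)
  qed
  have [measurable]: "(\<lambda>t. ?e ((t - r) / \<epsilon>)) \<in> borel_measurable borel" "(\<lambda>t. ?P ((t - r) / \<epsilon>)) \<in> borel_measurable borel"
    "?e \<in> borel_measurable borel" "?P \<in> borel_measurable borel" "deriv \<gamma> \<in> borel_measurable borel"
    using cP ce smooth_continuous_on[OF smooth_deriv[OF \<gamma>(1)]] \<epsilon>
    by (auto intro!: borel_measurable_continuous_onI continuous_on_compose2[OF cP] continuous_on_compose2[OF ce] continuous_intros)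
  define X where "X = \<rho> ^ (CARD('n) - 1) * integral {0..M} (\<lambda>t. (deriv \<gamma> t)\<^sup>2 / 2 + W (\<gamma> t))
      + \<Theta> * (K * shell_const TYPE('n) \<rho> * (\<delta> / \<epsilon>) + \<omega> * \<rho> ^ (CARD('n) - 1) * (M + \<delta> / \<epsilon>))"
  define Y where "Y = 2 * (2 * (s * \<epsilon>)) * (A * \<rho> ^ (CARD('n) - 1) + 2 * \<kappa> * B * \<rho> ^ (CARD('n) - 2))"
  have "energy \<epsilon> \<delta> ?\<theta>s W (cube \<rho>) u (grad u) = (\<integral>\<^sup>+x. ennreal (?dens x) * indicator (cube \<rho>) x \<partial>lborel)"
    by (rule energy_cube_eq[OF _ su W(1)]) measurable
  also have "\<dots> \<le> (\<integral>\<^sup>+x. ennreal (?in x) * indicator (cube \<rho>) x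
      + (\<Sum>i\<in>UNIV. F (x $ k) * indicator ?strip (x $ i) * indicator (cube \<rho>) x) \<partial>lborel)"
    by (rule nn_integral_mono[OF point])
  also have "\<dots> = (\<integral>\<^sup>+x. ennreal (?in x) * indicator (cube \<rho>) x \<partial>lborel)
      + (\<Sum>i\<in>UNIV. \<integral>\<^sup>+x. F (x $ k) * indicator ?strip (x $ i) * indicator (cube \<rho>) x \<partial>lborel)"
  proof -
    have [measurable]: "(\<lambda>x. F (x $ k) * indicator ?strip (x $ i) * indicator (cube \<rho>) x) \<in> borel_measurable borel" for i
      by measurable
    show ?thesis
      by (subst nn_integral_sum[symmetric], measurable) (rule nn_integral_add, measurable)
  qed
  also have "\<dots> \<le> ennreal X + (\<Sum>i\<in>(UNIV::'n set). ennreal Y)"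
  proof (intro add_mono sum_mono)
    show "(\<integral>\<^sup>+x. ennreal (?in x) * indicator (cube \<rho>) x \<partial>lborel) \<le> ennreal X"
      unfolding X_def
      by (rule interior_energy_bound[OF cP W(3) W(2)[OF \<gamma>(2)] _ ce _ _ \<omega> \<omega>0 \<epsilon> \<delta> M])
        (use \<gamma>(4,5) W(4,5) dout in auto)
    show "(\<integral>\<^sup>+x. F (x $ k) * indicator ?strip (x $ i) * indicator (cube \<rho>) x \<partial>lborel) \<le> ennreal Y" for i
      unfolding Y_def by (rule nn_integral_strip[OF F_def AB \<rho>]) (use s \<epsilon> \<kappa> in auto)
  qed
  also have "\<dots> = ennreal (X + real CARD('n) * Y)"
  proof -
    have "Y \<ge> 0" unfolding Y_def using AB \<rho> s \<epsilon> \<kappa> by (intro mult_nonneg_nonneg add_nonneg_nonneg) auto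
    moreover have "X \<ge> 0"
      unfolding X_def using \<rho> bound_pos K0 \<omega>0 \<delta> \<epsilon> M W(3) cP ce shell_const_nonneg[of \<rho>, where 'n = 'n]
      by (intro add_nonneg_nonneg mult_nonneg_nonneg Henstock_Kurzweil_Integration.integral_nonneg integrable_continuous_real continuous_on_add)
        (auto intro: continuous_on_subset)
    ultimately show ?thesis by (simp add: ennreal_of_nat_eq_real_of_nat ennreal_mult[symmetric] ennreal_plus[symmetric] del: ennreal_plus)
  qed
  also have "Y = 4 * ((3 * C\<^sup>2 + 2 * \<Theta> * K) * s + 3 / 2 * Cc\<^sup>2 * \<kappa>\<^sup>2 / s) * \<rho> ^ (CARD('n) - 1)
          + 48 * Cc\<^sup>2 * \<kappa> / s * \<rho> ^ (CARD('n) - 2)"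
  proof -
    have "s * \<epsilon> * A = (3 * C\<^sup>2 + 2 * \<Theta> * K) * s + 3 / 2 * Cc\<^sup>2 * \<kappa>\<^sup>2 / s"
      using s \<epsilon> by (simp add: A_def field_simps power2_eq_square)
    moreover have "s * \<epsilon> * B = 6 * Cc\<^sup>2 / s"
      using s \<epsilon> by (simp add: B_def field_simps power2_eq_square)
    moreover have "Y = 4 * (s * \<epsilon> * A) * \<rho> ^ (CARD('n) - 1) + 8 * \<kappa> * (s * \<epsilon> * B) * \<rho> ^ (CARD('n) - 2)"
      by (simp add: Y_def algebra_simps)
    ultimately show ?thesis by simp
  qed
  finally show ?thesis unfolding X_def .
qed


text \<open>Order of choice: s for the cost of interpolating in the layer, then \<kappa> depending
  on s for the cut-off terms, \<omega> for homogenization, and \<epsilon> last. The boundary data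
  may vary with \<epsilon> because in dimension one they are replaced by data that do.\<close>

lemma sigma_cell_upper:
  fixes W S \<delta> r :: "real \<Rightarrow> real" and q :: "real \<Rightarrow> real \<Rightarrow> real" and k :: 'n
  assumes cW: "continuous_on UNIV W" and W0: "\<And>s. W s \<ge> 0" and zero: "W (-1) = 0" "W 1 = 0"
    and q: "\<And>\<epsilon>. smooth (q \<epsilon>)" "\<And>\<epsilon> t. q \<epsilon> t \<in> {-1..1}" "\<And>\<epsilon> t. \<bar>deriv (q \<epsilon>) t\<bar> \<le> Cq"
    and qlim: "\<And>\<kappa>. \<kappa> > 0 \<Longrightarrow> \<forall>\<^sub>F \<epsilon> in at_right 0. \<forall>t\<ge>\<kappa>. \<bar>q \<epsilon> (t / \<epsilon>) - 1\<bar> \<le> \<kappa> \<and> \<bar>q \<epsilon> (- t / \<epsilon>) + 1\<bar> \<le> \<kappa>"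
    and \<delta>: "\<And>\<epsilon>. \<epsilon> > 0 \<Longrightarrow> \<delta> \<epsilon> > 0" "((\<lambda>\<epsilon>. \<delta> \<epsilon> / \<epsilon>) \<longlongrightarrow> 0) (at_right 0)"
    and S: "S \<in> borel_measurable borel" "\<And>t. S t \<in> {1, 2}"
    and r: "\<And>\<epsilon>. \<epsilon> > 0 \<Longrightarrow> r \<epsilon> \<ge> 0" "(r \<longlongrightarrow> 0) (at_right 0)"
    and window: "\<And>M. M > 0 \<Longrightarrow> \<forall>\<^sub>F \<epsilon> in at_right 0. \<forall>t\<in>{r \<epsilon>..r \<epsilon> + M * \<epsilon>}. S (t / \<delta> \<epsilon>) = 1"
    and \<rho>: "\<rho> > 0" and c: "sigma_W W < c"
  shows "\<forall>\<^sub>F \<epsilon> in at_right 0. sigma_cell W (q \<epsilon>) (\<lambda>y. S (y $ k) * \<theta> y) \<epsilon> (\<delta> \<epsilon>) (axis k 1) (cube \<rho>) \<le> ennreal (\<rho> ^ (CARD('n) - 1) * c)"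
proof -
  define D where "D = \<rho> ^ (CARD('n) - 1) * (c - sigma_W W)"
  have D: "D > 0" using c \<rho> by (simp add: D_def)
  obtain \<gamma> M where \<gamma>: "smooth \<gamma>" and M: "M > 0" and \<gamma>lo: "\<And>t. t \<le> 0 \<Longrightarrow> \<gamma> t = -1" and \<gamma>hi: "\<And>t. t \<ge> M \<Longrightarrow> \<gamma> t = 1"
    and \<gamma>r: "\<And>t. \<gamma> t \<in> {-1..1}" and I: "integral {0..M} (\<lambda>t. (deriv \<gamma> t)\<^sup>2 / 2 + W (\<gamma> t)) \<le> sigma_W W + (c - sigma_W W) / 4"
    using optimal_profile[OF cW W0, of "(c - sigma_W W) / 4"] c by auto
  obtain Cg where Cg: "\<And>t. \<bar>deriv \<gamma> t\<bar> \<le> Cg"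
  proof -
    obtain B where B: "\<forall>t\<in>{-1..M + 1}. \<bar>deriv \<gamma> t\<bar> \<le> B"
      using continuous_bounded_interval[OF smooth_continuous_on[OF smooth_deriv[OF \<gamma>]]] by blast
    have B0: "B \<ge> 0" using bspec[OF B, of 0] M by auto
    have "\<bar>deriv \<gamma> t\<bar> \<le> B" for t
    proof (cases "t \<in> {-1..M + 1}")
      case False
      have "(\<gamma> has_real_derivative 0) (at t)"
      proof (cases "t < 0")
        case True
        then show ?thesis
          by (intro has_field_derivative_transform_within_open[OF DERIV_const[of "-1"], where S = "{..<0}"]) (use \<gamma>lo in auto)
      next
        case f: False
        then show ?thesis
          by (intro has_field_derivative_transform_within_open[OF DERIV_const[of "1"], where S = "{M<..}"]) (use \<gamma>hi False in auto)
      qed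
      then have "deriv \<gamma> t = 0" by (rule DERIV_imp_deriv)
      then show ?thesis using B0 by simp
    qed (use B in auto)
    then show ?thesis using that by blast
  qed
  define C where "C = max Cg Cq"
  have dC: "\<bar>deriv \<gamma> t\<bar> \<le> C" "\<bar>deriv (q \<epsilon>) t\<bar> \<le> C" for t \<epsilon>
    using Cg[of t] q(3)[of \<epsilon> t] by (auto simp: C_def)
  obtain K where K': "\<forall>s\<in>{-1..1}. \<bar>W s\<bar> \<le> K"
    using continuous_bounded_interval[OF continuous_on_subset[OF cW subset_UNIV]] by blast
  have K: "W s \<le> K" if "s \<in> {-1..1}" for s using bspec[OF K' that] by linarith
  obtain Cc where Cc: "\<And>\<rho> \<tau> x. \<tau> > 0 \<Longrightarrow> norm (grad (cutoff \<rho> \<tau>) x :: real^'n) \<le> Cc / \<tau>"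
    by (rule grad_cutoff_bound) (rule that)
  let ?n = "real CARD('n)" and ?R = "\<rho> ^ (CARD('n) - 1)"
  have R: "?R > 0" using \<rho> by simp
  \<comment> \<open>The + 1 keeps the denominator positive even if the cost coefficient is
    0.\<close>
  define s where "s = D / (8 * (?n * (4 * \<bar>3 * C\<^sup>2 + 2 * \<Theta> * K\<bar> * ?R) + 1))"
  have den: "8 * (?n * (4 * \<bar>3 * C\<^sup>2 + 2 * \<Theta> * K\<bar> * ?R) + 1) > 0" using R by (intro mult_pos_pos add_nonneg_pos) auto
  have s: "s > 0" unfolding s_def using den D by simp
  have s1: "?n * (4 * ((3 * C\<^sup>2 + 2 * \<Theta> * K) * s) * ?R) \<le> D / 8"
  proof -
    have "?n * (4 * ((3 * C\<^sup>2 + 2 * \<Theta> * K) * s) * ?R) \<le> ?n * (4 * (\<bar>3 * C\<^sup>2 + 2 * \<Theta> * K\<bar> * s) * ?R)"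
      using s R by (intro mult_left_mono mult_right_mono) auto
    also have "\<dots> \<le> (?n * (4 * \<bar>3 * C\<^sup>2 + 2 * \<Theta> * K\<bar> * ?R) + 1) * s" using s by (simp add: algebra_simps)
    also have "\<dots> = D / 8" unfolding s_def using den by (simp add: field_simps)
    finally show ?thesis .
  qed
  have "((\<lambda>\<kappa>. ?n * (4 * (3 / 2 * Cc\<^sup>2 * \<kappa>\<^sup>2 / s) * ?R + 48 * Cc\<^sup>2 * \<kappa> / s * \<rho> ^ (CARD('n) - 2)))
      \<longlongrightarrow> ?n * (4 * (3 / 2 * Cc\<^sup>2 * 0\<^sup>2 / s) * ?R + 48 * Cc\<^sup>2 * 0 / s * \<rho> ^ (CARD('n) - 2))) (at_right 0)"
    using s by (intro tendsto_intros) auto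
  then have "\<forall>\<^sub>F \<kappa> in at_right 0. ?n * (4 * (3 / 2 * Cc\<^sup>2 * \<kappa>\<^sup>2 / s) * ?R + 48 * Cc\<^sup>2 * \<kappa> / s * \<rho> ^ (CARD('n) - 2)) < D / 8"
    by (rule order_tendstoD) (use D in simp)
  moreover have "\<forall>\<^sub>F \<kappa> in at_right 0. 0 < \<kappa> \<and> \<kappa> < \<rho> / 4"
    using \<rho> by (intro eventually_at_rightI[of 0 "\<rho> / 4"]) auto
  ultimately have "\<forall>\<^sub>F \<kappa> in at_right 0. (0 < \<kappa> \<and> \<kappa> < \<rho> / 4) \<and>
      ?n * (4 * (3 / 2 * Cc\<^sup>2 * \<kappa>\<^sup>2 / s) * ?R + 48 * Cc\<^sup>2 * \<kappa> / s * \<rho> ^ (CARD('n) - 2)) < D / 8"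
    by eventually_elim auto
  then obtain \<kappa> where \<kappa>: "0 < \<kappa>" "\<kappa> < \<rho> / 4"
    "?n * (4 * (3 / 2 * Cc\<^sup>2 * \<kappa>\<^sup>2 / s) * ?R + 48 * Cc\<^sup>2 * \<kappa> / s * \<rho> ^ (CARD('n) - 2)) < D / 8"
    using eventually_happens'[OF trivial_limit_at_right_real] by blast
  define \<omega> where "\<omega> = D / (8 * (\<Theta> * ?R * (M + 1)))"
  have \<omega>: "\<omega> > 0" using D bound_pos R M by (simp add: \<omega>_def)
  have \<omega>1: "\<Theta> * (\<omega> * ?R * (M + 1)) = D / 8"
  proof -
    have pos: "\<Theta> * ?R * (M + 1) > 0" using bound_pos R M by (intro mult_pos_pos) auto
    have "\<Theta> * (\<omega> * ?R * (M + 1)) = \<omega> * (\<Theta> * ?R * (M + 1))" by (simp only: mult_ac)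
    also have "D / (8 * X) * X = D / 8" if "X > 0" for X using that by simp
    from this[OF pos] have "\<omega> * (\<Theta> * ?R * (M + 1)) = D / 8" unfolding \<omega>_def .
    finally show ?thesis .
  qed
  obtain d where d: "d > 0" "\<And>a b. \<bar>a - b\<bar> < d \<Longrightarrow> \<bar>W (\<gamma> a) - W (\<gamma> b)\<bar> \<le> \<omega>"
  proof -
    have "continuous_on {-1..M + 1} (\<lambda>t. W (\<gamma> t))"
      by (intro continuous_on_compose2[OF cW] smooth_continuous_on \<gamma>) auto
    then have "uniformly_continuous_on {-1..M + 1} (\<lambda>t. W (\<gamma> t))"
      by (intro compact_uniformly_continuous) auto
    then obtain d0 where d0: "d0 > 0" "\<forall>a\<in>{-1..M + 1}. \<forall>b\<in>{-1..M + 1}. dist b a < d0 \<longrightarrow> dist (W (\<gamma> b)) (W (\<gamma> a)) < \<omega>"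
      using \<omega> unfolding uniformly_continuous_on_def by blast
    \<comment> \<open>If one of the points is in [0, M], both lie in the compact interval; otherwise
      both profile values are zeros of W.\<close>
    have "\<bar>W (\<gamma> a) - W (\<gamma> b)\<bar> \<le> \<omega>" if ab: "\<bar>a - b\<bar> < min d0 1" for a b
    proof (cases "a \<in> {0..M} \<or> b \<in> {0..M}")
      case True
      then have "a \<in> {-1..M + 1}" "b \<in> {-1..M + 1}" using ab by auto
      then have "dist (W (\<gamma> a)) (W (\<gamma> b)) < \<omega>" using d0(2) ab by (simp add: dist_real_def)
      then show ?thesis by (simp add: dist_real_def)
    next
      case False
      then have "(\<gamma> a = -1 \<or> \<gamma> a = 1) \<and> (\<gamma> b = -1 \<or> \<gamma> b = 1)"
        using \<gamma>lo[of a] \<gamma>hi[of a] \<gamma>lo[of b] \<gamma>hi[of b] by force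
      then show ?thesis using zero \<omega> by auto
    qed
    then show ?thesis using that[of "min d0 1"] d0(1) by simp
  qed
  have \<delta>0: "(\<delta> \<longlongrightarrow> 0) (at_right 0)"
    by (rule tendsto_times_ident[OF \<delta>(2)]) simp
  have e1: "\<forall>\<^sub>F \<epsilon> in at_right 0. \<delta> \<epsilon> / \<epsilon> < min d 1"
    by (rule order_tendstoD(2)[OF \<delta>(2)]) (use d in simp)
  have e2: "\<forall>\<^sub>F \<epsilon> in at_right 0. \<Theta> * (K * shell_const TYPE('n) \<rho> * (\<delta> \<epsilon> / \<epsilon>)) < D / 8"
  proof (rule order_tendstoD(2))
    show "((\<lambda>\<epsilon>. \<Theta> * (K * shell_const TYPE('n) \<rho> * (\<delta> \<epsilon> / \<epsilon>))) \<longlongrightarrow> \<Theta> * (K * shell_const TYPE('n) \<rho> * 0)) (at_right 0)"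
      by (intro tendsto_intros \<delta>)
  qed (use D in simp)
  have e3: "\<forall>\<^sub>F \<epsilon> in at_right 0. \<delta> \<epsilon> < \<rho> / 2"
    by (rule order_tendstoD(2)[OF \<delta>0]) (use \<rho> in simp)
  have e4: "\<forall>\<^sub>F \<epsilon> in at_right 0. 2 * (s * \<epsilon>) < \<rho> / 4"
  proof (rule order_tendstoD(2))
    show "((\<lambda>\<epsilon>. 2 * (s * \<epsilon>)) \<longlongrightarrow> 2 * (s * 0)) (at_right 0)" by (intro tendsto_intros)
  qed (use \<rho> in simp)
  have e5: "\<forall>\<^sub>F \<epsilon> in at_right 0. r \<epsilon> + M * \<epsilon> < \<kappa>"
  proof (rule order_tendstoD(2))
    show "((\<lambda>\<epsilon>. r \<epsilon> + M * \<epsilon>) \<longlongrightarrow> 0 + M * 0) (at_right 0)" by (intro tendsto_intros r)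
  qed (use \<kappa> in simp)
  show ?thesis
    using e1 e2 e3 e4 e5 window[OF M] qlim[OF \<kappa>(1)] eventually_at_right_less[of 0]
  proof eventually_elim
    case (elim \<epsilon>)
    have \<epsilon>: "\<epsilon> > 0" and \<delta>e: "\<delta> \<epsilon> > 0" "2 * \<delta> \<epsilon> \<le> \<rho>" using elim \<delta>(1) by auto
    let ?h = "\<lambda>x::real^'n. q \<epsilon> ((x \<bullet> axis k 1) / \<epsilon>)"
    let ?\<phi> = "\<lambda>x::real^'n. (\<gamma> ((x $ k - r \<epsilon>) / \<epsilon>) - q \<epsilon> (x $ k / \<epsilon>)) * cutoff \<rho> (s * \<epsilon>) x"
    let ?u = "\<lambda>x::real^'n. q \<epsilon> (x $ k / \<epsilon>) + ?\<phi> x"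
    have h: "?h = (\<lambda>x. q \<epsilon> (x $ k / \<epsilon>))" by (simp add: inner_axis)
    have sq: "smooth (\<lambda>t. q \<epsilon> (t / \<epsilon>))" by (rule smooth_scaled(2)[OF q(1)])
    have sg: "smooth (\<lambda>t. \<gamma> ((t - r \<epsilon>) / \<epsilon>))" by (rule smooth_scaled(1)[OF \<gamma>])
    have sh: "smooth ?h" unfolding h by (rule smooth_comp[OF sq smooth_vec_nth])
    have t: "test_function (interior (cube \<rho>)) ?\<phi>"
      by (intro test_function_mult test_function_cutoff smooth_diff smooth_comp[OF sq smooth_vec_nth] smooth_comp[OF sg smooth_vec_nth])
        (use s \<epsilon> in simp)
    \<comment> \<open>To the right of \<kappa> the transition is complete, as
      \<open>r \<epsilon> + M * \<epsilon> < \<kappa>\<close>; to the left of 0 it has not begun, as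
      \<open>r \<epsilon> \<ge> 0\<close>.\<close>
    have near: "\<bar>\<gamma> ((t - r \<epsilon>) / \<epsilon>) - q \<epsilon> (t / \<epsilon>)\<bar> \<le> \<kappa>" if "\<bar>t\<bar> \<ge> \<kappa>" for t
    proof (cases "t \<ge> 0")
      case True
      then have "t \<ge> \<kappa>" using that by simp
      moreover from this have "(t - r \<epsilon>) / \<epsilon> \<ge> M" unfolding pos_le_divide_eq[OF \<epsilon>] using elim(5) by linarith
      ultimately show ?thesis using elim(7) \<gamma>hi by (simp add: abs_minus_commute)
    next
      case False
      then have "- t \<ge> \<kappa>" using that by simp
      moreover have "(t - r \<epsilon>) / \<epsilon> \<le> 0" using False r(1)[OF \<epsilon>] \<epsilon> by (simp add: divide_nonpos_pos)
      ultimately have "\<bar>q \<epsilon> (- (- t) / \<epsilon>) + 1\<bar> \<le> \<kappa>" "\<gamma> ((t - r \<epsilon>) / \<epsilon>) = -1" using elim(7) \<gamma>lo by blast+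
      then show ?thesis by (simp add: abs_minus_commute abs_le_iff)
    qed
    have "sigma_cell W (q \<epsilon>) (\<lambda>y. S (y $ k) * \<theta> y) \<epsilon> (\<delta> \<epsilon>) (axis k 1) (cube \<rho>) \<le>
        energy \<epsilon> (\<delta> \<epsilon>) (\<lambda>y. S (y $ k) * \<theta> y) W (cube \<rho>) ?u (grad ?u)"
      using sigma_cell_le_energy[OF refl sh t, of W "\<lambda>y. S (y $ k) * \<theta> y" "\<delta> \<epsilon>"] by (simp add: inner_axis)
    also have "\<dots> \<le> ennreal (?R * integral {0..M} (\<lambda>t. (deriv \<gamma> t)\<^sup>2 / 2 + W (\<gamma> t))
      + \<Theta> * (K * shell_const TYPE('n) \<rho> * (\<delta> \<epsilon> / \<epsilon>) + \<omega> * ?R * (M + \<delta> \<epsilon> / \<epsilon>))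
      + ?n * (4 * ((3 * C\<^sup>2 + 2 * \<Theta> * K) * s + 3 / 2 * Cc\<^sup>2 * \<kappa>\<^sup>2 / s) * ?R
          + 48 * Cc\<^sup>2 * \<kappa> / s * \<rho> ^ (CARD('n) - 2)))"
    proof (rule energy_upper_bound[OF \<gamma> \<gamma>r dC(1) \<gamma>lo \<gamma>hi q(1,2) dC(2) cW K W0 zero(2,1) _ \<epsilon> s \<delta>e M S _ refl \<kappa>(1) _ near])
      show "norm (grad (cutoff \<rho> (s * \<epsilon>)) x :: real^'n) \<le> Cc / (s * \<epsilon>)" for x
        using s \<epsilon> by (intro Cc) simp
      show "S (t / \<delta> \<epsilon>) = 1" if "t \<in> {r \<epsilon>..r \<epsilon> + M * \<epsilon>}" for t using elim(6) that by blast
      show "\<kappa> + 2 * (s * \<epsilon>) \<le> \<rho> / 2" using \<kappa>(2) elim(4) by linarith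
      show "\<bar>W (\<gamma> a) - W (\<gamma> b)\<bar> \<le> \<omega>" if "\<bar>a - b\<bar> \<le> \<delta> \<epsilon> / \<epsilon>" for a b
        using that elim(1) by (intro d(2)) simp
    qed
    \<comment> \<open>Of the gap D the profile uses a quarter and four errors use an eighth
      each.\<close>
    also have "\<dots> \<le> ennreal (?R * c)"
    proof (rule ennreal_leI)
      have "?R * integral {0..M} (\<lambda>t. (deriv \<gamma> t)\<^sup>2 / 2 + W (\<gamma> t)) \<le> ?R * (sigma_W W + (c - sigma_W W) / 4)"
        using R by (intro mult_left_mono I) simp
      also have "\<dots> = ?R * c - 3 / 4 * D" by (simp add: D_def field_simps)
      finally have 1: "?R * integral {0..M} (\<lambda>t. (deriv \<gamma> t)\<^sup>2 / 2 + W (\<gamma> t)) \<le> ?R * c - 3 / 4 * D" .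
      have "\<Theta> * (\<omega> * ?R * (M + \<delta> \<epsilon> / \<epsilon>)) \<le> \<Theta> * (\<omega> * ?R * (M + 1))"
        using bound_pos \<omega> R elim(1) by (intro mult_left_mono add_left_mono) auto
      then have 2: "\<Theta> * (K * shell_const TYPE('n) \<rho> * (\<delta> \<epsilon> / \<epsilon>) + \<omega> * ?R * (M + \<delta> \<epsilon> / \<epsilon>)) \<le> D / 8 + D / 8"
        using elim(2) unfolding distrib_left[of \<Theta>] \<omega>1 by linarith
      have "?n * (4 * ((3 * C\<^sup>2 + 2 * \<Theta> * K) * s + 3 / 2 * Cc\<^sup>2 * \<kappa>\<^sup>2 / s) * ?R + 48 * Cc\<^sup>2 * \<kappa> / s * \<rho> ^ (CARD('n) - 2)) =
        ?n * (4 * ((3 * C\<^sup>2 + 2 * \<Theta> * K) * s) * ?R) + ?n * (4 * (3 / 2 * Cc\<^sup>2 * \<kappa>\<^sup>2 / s) * ?R + 48 * Cc\<^sup>2 * \<kappa> / s * \<rho> ^ (CARD('n) - 2))"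
        by (simp add: algebra_simps)
      also have "\<dots> \<le> D / 8 + D / 8" by (intro add_mono s1 less_imp_le[OF \<kappa>(3)])
      finally show "?R * integral {0..M} (\<lambda>t. (deriv \<gamma> t)\<^sup>2 / 2 + W (\<gamma> t))
        + \<Theta> * (K * shell_const TYPE('n) \<rho> * (\<delta> \<epsilon> / \<epsilon>) + \<omega> * ?R * (M + \<delta> \<epsilon> / \<epsilon>))
        + ?n * (4 * ((3 * C\<^sup>2 + 2 * \<Theta> * K) * s + 3 / 2 * Cc\<^sup>2 * \<kappa>\<^sup>2 / s) * ?R
          + 48 * Cc\<^sup>2 * \<kappa> / s * \<rho> ^ (CARD('n) - 2)) \<le> ?R * c"
        using 1 2 D by linarith
    qed
    finally show ?case .
  qed
qed

end

subsection \<open>Boundary values in dimension one\<close>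

lemma H1_add:
  assumes "H1 (cube \<rho>) u Du" "H1 (cube \<rho>) v Dv"
  shows "H1 (cube \<rho>) (\<lambda>x. u x + v x) (\<lambda>x. Du x + Dv x :: real^'n)"
proof -
  have "H1 (cube \<rho>) (\<lambda>x. 0 - v x) (\<lambda>x. 0 - Dv x)"
  proof (rule H1_diff[OF _ assms(2)])
    have "grad (\<lambda>x::real^'n. 0) = (\<lambda>x. 0)" by (simp add: grad_def fun_eq_iff vec_eq_iff)
    then show "H1 (cube \<rho>) (\<lambda>x. 0) (\<lambda>x. 0 :: real^'n)" using H1_smooth[OF smooth_const[of 0]] by metis
  qed
  from H1_diff[OF assms(1) this] show ?thesis by simp
qed

lemma norm_add_square_le:
  fixes a b :: "'a::real_normed_vector"
  shows "(norm (a + b))\<^sup>2 \<le> 2 * (norm a)\<^sup>2 + 2 * (norm b)\<^sup>2"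
proof -
  have "(norm (a + b))\<^sup>2 \<le> (norm a + norm b)\<^sup>2" by (intro power_mono norm_triangle_ineq) simp
  also have "\<dots> \<le> 2 * (norm a)\<^sup>2 + 2 * (norm b)\<^sup>2"
    using sum_squares_bound[of "norm a" "norm b"] by (simp add: power2_sum)
  finally show ?thesis .
qed

lemma L2_tendsto_add:
  fixes f g :: "nat \<Rightarrow> real^'n \<Rightarrow> 'b::euclidean_space"
  assumes "\<And>m. L2_on U (f m)" "\<And>m. L2_on U (g m)"
    and "(\<lambda>m. LINT x|lebesgue_on U. (norm (f m x))\<^sup>2) \<longlonglongrightarrow> 0" "(\<lambda>m. LINT x|lebesgue_on U. (norm (g m x))\<^sup>2) \<longlonglongrightarrow> 0"
  shows "(\<lambda>m. LINT x|lebesgue_on U. (norm (f m x + g m x))\<^sup>2) \<longlonglongrightarrow> 0"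
proof (rule tendsto_sandwich[OF always_eventually always_eventually tendsto_const])
  show "(\<lambda>m. 2 * (LINT x|lebesgue_on U. (norm (f m x))\<^sup>2) + 2 * (LINT x|lebesgue_on U. (norm (g m x))\<^sup>2)) \<longlonglongrightarrow> 0"
    using tendsto_add[OF tendsto_mult[OF tendsto_const[of 2] assms(3)] tendsto_mult[OF tendsto_const[of 2] assms(4)]] by simp
  show "\<forall>m. (LINT x|lebesgue_on U. (norm (f m x + g m x))\<^sup>2) \<le>
      2 * (LINT x|lebesgue_on U. (norm (f m x))\<^sup>2) + 2 * (LINT x|lebesgue_on U. (norm (g m x))\<^sup>2)"
  proof
    fix m
    have i: "integrable (lebesgue_on U) (\<lambda>x. (norm (f m x))\<^sup>2)" "integrable (lebesgue_on U) (\<lambda>x. (norm (g m x))\<^sup>2)"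
      "integrable (lebesgue_on U) (\<lambda>x. (norm (f m x + g m x))\<^sup>2)"
      using assms(1,2) L2_on_add_scale[OF assms(1)[of m] assms(2)[of m], of 1] by (simp_all add: L2_on_def)
    have "(LINT x|lebesgue_on U. (norm (f m x + g m x))\<^sup>2) \<le> (LINT x|lebesgue_on U. 2 * (norm (f m x))\<^sup>2 + 2 * (norm (g m x))\<^sup>2)"
      by (intro integral_mono i Bochner_Integration.integrable_add integrable_mult_right norm_add_square_le)
    then show "(LINT x|lebesgue_on U. (norm (f m x + g m x))\<^sup>2) \<le>
      2 * (LINT x|lebesgue_on U. (norm (f m x))\<^sup>2) + 2 * (LINT x|lebesgue_on U. (norm (g m x))\<^sup>2)"
      using i by simp
  qed
qed auto

lemma H1_0_add:
  assumes u: "H1_0 (cube \<rho>) u Du" and v: "H1_0 (cube \<rho>) v Dv"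
  shows "H1_0 (cube \<rho>) (\<lambda>x. u x + v x) (\<lambda>x. Du x + Dv x :: real^'n)"
proof -
  let ?M = "lebesgue_on (cube \<rho>) :: (real^'n) measure"
  obtain \<phi> \<psi> where t: "\<And>m. test_function (interior (cube \<rho>)) (\<phi> m)" "\<And>m. test_function (interior (cube \<rho>)) (\<psi> m)"
    and l: "(\<lambda>m. LINT x|?M. (u x - \<phi> m x)\<^sup>2) \<longlonglongrightarrow> 0" "(\<lambda>m. LINT x|?M. (norm (Du x - grad (\<phi> m) x))\<^sup>2) \<longlonglongrightarrow> 0"
      "(\<lambda>m. LINT x|?M. (v x - \<psi> m x)\<^sup>2) \<longlonglongrightarrow> 0" "(\<lambda>m. LINT x|?M. (norm (Dv x - grad (\<psi> m) x))\<^sup>2) \<longlonglongrightarrow> 0"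
    using u v unfolding H1_0_def by auto
  have s: "smooth (\<phi> m)" "smooth (\<psi> m)" for m using t test_function_smooth by blast+
  have L2: "L2_on (cube \<rho>) u" "L2_on (cube \<rho>) v" "L2_on (cube \<rho>) Du" "L2_on (cube \<rho>) Dv"
    using u v by (simp_all add: H1_0_def H1_def)
  have L2d: "L2_on (cube \<rho>) (\<lambda>x. u x - \<phi> m x)" "L2_on (cube \<rho>) (\<lambda>x. v x - \<psi> m x)"
    "L2_on (cube \<rho>) (\<lambda>x. Du x - grad (\<phi> m) x)" "L2_on (cube \<rho>) (\<lambda>x. Dv x - grad (\<psi> m) x)" for m
    by (intro L2_on_diff L2 L2_on_continuous smooth_continuous_on continuous_on_grad s)+
  have g: "grad (\<lambda>x. \<phi> m x + \<psi> m x) x = grad (\<phi> m) x + grad (\<psi> m) x" for m x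
    by (intro grad_add smooth_differentiable s)
  show ?thesis
    unfolding H1_0_def
  proof (intro conjI exI[of _ "\<lambda>m x. \<phi> m x + \<psi> m x"] allI)
    show "H1 (cube \<rho>) (\<lambda>x. u x + v x) (\<lambda>x. Du x + Dv x)"
      using u v by (intro H1_add) (auto simp: H1_0_def)
    show "test_function (interior (cube \<rho>)) (\<lambda>x. \<phi> m x + \<psi> m x)" for m by (intro test_function_add t)
    show "(\<lambda>m. LINT x|?M. (u x + v x - (\<phi> m x + \<psi> m x))\<^sup>2) \<longlonglongrightarrow> 0"
      using L2_tendsto_add[OF L2d(1,2)] l(1,3) by (simp add: algebra_simps)
    show "(\<lambda>m. LINT x|?M. (norm (Du x + Dv x - grad (\<lambda>x. \<phi> m x + \<psi> m x) x))\<^sup>2) \<longlonglongrightarrow> 0"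
      using L2_tendsto_add[OF L2d(3,4) l(2,4)] by (simp add: g algebra_simps)
  qed
qed

text \<open>How soon the functions vanish at a point depends on its distance to the boundary; the
  uniform bound makes up for this by dominated convergence.\<close>

lemma L2_tendsto_bounded_convergence:
  fixes f :: "nat \<Rightarrow> real^'n \<Rightarrow> 'b::euclidean_space"
  assumes c: "\<And>m. continuous_on UNIV (f m)" and b: "\<And>m x. x \<in> cube \<rho> \<Longrightarrow> norm (f m x) \<le> B"
    and z: "\<And>x. x \<in> interior (cube \<rho>) \<Longrightarrow> \<forall>\<^sub>F m in sequentially. f m x = 0"
  shows "(\<lambda>m. LINT x|lebesgue_on (cube \<rho>). (norm (f m x))\<^sup>2) \<longlonglongrightarrow> 0"
proof -
  let ?M = "lebesgue_on (cube \<rho>) :: (real^'n) measure"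
  interpret M: finite_measure ?M by (rule finite_measure_cube)
  have meas: "(\<lambda>x. (norm (f m x))\<^sup>2) \<in> borel_measurable ?M" for m
    by (intro measurable_lebesgue_on_cube continuous_intros c)
  have "(\<lambda>m. LINT x|?M. (norm (f m x))\<^sup>2) \<longlonglongrightarrow> (LINT x|?M. 0)"
  proof (rule integral_dominated_convergence[where w = "\<lambda>x. B\<^sup>2"])
    show "AE x in ?M. (\<lambda>m. (norm (f m x))\<^sup>2) \<longlonglongrightarrow> 0"
      using AE_interior_cube
    proof eventually_elim
      case (elim x)
      show ?case by (rule tendsto_eventually[OF eventually_mono[OF z[OF elim]]]) simp
    qed
    show "AE x in ?M. norm ((norm (f m x))\<^sup>2) \<le> B\<^sup>2" for m
      using b by (intro AE_I2) (auto simp: space_restrict_space intro: power_mono)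
  qed (simp_all add: meas)
  then show ?thesis by simp
qed

text \<open>Since \<open>f\<close> vanishes linearly at the end points, the gradient of the cut-off only contributes a
  bounded amount, on a shrinking set.\<close>
lemma H1_0_vanishing:
  fixes f :: "real \<Rightarrow> real" and k :: "'n::finite"
  assumes f: "smooth f" and zero: "f (\<rho> / 2) = 0" "f (- \<rho> / 2) = 0" and one: "CARD('n) = 1" and \<rho>: "\<rho> > 0"
  shows "H1_0 (cube \<rho>) (\<lambda>x::real^'n. f (x $ k)) (grad (\<lambda>x. f (x $ k)))"
proof -
  let ?M = "lebesgue_on (cube \<rho>) :: (real^'n) measure"
  let ?u = "\<lambda>x::real^'n. f (x $ k)"
  \<comment> \<open>In dimension one every face is normal to k, so f vanishes on the whole
    boundary.\<close>
  have all_k: "i = k" for i :: 'n using one by (metis card_1_singletonE UNIV_I singletonD)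
  have su: "smooth ?u" by (rule smooth_comp[OF f smooth_vec_nth])
  obtain Cc where Cc: "\<And>\<rho> \<tau> x. \<tau> > 0 \<Longrightarrow> norm (grad (cutoff \<rho> \<tau>) x :: real^'n) \<le> Cc / \<tau>"
    by (rule grad_cutoff_bound) (rule that)
  have Cc0: "Cc \<ge> 0" using order_trans[OF norm_ge_zero Cc[of 1 1 0]] by simp
  obtain L where L: "\<forall>t\<in>{- \<rho> / 2..\<rho> / 2}. \<bar>deriv f t\<bar> \<le> L"
    using continuous_bounded_interval[OF smooth_continuous_on[OF smooth_deriv[OF f]]] by blast
  have L0: "L \<ge> 0" using L \<rho> by (auto dest: bspec[where x = 0])
  have lip: "\<bar>f a - f b\<bar> \<le> L * \<bar>a - b\<bar>" if "a \<in> {- \<rho> / 2..\<rho> / 2}" "b \<in> {- \<rho> / 2..\<rho> / 2}" for a b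
    using field_differentiable_bound[of "{- \<rho> / 2..\<rho> / 2}" f "deriv f" L a b] that L smooth_DERIV[OF f]
    by (auto simp: has_field_derivative_at_within)
  have van: "\<bar>f t\<bar> \<le> L * (\<rho> / 2 - \<bar>t\<bar>)" if "\<bar>t\<bar> \<le> \<rho> / 2" for t
    using lip[of t "\<rho> / 2"] lip[of t "- \<rho> / 2"] zero that by (cases "t \<ge> 0") (auto simp: abs_le_iff add.commute)
  have fb: "\<bar>f t\<bar> \<le> L * \<rho>" if "\<bar>t\<bar> \<le> \<rho> / 2" for t
  proof -
    have "\<rho> / 2 - \<bar>t\<bar> \<le> \<rho>" using \<rho> abs_ge_zero[of t] by linarith
    then have "L * (\<rho> / 2 - \<bar>t\<bar>) \<le> L * \<rho>" using L0 by (rule mult_left_mono)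
    then show ?thesis using van[OF that] by linarith
  qed
  let ?c = "\<lambda>m::nat. cutoff \<rho> (1 / real (Suc m)) :: real^'n \<Rightarrow> real"
  define \<phi> where "\<phi> m x = f (x $ k) * ?c m x" for m and x :: "real^'n"
  have t: "test_function (interior (cube \<rho>)) (\<phi> m)" for m
    unfolding \<phi>_def by (intro test_function_mult su test_function_cutoff) simp
  have s\<phi>: "smooth (\<phi> m)" for m using t by (rule test_function_smooth)
  have g\<phi>: "grad (\<phi> m) x = f (x $ k) *\<^sub>R grad (?c m) x + ?c m x *\<^sub>R grad ?u x" for m x
    unfolding \<phi>_def by (rule grad_mult) (intro smooth_differentiable su smooth_cutoff)+
  have ev: "\<forall>\<^sub>F m in sequentially. ?u x - \<phi> m x = 0 \<and> grad ?u x - grad (\<phi> m) x = 0"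
    if x: "x \<in> interior (cube \<rho>)" for x
  proof -
    have d: "(\<rho> / 2 - \<bar>x $ k\<bar>) / 2 > 0" using x by (simp add: mem_interior_cube)
    have "\<forall>\<^sub>F m in sequentially. 1 / real (Suc m) < (\<rho> / 2 - \<bar>x $ k\<bar>) / 2"
      by (rule order_tendstoD(2)[OF LIMSEQ_Suc[OF lim_1_over_n] d])
    then show ?thesis
    proof eventually_elim
      case (elim m)
      have le: "\<bar>x $ i\<bar> \<le> \<rho> / 2 - 2 * (1 / real (Suc m))" for i
        using elim all_k[of i] by (simp add: field_simps)
      have "?c m x = 1" "grad (?c m) x = 0"
        by (rule cutoff_eq_1 grad_cutoff_zero; use le in simp)+
      then show ?case by (simp add: \<phi>_def[of m x] g\<phi>)
    qed
  qed
  have "compact ((\<lambda>x. norm (grad ?u x)) ` cube \<rho>)"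
    by (intro compact_continuous_image continuous_on_norm continuous_on_grad su) (simp add: cube_def)
  then obtain G where G: "\<forall>x\<in>cube \<rho>. norm (grad ?u x) \<le> G"
    by (auto dest!: compact_imp_bounded simp: bounded_iff)
  show ?thesis
    unfolding H1_0_def
  proof (intro conjI exI[of _ \<phi>] allI t H1_smooth su)
    have "(\<lambda>m. LINT x|?M. (norm (?u x - \<phi> m x))\<^sup>2) \<longlonglongrightarrow> 0"
    proof (rule L2_tendsto_bounded_convergence[where B = "L * \<rho>"])
      show "continuous_on UNIV (\<lambda>x. ?u x - \<phi> m x)" for m
        by (intro continuous_on_diff smooth_continuous_on su s\<phi>)
      show "norm (?u x - \<phi> m x) \<le> L * \<rho>" if "x \<in> cube \<rho>" for m x
      proof -
        have c01: "0 \<le> ?c m x" "?c m x \<le> 1" by (rule cutoff_nonneg cutoff_le_1)+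
        have "\<bar>f (x $ k)\<bar> * \<bar>1 - ?c m x\<bar> \<le> L * \<rho> * 1"
          using fb that c01 L0 \<rho> by (intro mult_mono) (auto simp: mem_cube)
        moreover have "?u x - \<phi> m x = f (x $ k) * (1 - ?c m x)" by (simp add: \<phi>_def algebra_simps)
        ultimately show ?thesis by (simp add: abs_mult)
      qed
    qed (rule eventually_mono[OF ev], assumption, blast)
    then show "(\<lambda>m. LINT x|?M. (?u x - \<phi> m x)\<^sup>2) \<longlonglongrightarrow> 0" by simp
    show "(\<lambda>m. LINT x|?M. (norm (grad ?u x - grad (\<phi> m) x))\<^sup>2) \<longlonglongrightarrow> 0"
    proof (rule L2_tendsto_bounded_convergence[where B = "G + 2 * L * Cc"])
      show "continuous_on UNIV (\<lambda>x. grad ?u x - grad (\<phi> m) x)" for m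
        by (intro continuous_on_diff continuous_on_grad su s\<phi>)
      show "norm (grad ?u x - grad (\<phi> m) x) \<le> G + 2 * L * Cc" if x: "x \<in> cube \<rho>" for m x
      proof -
        let ?\<tau> = "1 / real (Suc m)"
        have c01: "0 \<le> ?c m x" "?c m x \<le> 1" by (rule cutoff_nonneg cutoff_le_1)+
        have "grad ?u x - grad (\<phi> m) x = (1 - ?c m x) *\<^sub>R grad ?u x - f (x $ k) *\<^sub>R grad (?c m) x"
          by (simp add: g\<phi> algebra_simps)
        then have "norm (grad ?u x - grad (\<phi> m) x) \<le> norm ((1 - ?c m x) *\<^sub>R grad ?u x) + norm (f (x $ k) *\<^sub>R grad (?c m) x)"
          by (simp only: norm_triangle_ineq4)
        also have "\<dots> \<le> G + 2 * L * Cc"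
        proof (rule add_mono)
          have "(1 - ?c m x) * norm (grad ?u x) \<le> 1 * G" using c01 G x by (intro mult_mono) auto
          then show "norm ((1 - ?c m x) *\<^sub>R grad ?u x) \<le> G" using c01 by simp
          \<comment> \<open>Where the cut-off of width \<tau> varies, f is at most
            \<open>2 * L * \<tau>\<close> in absolute value, while the gradient of the cut-off is at
            most \<open>Cc / \<tau>\<close>; the product stays bounded.\<close>
          show "norm (f (x $ k) *\<^sub>R grad (?c m) x) \<le> 2 * L * Cc"
          proof (cases "\<bar>x $ k\<bar> \<le> \<rho> / 2 - 2 * ?\<tau>")
            case True
            then have "\<bar>x $ i\<bar> \<le> \<rho> / 2 - 2 * ?\<tau>" for i using all_k[of i] by simp
            then have "grad (?c m) x = 0" by (intro grad_cutoff_zero) auto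
            then show ?thesis using L0 Cc0 by simp
          next
            case False
            have "\<bar>x $ k\<bar> \<le> \<rho> / 2" using x by (simp add: mem_cube)
            then have "\<bar>f (x $ k)\<bar> \<le> L * (\<rho> / 2 - \<bar>x $ k\<bar>)" by (rule van)
            also have "\<dots> \<le> L * (2 * ?\<tau>)" using False L0 by (intro mult_left_mono) auto
            finally have "\<bar>f (x $ k)\<bar> * norm (grad (?c m) x) \<le> L * (2 * ?\<tau>) * (Cc / ?\<tau>)"
              using L0 by (intro mult_mono Cc) auto
            also have "\<dots> = 2 * L * Cc" by simp
            finally show ?thesis by simp
          qed
        qed
        finally show ?thesis .
      qed
    qed (rule eventually_mono[OF ev], assumption, blast)
  qed
qed

text \<open>The two boundary data differ by a function of \<open>x $ k\<close> that vanishes at both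
  ends of the interval and hence belongs to \<open>H1_0\<close>. Thus every competitor for
  \<open>q'\<close> is one for \<open>q\<close>.\<close>

lemma sigma_cell_boundary_cong:
  fixes q q' :: "real \<Rightarrow> real" and k :: "'n::finite"
  assumes q: "smooth q" "smooth q'" and one: "CARD('n) = 1" and \<rho>: "\<rho> > 0"
    and eq: "q' (\<rho> / 2 / \<epsilon>) = q (\<rho> / 2 / \<epsilon>)" "q' (- \<rho> / 2 / \<epsilon>) = q (- \<rho> / 2 / \<epsilon>)"
  shows "sigma_cell W q \<theta> \<epsilon> \<delta> (axis k 1) (cube \<rho> :: (real^'n) set) \<le> sigma_cell W q' \<theta> \<epsilon> \<delta> (axis k 1) (cube \<rho>)"
  unfolding sigma_cell_def
proof (rule Inf_superset_mono, rule subsetI)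
  fix E assume "E \<in> {energy \<epsilon> \<delta> \<theta> W (cube \<rho>) u Du |u Du. H1 (cube \<rho>) u Du \<and> eq_on_boundary (cube \<rho>) u (\<lambda>x. q' (x \<bullet> axis k 1 / \<epsilon>))}"
  then obtain u Du Dw where E: "E = energy \<epsilon> \<delta> \<theta> W (cube \<rho>) u Du" "H1 (cube \<rho>) u Du"
    and w: "H1_0 (cube \<rho>) (\<lambda>x. u x - q' (x \<bullet> axis k 1 / \<epsilon>)) Dw"
    unfolding eq_on_boundary_def by blast
  define f where "f t = q' (t / \<epsilon>) - q (t / \<epsilon>)" for t
  have sf: "smooth f"
    unfolding f_def by (intro smooth_diff smooth_scaled q)
  have "H1_0 (cube \<rho>) (\<lambda>x::real^'n. f (x $ k)) (grad (\<lambda>x. f (x $ k)))"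
    by (rule H1_0_vanishing[OF sf _ _ one \<rho>]) (use eq in \<open>simp_all add: f_def\<close>)
  from H1_0_add[OF w this]
  have "H1_0 (cube \<rho>) (\<lambda>x. u x - q (x \<bullet> axis k 1 / \<epsilon>)) (\<lambda>x. Dw x + grad (\<lambda>x. f (x $ k)) x)"
    by (simp add: f_def inner_axis)
  then have "eq_on_boundary (cube \<rho>) u (\<lambda>x. q (x \<bullet> axis k 1 / \<epsilon>))"
    unfolding eq_on_boundary_def by blast
  with E show "E \<in> {energy \<epsilon> \<delta> \<theta> W (cube \<rho>) u Du |u Du. H1 (cube \<rho>) u Du \<and> eq_on_boundary (cube \<rho>) u (\<lambda>x. q (x \<bullet> axis k 1 / \<epsilon>))}"
    by blast
qed

subsection \<open>The stripe pattern\<close>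

text \<open>The factorial makes each start a multiple \<open>n ^ 4\<close> of the previous one, so
  that earlier windows are negligible. The fourth power also yields
  \<open>real n ^ 4 \<le> window_start n\<close>, from which the smallness of \<delta>
  follows.\<close>

definition window_start :: "nat \<Rightarrow> real" where "window_start n = fact n ^ 4"

text \<open>The relative length 1 / n tends to 0, which gives density zero, yet slowly enough for a
  rescaled window to hold a whole transition.\<close>

definition windows :: "real set" where
  "windows = (\<Union>n\<in>{1..}. {window_start n..window_start n + window_start n / real n})"

definition stripe :: "real \<Rightarrow> real" where "stripe t = (if t \<in> windows then 1 else 2)"

lemma windows_borel [measurable]: "windows \<in> sets borel"
  unfolding windows_def by (intro sets.countable_UN') auto

lemma stripe_borel [measurable]: "stripe \<in> borel_measurable borel"
  unfolding stripe_def by measurable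

lemma window_start_mono: "m \<le> n \<Longrightarrow> window_start m \<le> window_start n"
  unfolding window_start_def by (intro power_mono fact_mono) auto

lemma window_start_ge: "real n ^ 4 \<le> window_start n"
proof -
  have "real n \<le> real (fact n)" using fact_ge_self[of n] of_nat_le_iff by blast
  then show ?thesis unfolding window_start_def by (intro power_mono) auto
qed

lemma window_start_pos: "window_start n > 0"
  by (simp add: window_start_def)

text \<open>Only the last window that has started matters: the earlier ones lie below \<open>2 * window_start (N - 1)\<close>.\<close>
lemma windows_density:
  assumes K: "K \<ge> 1" and R: "window_start K \<le> R"
  shows "measure lborel (windows \<inter> {-R..R}) \<le> 3 * R / real K"
proof -
  have "real n \<le> R" if "window_start n \<le> R" for n
  proof (cases n)
    case (Suc m)
    have "real n = real n ^ 1" by simp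
    also have "\<dots> \<le> real n ^ 4" by (intro power_increasing) (auto simp: Suc)
    finally show ?thesis using window_start_ge[of n] that by linarith
  qed (use that window_start_pos[of n] in auto)
  then have "{n. window_start n \<le> R} \<subseteq> {..nat \<lceil>R\<rceil>}"
    using real_nat_ceiling_ge[of R] order_trans of_nat_le_iff by blast
  then have fin: "finite {n. window_start n \<le> R}" using finite_subset by blast
  define N where "N = Max {n. window_start n \<le> R}"
  have NR: "window_start N \<le> R" using Max_in[OF fin] R by (auto simp: N_def)
  have Nmax: "n \<le> N" if "window_start n \<le> R" for n unfolding N_def using fin that by simp
  have NK: "K \<le> N" using R by (rule Nmax)
  have N1: "N \<ge> 1" using K NK by simp
  have rec: "window_start (N - 1) \<le> window_start N / real N"
  proof -
    have "window_start N = real N ^ 4 * window_start (N - 1)"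
      using N1 unfolding window_start_def by (subst fact_reduce) (auto simp: power_mult_distrib)
    moreover have "real N ^ 1 \<le> real N ^ 4" using N1 by (intro power_increasing) auto
    then have "real N * window_start (N - 1) \<le> real N ^ 4 * window_start (N - 1)"
      using window_start_pos[of "N - 1"] by (intro mult_right_mono) auto
    ultimately have "window_start (N - 1) * real N \<le> window_start N" by (simp add: mult.commute)
    then show ?thesis using N1 by (simp add: pos_le_divide_eq)
  qed
  \<comment> \<open>A window ends at the latest at twice its start, so \<open>?A\<close> contains
    all windows before the N-th.\<close>
  let ?A = "{0..2 * window_start (N - 1)}" and ?B = "{window_start N..window_start N + window_start N / real N}"
  have sub: "windows \<inter> {-R..R} \<subseteq> ?A \<union> ?B"
  proof
    fix t assume "t \<in> windows \<inter> {-R..R}"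
    then obtain n where n: "n \<ge> 1" "window_start n \<le> t" "t \<le> window_start n + window_start n / real n" "t \<le> R"
      by (auto simp: windows_def)
    show "t \<in> ?A \<union> ?B"
    proof (cases "n = N")
      case False
      moreover have "n \<le> N" by (rule Nmax) (use n in linarith)
      ultimately have nN: "window_start n \<le> window_start (N - 1)" by (intro window_start_mono) simp
      have "window_start n / real n \<le> window_start n" using n(1) window_start_pos[of n] by (simp add: divide_le_eq)
      then have "t \<le> 2 * window_start (N - 1)" using n(3) nN by linarith
      moreover have "0 \<le> t" using n(2) window_start_pos[of n] by linarith
      ultimately show ?thesis by simp
    qed (use n in auto)
  qed
  have "measure lborel (windows \<inter> {-R..R}) \<le> measure lborel (?A \<union> ?B)"
    by (rule measure_mono_fmeasurable[OF sub]) (auto intro!: fmeasurable_compact compact_Un)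
  also have "\<dots> \<le> measure lborel ?A + measure lborel ?B"
    by (intro measure_Un_le) auto
  also have "\<dots> = 2 * window_start (N - 1) + window_start N / real N"
    using window_start_pos[of N] window_start_pos[of "N - 1"] by simp
  also have "\<dots> \<le> 3 * (window_start N / real N)" using rec by simp
  also have "\<dots> \<le> 3 * (R / real K)"
    using NR NK K window_start_pos[of N] by (intro mult_left_mono frac_le) auto
  finally show ?thesis by simp
qed

lemma windows_density_zero: "((\<lambda>R. measure lborel (windows \<inter> {-R..R}) / R) \<longlongrightarrow> 0) at_top"
proof (rule tendstoI)
  fix e :: real assume e: "e > 0"
  obtain K :: nat where K: "3 / e < real K" using reals_Archimedean2 by blast
  have K1: "K \<ge> 1" using K e by (cases K) (auto simp: divide_less_0_iff)
  show "\<forall>\<^sub>F R in at_top. dist (measure lborel (windows \<inter> {-R..R}) / R) 0 < e"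
    using eventually_ge_at_top[of "window_start K"]
  proof eventually_elim
    case (elim R)
    have R: "R > 0" using elim window_start_pos[of K] by linarith
    have "measure lborel (windows \<inter> {-R..R}) / R \<le> 3 * R / real K / R"
      using R by (intro divide_right_mono windows_density[OF K1 elim]) simp
    also have "\<dots> = 3 / real K" using R by simp
    also have "\<dots> < e" using K K1 e by (simp add: field_simps)
    finally show ?case using R by simp
  qed
qed

text \<open>The approximating trigonometric polynomial is the constant 2. The difference takes only
  the values 0 and -1, so the p-th power of its modulus is the indicator of \<open>windows\<close>
  for every p, and the seminorm reduces to their density.\<close>

lemma besicovitch_stripe:
  assumes p: "p \<ge> 1"
  shows "besicovitch p (\<lambda>t. complex_of_real (stripe t))"
  unfolding besicovitch_def
proof (intro conjI allI impI)
  have m: "(\<lambda>t. complex_of_real (stripe t)) \<in> borel_measurable borel" by measurable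
  show "(\<lambda>t. complex_of_real (stripe t)) \<in> borel_measurable lebesgue"
    using measurable_completion[of "\<lambda>t. complex_of_real (stripe t)" lborel borel] m by simp
  show "integrable (lebesgue_on {-R..R}) (\<lambda>x. cmod (complex_of_real (stripe x)) powr p)" for R
  proof -
    interpret finite_measure "lebesgue_on {-R..R}"
      by (rule finite_measureI) (simp add: emeasure_restrict_space emeasure_lborel_Icc_eq)
    have [measurable]: "stripe \<in> borel_measurable (lebesgue_on {-R..R})"
      by (rule measurable_restrict_space1, rule measurable_completion) simp
    show ?thesis
    proof (rule integrable_const_bound[where B = "2 powr p"])
      show "AE x in lebesgue_on {-R..R}. norm (cmod (complex_of_real (stripe x)) powr p) \<le> 2 powr p"
        using p by (intro AE_I2) (auto simp: stripe_def intro: ge_one_powr_ge_zero)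
    qed measurable
  qed
  fix \<eta> :: real assume \<eta>: "\<eta> > 0"
  show "\<exists>P. trig_poly P \<and> Limsup at_top (\<lambda>R. ereal ((LINT x|lebesgue_on {-R..R}. cmod (complex_of_real (stripe x) - P x) powr p) / (2 * R))) \<le> ereal \<eta>"
  proof (intro exI conjI)
    show "trig_poly (\<lambda>x. 2)"
      unfolding trig_poly_def by (intro exI[of _ "{0}"] exI[of _ "\<lambda>_. 2"]) simp
    have val: "(LINT x|lebesgue_on {-R..R}. cmod (complex_of_real (stripe x) - 2) powr p) = measure lborel (windows \<inter> {-R..R})" for R
    proof -
      have "(\<lambda>x. cmod (complex_of_real (stripe x) - 2) powr p) = indicator windows"
        using p by (auto simp: fun_eq_iff stripe_def indicator_def)
      then have "(LINT x|lebesgue_on {-R..R}. cmod (complex_of_real (stripe x) - 2) powr p) = (LINT x|lebesgue_on {-R..R}. indicator windows x)"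
        by simp
      also have "\<dots> = (LINT x|lborel. indicator {-R..R} x * indicator windows x)"
        by (rule integral_lebesgue_on_borel) auto
      also have "\<dots> = (LINT x|lborel. indicator (windows \<inter> {-R..R}) x)"
        by (intro Bochner_Integration.integral_cong) (auto simp: indicator_def)
      also have "\<dots> = measure lborel (windows \<inter> {-R..R})" by simp
      finally show ?thesis .
    qed
    show "Limsup at_top (\<lambda>R. ereal ((LINT x|lebesgue_on {-R..R}. cmod (complex_of_real (stripe x) - 2) powr p) / (2 * R))) \<le> ereal \<eta>"
    proof (rule Limsup_bounded)
      have "\<forall>\<^sub>F R in at_top. measure lborel (windows \<inter> {-R..R}) / R < \<eta>"
        by (rule order_tendstoD(2)[OF windows_density_zero \<eta>])
      then show "\<forall>\<^sub>F R in at_top. ereal ((LINT x|lebesgue_on {-R..R}. cmod (complex_of_real (stripe x) - 2) powr p) / (2 * R)) \<le> ereal \<eta>"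
        using eventually_gt_at_top[of 0]
      proof eventually_elim
        case (elim R)
        have "measure lborel (windows \<inter> {-R..R}) / (2 * R) \<le> measure lborel (windows \<inter> {-R..R}) / R"
          using elim(2) by (intro divide_left_mono) auto
        then show ?case unfolding val using elim(1) by simp
      qed
    qed
  qed
qed

section \<open>Mean value of the striped weight\<close>

context periodic_weight
begin

text \<open>This is \<open>homogenization_estimate\<close> with \<delta> = 1 for the indicator of
  the cube: a translation by less than one period changes it only in a shell of bounded width, whose
  volume is of lower order than that of the cube.\<close>

lemma cube_integral_weight:
  assumes R: "R \<ge> 1"
  shows "\<bar>cube_integral (2 * R) \<theta> - (2 * R) ^ CARD('n)\<bar> \<le> \<Theta> * ((2 * R + 2) ^ CARD('n) - (2 * R - 2) ^ CARD('n))"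
proof -
  let ?\<psi> = "indicator (cube (2 * R)) :: real^'n \<Rightarrow> real"
  let ?N = "cube (2 * R + 2) - cube (2 * R - 2) :: (real^'n) set"
  let ?e = "(2 * R + 2) ^ CARD('n) - (2 * R - 2) ^ CARD('n)"
  have e0: "?e \<ge> 0" using R by (simp add: power_mono)
  have N: "emeasure lborel ?N = ennreal ?e"
  proof -
    have "emeasure lborel ?N = emeasure lborel (cube (2 * R + 2) :: (real^'n) set) - emeasure lborel (cube (2 * R - 2) :: (real^'n) set)"
    proof (rule emeasure_Diff)
      have "(2 * R - 2) / 2 \<le> (2 * R + 2) / 2" by simp
      then show "cube (2 * R - 2) \<subseteq> (cube (2 * R + 2) :: (real^'n) set)"
        unfolding subset_iff mem_cube by (meson order_trans)
    qed (use R in \<open>auto simp: emeasure_cube\<close>)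
    then show ?thesis using R by (simp add: emeasure_cube ennreal_minus)
  qed
  have osc: "(\<integral>\<^sup>+x. ennreal \<bar>?\<psi> (x - 1 *\<^sub>R z) - ?\<psi> x\<bar> \<partial>lborel) \<le> ennreal ?e" if "z \<in> cell" for z
  proof -
    have z: "0 \<le> z $ j \<and> z $ j < 1" for j using that by (simp add: cell_def)
    have "\<bar>?\<psi> (x - 1 *\<^sub>R z) - ?\<psi> x\<bar> \<le> indicator ?N x" for x
      using translate_diff_cube[where f = "\<lambda>_. 1" and \<eta> = "\<lambda>_. 0" and K = 1 and \<delta> = 1 and \<rho> = "2 * R" and x = x, OF z] by simp
    then have "(\<integral>\<^sup>+x. ennreal \<bar>?\<psi> (x - 1 *\<^sub>R z) - ?\<psi> x\<bar> \<partial>lborel) \<le> (\<integral>\<^sup>+x. indicator ?N x \<partial>lborel)"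
      by (intro nn_integral_mono) (metis ennreal_indicator ennreal_leI)
    then show ?thesis by (simp add: N)
  qed
  have I: "(\<integral>\<^sup>+x. ennreal (?\<psi> x * \<theta> (x /\<^sub>R 1)) \<partial>lborel) = ennreal (cube_integral (2 * R) \<theta>)"
    by (subst ennreal_cube_integral[OF cont]) (auto intro!: nn_integral_cong simp: pos less_imp_le indicator_def)
  have V: "(\<integral>\<^sup>+x. ennreal (?\<psi> x) \<partial>lborel) = ennreal ((2 * R) ^ CARD('n))"
    using R by (simp add: ennreal_indicator emeasure_cube)
  have I0: "cube_integral (2 * R) \<theta> \<ge> 0" by (rule cube_integral_nonneg) (simp add: pos less_imp_le)
  have T0: "\<Theta> * ?e \<ge> 0" using bound_pos e0 by simp
  have 1: "ennreal (cube_integral (2 * R) \<theta>) \<le> ennreal ((2 * R) ^ CARD('n)) + ennreal \<Theta> * ennreal ?e"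
    unfolding I[symmetric] V[symmetric] by (rule homogenization_estimate(1)[OF _ _ _ osc]) auto
  have 2: "ennreal ((2 * R) ^ CARD('n)) \<le> ennreal (cube_integral (2 * R) \<theta>) + ennreal \<Theta> * ennreal ?e"
    unfolding I[symmetric] V[symmetric] by (rule homogenization_estimate(2)[OF _ _ _ osc]) auto
  have "cube_integral (2 * R) \<theta> \<le> (2 * R) ^ CARD('n) + \<Theta> * ?e"
    using 1 R T0 e0 bound_pos by (simp add: ennreal_mult[symmetric] ennreal_plus[symmetric] del: ennreal_plus)
  moreover have "(2 * R) ^ CARD('n) \<le> cube_integral (2 * R) \<theta> + \<Theta> * ?e"
    using 2 R T0 e0 I0 bound_pos by (simp add: ennreal_mult[symmetric] ennreal_plus[symmetric] del: ennreal_plus)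
  ultimately show ?thesis by linarith
qed

text \<open>The pattern is 2 minus the indicator of \<open>windows\<close>. The first part has mean
  2 by the shell estimate; the second is bounded by \<Theta> times the one-dimensional density of
  the windows.\<close>

lemma has_mean_value_stripe: "has_mean_value (\<lambda>y. stripe (y $ k) * \<theta> y) 2"
proof -
  let ?n = "CARD('n)"
  define B where "B R = (LINT x|lborel. indicator (cube (2 * R)) x * (indicator windows (x $ k) * \<theta> x))" for R
  have cb: "cbox (vec (- R)) (vec R) = (cube (2 * R) :: (real^'n) set)" for R by (simp add: cube_def)
  have lim0: "((\<lambda>R::real. inverse R) \<longlongrightarrow> 0) at_top" by (rule tendsto_inverse_0_at_top[OF filterlim_ident])
  have shell: "((\<lambda>R::real. ((2 * R + 2) ^ ?n - (2 * R - 2) ^ ?n) / (2 * R) ^ ?n) \<longlongrightarrow> 0) at_top"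
  proof -
    have "((\<lambda>R::real. (1 + inverse R) ^ ?n - (1 - inverse R) ^ ?n) \<longlongrightarrow> (1 + 0) ^ ?n - (1 - 0) ^ ?n) at_top"
      by (intro tendsto_intros lim0)
    moreover have "\<forall>\<^sub>F R::real in at_top. (1 + inverse R) ^ ?n - (1 - inverse R) ^ ?n = ((2 * R + 2) ^ ?n - (2 * R - 2) ^ ?n) / (2 * R) ^ ?n"
      using eventually_gt_at_top[of "0::real"]
    proof eventually_elim
      case (elim R)
      have "(2 * R + 2) / (2 * R) = 1 + inverse R" "(2 * R - 2) / (2 * R) = 1 - inverse R"
        using elim by (simp_all add: field_simps)
      then show ?case by (metis diff_divide_distrib power_divide)
    qed
    ultimately show ?thesis by (simp add: tendsto_cong)
  qed
  have A1: "((\<lambda>R. cube_integral (2 * R) \<theta> / (2 * R) ^ ?n) \<longlongrightarrow> 1) at_top"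
  proof -
    have "((\<lambda>R. cube_integral (2 * R) \<theta> / (2 * R) ^ ?n - 1) \<longlongrightarrow> 0) at_top"
    proof (rule tendsto_rabs_zero_cancel, rule tendsto_sandwich[OF _ _ tendsto_const])
      show "((\<lambda>R. \<Theta> * (((2 * R + 2) ^ ?n - (2 * R - 2) ^ ?n) / (2 * R) ^ ?n)) \<longlongrightarrow> 0) at_top"
        using tendsto_mult[OF tendsto_const[of \<Theta>] shell] by simp
      show "\<forall>\<^sub>F R in at_top. \<bar>cube_integral (2 * R) \<theta> / (2 * R) ^ ?n - 1\<bar> \<le> \<Theta> * (((2 * R + 2) ^ ?n - (2 * R - 2) ^ ?n) / (2 * R) ^ ?n)"
        using eventually_ge_at_top[of "1::real"]
      proof eventually_elim
        case (elim R)
        have p: "(2 * R) ^ ?n > 0" using elim by simp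
        have "\<bar>cube_integral (2 * R) \<theta> / (2 * R) ^ ?n - 1\<bar> = \<bar>cube_integral (2 * R) \<theta> - (2 * R) ^ ?n\<bar> / (2 * R) ^ ?n"
        proof -
          have "cube_integral (2 * R) \<theta> / (2 * R) ^ ?n - 1 = (cube_integral (2 * R) \<theta> - (2 * R) ^ ?n) / (2 * R) ^ ?n"
            using p by (simp only: diff_divide_distrib divide_self_if less_imp_neq[symmetric] if_False)
          then show ?thesis using p by (simp only: abs_divide abs_of_pos)
        qed
        also have "\<dots> \<le> \<Theta> * ((2 * R + 2) ^ ?n - (2 * R - 2) ^ ?n) / (2 * R) ^ ?n"
          by (intro divide_right_mono cube_integral_weight elim less_imp_le[OF p])
        finally show ?case by simp
      qed
    qed auto
    then show ?thesis by (simp add: LIM_zero_iff)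
  qed
  have iB: "integrable lborel (\<lambda>x. indicator (cube (2 * R)) x * (indicator windows (x $ k) * \<theta> x))" for R
  proof (rule Bochner_Integration.integrable_bound[OF integrable_cube[OF cont]])
    show "AE x in lborel. norm (indicator (cube (2 * R)) x * (indicator windows (x $ k) * \<theta> x)) \<le> norm (indicator (cube (2 * R)) x * \<theta> x)"
      by (intro AE_I2) (auto simp: indicator_def)
  qed measurable
  have B0: "B R \<ge> 0" for R
    unfolding B_def using pos by (intro Bochner_Integration.integral_nonneg) (auto simp: indicator_def less_imp_le)
  have B1: "B R \<le> \<Theta> * (2 * R) ^ (?n - 1) * measure lborel (windows \<inter> {-R..R})" if "R > 0" for R
  proof -
    have "ennreal (B R) = (\<integral>\<^sup>+x. ennreal (indicator (cube (2 * R)) x * (indicator windows (x $ k) * \<theta> x)) \<partial>lborel)"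
      unfolding B_def using pos by (intro nn_integral_eq_integral[OF iB, symmetric]) (auto simp: indicator_def less_imp_le)
    also have "\<dots> \<le> (\<integral>\<^sup>+x. (ennreal \<Theta> * indicator windows (x $ k)) * indicator (cube (2 * R)) x \<partial>lborel)"
      using bound by (intro nn_integral_mono) (auto simp: indicator_def ennreal_leI)
    also have "\<dots> = ennreal (2 * R) ^ (?n - 1) * (\<integral>\<^sup>+t. (ennreal \<Theta> * indicator windows t) * indicator {- (2 * R) / 2..2 * R / 2} t \<partial>lborel)"
      by (rule nn_integral_cube_coord) (use that in auto)
    also have "(\<integral>\<^sup>+t. (ennreal \<Theta> * indicator windows t) * indicator {- (2 * R) / 2..2 * R / 2} t \<partial>lborel) =
        (\<integral>\<^sup>+t. ennreal \<Theta> * indicator (windows \<inter> {-R..R}) t \<partial>lborel)"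
      by (intro nn_integral_cong) (auto simp: indicator_def)
    also have "\<dots> = ennreal \<Theta> * emeasure lborel (windows \<inter> {-R..R})" by (rule nn_integral_cmult_indicator) measurable
    also have "emeasure lborel (windows \<inter> {-R..R}) = ennreal (measure lborel (windows \<inter> {-R..R}))"
    proof (rule emeasure_eq_ennreal_measure)
      have "emeasure lborel (windows \<inter> {-R..R}) \<le> emeasure lborel {-R..R}" by (intro emeasure_mono) auto
      then show "emeasure lborel (windows \<inter> {-R..R}) \<noteq> top" using that by (auto simp: top_unique)
    qed
    also have "ennreal (2 * R) ^ (?n - 1) * (ennreal \<Theta> * ennreal (measure lborel (windows \<inter> {-R..R}))) =
        ennreal (\<Theta> * (2 * R) ^ (?n - 1) * measure lborel (windows \<inter> {-R..R}))"
      using that bound_pos by (simp add: ennreal_power ennreal_mult[symmetric] mult_ac)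
    finally show ?thesis using that bound_pos by (simp add: ennreal_le_iff)
  qed
  have B2: "((\<lambda>R. B R / (2 * R) ^ ?n) \<longlongrightarrow> 0) at_top"
  proof (rule tendsto_sandwich[OF _ _ tendsto_const])
    show "((\<lambda>R. \<Theta> / 2 * (measure lborel (windows \<inter> {-R..R}) / R)) \<longlongrightarrow> 0) at_top"
      using tendsto_mult[OF tendsto_const[of "\<Theta> / 2"] windows_density_zero] by simp
    show "\<forall>\<^sub>F R in at_top. 0 \<le> B R / (2 * R) ^ ?n"
      using eventually_gt_at_top[of "0::real"] by eventually_elim (use B0 in simp)
    show "\<forall>\<^sub>F R in at_top. B R / (2 * R) ^ ?n \<le> \<Theta> / 2 * (measure lborel (windows \<inter> {-R..R}) / R)"
      using eventually_gt_at_top[of "0::real"]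
    proof eventually_elim
      case (elim R)
      let ?m = "measure lborel (windows \<inter> {-R..R})"
      have pn: "(2 * R) ^ ?n = (2 * R) ^ (?n - 1) * (2 * R)" by (metis Suc_pred' power_Suc2 zero_less_card_finite)
      have q: "(2 * R) ^ (?n - 1) > 0" using elim by simp
      have "B R / (2 * R) ^ ?n \<le> (\<Theta> * (2 * R) ^ (?n - 1) * ?m) / (2 * R) ^ ?n"
        using B1[OF elim] elim by (intro divide_right_mono) auto
      also have "\<dots> = (\<Theta> * X * m) / (X * (2 * R))" if "X = (2 * R) ^ (?n - 1)" "m = ?m" for X m
        unfolding pn that ..
      also have "(\<Theta> * X * m) / (X * (2 * R)) = \<Theta> / 2 * (m / R)" if "X > 0" for X m
        using that elim by (simp add: field_simps)
      finally show ?case using q by blast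
    qed
  qed
  have eq: "\<forall>\<^sub>F R in at_top. 2 * (cube_integral (2 * R) \<theta> / (2 * R) ^ ?n) - B R / (2 * R) ^ ?n =
      (LINT x|lebesgue_on (cbox (vec (- R)) (vec R)). stripe (x $ k) * \<theta> x) / (2 * R) ^ ?n"
  proof (rule always_eventually, rule allI)
    fix R
    have "(LINT x|lebesgue_on (cbox (vec (- R)) (vec R)). stripe (x $ k) * \<theta> x) =
        (LINT x|lborel. indicator (cube (2 * R)) x * (stripe (x $ k) * \<theta> x))"
      unfolding cb by (rule integral_lebesgue_on_borel) measurable
    also have "\<dots> = (LINT x|lborel. 2 * (indicator (cube (2 * R)) x * \<theta> x) - indicator (cube (2 * R)) x * (indicator windows (x $ k) * \<theta> x))"
      by (intro Bochner_Integration.integral_cong) (auto simp: stripe_def indicator_def)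
    also have "\<dots> = 2 * cube_integral (2 * R) \<theta> - B R"
      unfolding B_def cube_integral_def using integrable_cube[OF cont] iB by simp
    finally show "2 * (cube_integral (2 * R) \<theta> / (2 * R) ^ ?n) - B R / (2 * R) ^ ?n =
      (LINT x|lebesgue_on (cbox (vec (- R)) (vec R)). stripe (x $ k) * \<theta> x) / (2 * R) ^ ?n"
      by (simp add: diff_divide_distrib)
  qed
  have "((\<lambda>R. 2 * (cube_integral (2 * R) \<theta> / (2 * R) ^ ?n) - B R / (2 * R) ^ ?n) \<longlongrightarrow> 2 * 1 - 0) at_top"
    by (intro tendsto_intros A1 B2)
  from Lim_transform_eventually[OF this eq] show ?thesis by (simp add: has_mean_value_def)
qed

end

lemma mean_value_eqI: "has_mean_value f m \<Longrightarrow> mean_value f = m"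
  unfolding mean_value_def has_mean_value_def
  by (rule the_equality) (auto intro: tendsto_unique[OF trivial_limit_at_top_linorder])

text \<open>For \<open>n\<close> about \<open>1 / sqrt \<epsilon>\<close> and \<open>r = sqrt (sqrt \<epsilon>)\<close>, the \<open>n\<close>-th window, scaled to start at \<open>r\<close>,
  has length \<open>r / n\<close>, which is much longer than the transition layer of length of order \<open>\<epsilon>\<close>.\<close>
lemma stripe_scales:
  obtains \<delta> r :: "real \<Rightarrow> real" where "\<And>\<epsilon>. \<epsilon> > 0 \<Longrightarrow> \<delta> \<epsilon> > 0" "((\<lambda>\<epsilon>. \<delta> \<epsilon> / \<epsilon>\<^sup>2) \<longlongrightarrow> 0) (at_right 0)"
    "\<And>\<epsilon>. \<epsilon> > 0 \<Longrightarrow> r \<epsilon> \<ge> 0" "(r \<longlongrightarrow> 0) (at_right 0)"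
    "\<And>M. M > 0 \<Longrightarrow> \<forall>\<^sub>F \<epsilon> in at_right 0. \<forall>t\<in>{r \<epsilon>..r \<epsilon> + M * \<epsilon>}. stripe (t / \<delta> \<epsilon>) = 1"
proof -
  define r :: "real \<Rightarrow> real" where "r \<epsilon> = sqrt (sqrt \<epsilon>)" for \<epsilon>
  define n where "n \<epsilon> = nat \<lceil>1 / sqrt \<epsilon>\<rceil>" for \<epsilon> :: real
  define \<delta> where "\<delta> \<epsilon> = r \<epsilon> / window_start (n \<epsilon>)" for \<epsilon>
  have r2: "(r \<epsilon>)\<^sup>2 = sqrt \<epsilon>" "(r \<epsilon>) ^ 4 = \<epsilon>" and rp: "r \<epsilon> > 0" if "\<epsilon> > 0" for \<epsilon>
  proof -
    show a: "(r \<epsilon>)\<^sup>2 = sqrt \<epsilon>" using that by (simp add: r_def)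
    have "(r \<epsilon>) ^ 4 = ((r \<epsilon>)\<^sup>2)\<^sup>2" by (simp add: power_mult[symmetric])
    then show "(r \<epsilon>) ^ 4 = \<epsilon>" using that by (simp add: a)
  qed (use that in \<open>simp add: r_def\<close>)
  have rlim: "(r \<longlongrightarrow> 0) (at_right 0)"
  proof -
    have "((\<lambda>\<epsilon>. sqrt (sqrt \<epsilon>)) \<longlongrightarrow> sqrt (sqrt 0)) (at_right 0)" by (intro tendsto_intros)
    then show ?thesis by (simp add: r_def[abs_def])
  qed
  have n_ge: "1 / sqrt \<epsilon> \<le> real (n \<epsilon>)" and n_le: "real (n \<epsilon>) \<le> 1 / sqrt \<epsilon> + 1" and n1: "n \<epsilon> \<ge> 1" if "\<epsilon> > 0" for \<epsilon>
  proof -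
    have p: "1 / sqrt \<epsilon> > 0" using that by simp
    show a: "1 / sqrt \<epsilon> \<le> real (n \<epsilon>)" unfolding n_def by (rule real_nat_ceiling_ge)
    show "real (n \<epsilon>) \<le> 1 / sqrt \<epsilon> + 1" unfolding n_def using p by linarith
    have "real (n \<epsilon>) > 0" using a p by linarith
    then show "n \<epsilon> \<ge> 1" by simp
  qed
  have ws: "1 / \<epsilon>\<^sup>2 \<le> window_start (n \<epsilon>)" if "\<epsilon> > 0" for \<epsilon>
  proof -
    have "(1 / sqrt \<epsilon>) ^ 4 \<le> real (n \<epsilon>) ^ 4" using n_ge[OF that] that by (intro power_mono) auto
    moreover have "(1 / sqrt \<epsilon>) ^ 4 = ((1 / sqrt \<epsilon>)\<^sup>2)\<^sup>2" by (simp add: power_mult[symmetric])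
    moreover have "(1 / sqrt \<epsilon>)\<^sup>2 = 1 / \<epsilon>" using that by (simp add: power_divide)
    ultimately have "(1 / \<epsilon>)\<^sup>2 \<le> real (n \<epsilon>) ^ 4" by (simp only:)
    then have "1 / \<epsilon>\<^sup>2 \<le> real (n \<epsilon>) ^ 4" by (simp only: power_divide power_one)
    then show ?thesis using window_start_ge[of "n \<epsilon>"] by linarith
  qed
  show ?thesis
  proof (rule that[of \<delta> r])
    show dpos: "\<delta> \<epsilon> > 0" if "\<epsilon> > 0" for \<epsilon> using rp[OF that] window_start_pos by (simp add: \<delta>_def)
    show "((\<lambda>\<epsilon>. \<delta> \<epsilon> / \<epsilon>\<^sup>2) \<longlongrightarrow> 0) (at_right 0)"
    proof (rule tendsto_sandwich[OF _ _ tendsto_const rlim])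
      show "\<forall>\<^sub>F \<epsilon> in at_right 0. 0 \<le> \<delta> \<epsilon> / \<epsilon>\<^sup>2"
        by (rule eventually_mono[OF eventually_at_right_less]) (use dpos in \<open>simp add: less_imp_le\<close>)
      show "\<forall>\<^sub>F \<epsilon> in at_right 0. \<delta> \<epsilon> / \<epsilon>\<^sup>2 \<le> r \<epsilon>"
      proof (rule eventually_mono[OF eventually_at_right_less])
        fix \<epsilon> :: real assume \<epsilon>: "0 < \<epsilon>"
        have "r \<epsilon> * (1 / \<epsilon>\<^sup>2) \<le> r \<epsilon> * window_start (n \<epsilon>)"
          using rp[OF \<epsilon>] by (intro mult_left_mono ws \<epsilon>) simp
        then have "r \<epsilon> * (1 / \<epsilon>\<^sup>2) / window_start (n \<epsilon>) \<le> r \<epsilon> * window_start (n \<epsilon>) / window_start (n \<epsilon>)"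
          using window_start_pos[of "n \<epsilon>"] by (intro divide_right_mono) auto
        then show "\<delta> \<epsilon> / \<epsilon>\<^sup>2 \<le> r \<epsilon>"
          using window_start_pos[of "n \<epsilon>"] by (simp add: \<delta>_def mult.commute)
      qed
    qed
    show "r \<epsilon> \<ge> 0" if "\<epsilon> > 0" for \<epsilon> using rp[OF that] by simp
    show "(r \<longlongrightarrow> 0) (at_right 0)" by (rule rlim)
    fix M :: real assume M: "M > 0"
    \<comment> \<open>Since \<epsilon> times the index is at most
      \<open>sqrt \<epsilon> + \<epsilon>\<close>, that is
      \<open>r \<epsilon> * (r \<epsilon> + r \<epsilon> ^ 3)\<close>, this bound says that the
      transition of length \<open>M * \<epsilon>\<close> fits into the rescaled window.\<close>
    have "((\<lambda>\<epsilon>. M * (r \<epsilon> + r \<epsilon> ^ 3)) \<longlongrightarrow> M * (0 + 0 ^ 3)) (at_right 0)" by (intro tendsto_intros rlim)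
    then have "\<forall>\<^sub>F \<epsilon> in at_right 0. M * (r \<epsilon> + r \<epsilon> ^ 3) < 1" by (rule order_tendstoD(2)) simp
    then show "\<forall>\<^sub>F \<epsilon> in at_right 0. \<forall>t\<in>{r \<epsilon>..r \<epsilon> + M * \<epsilon>}. stripe (t / \<delta> \<epsilon>) = 1"
      using eventually_at_right_less[of 0]
    proof eventually_elim
      case (elim \<epsilon>)
      let ?w = "window_start (n \<epsilon>)" and ?n = "real (n \<epsilon>)"
      have w: "?w > 0" by (rule window_start_pos)
      have rp': "r \<epsilon> > 0" using elim(2) by (rule rp)
      have "\<epsilon> * ?n \<le> \<epsilon> * (1 / sqrt \<epsilon> + 1)" using n_le[OF elim(2)] elim(2) by (intro mult_left_mono) auto
      also have "\<dots> = sqrt \<epsilon> + \<epsilon>" using elim(2) by (simp add: distrib_left real_div_sqrt)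
      also have "\<dots> = r \<epsilon> * (r \<epsilon> + r \<epsilon> ^ 3)"
      proof -
        have "sqrt \<epsilon> + \<epsilon> = (r \<epsilon>)\<^sup>2 + r \<epsilon> ^ 4" using r2[OF elim(2)] by simp
        also have "\<dots> = r \<epsilon> * (r \<epsilon> + r \<epsilon> ^ 3)" by (simp add: power2_eq_square numeral_eq_Suc distrib_left)
        finally show ?thesis .
      qed
      finally have "M * (\<epsilon> * ?n) \<le> M * (r \<epsilon> * (r \<epsilon> + r \<epsilon> ^ 3))" using M by (intro mult_left_mono) auto
      also have "\<dots> = r \<epsilon> * (M * (r \<epsilon> + r \<epsilon> ^ 3))" by simp
      also have "\<dots> \<le> r \<epsilon> * 1" using elim(1) rp' by (intro mult_left_mono) auto
      finally have "M * \<epsilon> * ?n \<le> r \<epsilon>" by simp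
      then have Mle: "M * \<epsilon> \<le> r \<epsilon> / ?n" using n1[OF elim(2)] by (simp add: pos_le_divide_eq)
      show ?case
      proof
        fix t assume t: "t \<in> {r \<epsilon>..r \<epsilon> + M * \<epsilon>}"
        have q: "t / \<delta> \<epsilon> = t / r \<epsilon> * ?w" by (simp add: \<delta>_def)
        have "1 \<le> t / r \<epsilon>" using t rp' by simp
        then have lo: "1 * ?w \<le> t / r \<epsilon> * ?w" using w by (intro mult_right_mono) auto
        have "t \<le> r \<epsilon> + r \<epsilon> / ?n" using t Mle by simp
        then have "t / r \<epsilon> \<le> (r \<epsilon> + r \<epsilon> / ?n) / r \<epsilon>" using rp' by (intro divide_right_mono) auto
        also have "\<dots> = 1 + 1 / ?n" using rp' by (simp add: add_divide_distrib)
        finally have "t / r \<epsilon> * ?w \<le> (1 + 1 / ?n) * ?w" using w by (intro mult_right_mono) auto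
        then have "t / \<delta> \<epsilon> \<in> {?w..?w + ?w / ?n}" using lo by (simp add: q distrib_right)
        then have "t / \<delta> \<epsilon> \<in> windows" using n1[OF elim(2)] by (auto simp: windows_def)
        then show "stripe (t / \<delta> \<epsilon>) = 1" by (simp add: stripe_def)
      qed
    qed
  qed
qed

subsection \<open>The limit surface tension\<close>

lemma lattice_periodic_bounded:
  fixes \<theta> :: "real^'n \<Rightarrow> real"
  assumes "continuous_on UNIV \<theta>" "lattice_periodic \<theta>"
  obtains \<Theta> where "\<And>y. \<theta> y \<le> \<Theta>"
proof -
  have "compact (\<theta> ` cbox 0 1)"
    by (intro compact_continuous_image compact_cbox continuous_on_subset[OF assms(1)]) simp
  then obtain B where B: "\<forall>y\<in>cbox 0 1. \<bar>\<theta> y\<bar> \<le> B"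
    by (auto dest!: compact_imp_bounded simp: bounded_iff)
  have "\<theta> y \<le> B" for y
  proof -
    define z :: "real^'n" where "z = (\<chi> i. of_int \<lfloor>y $ i\<rfloor>)"
    have "y - z \<in> cbox 0 1"
      unfolding mem_box_cart
    proof (intro allI conjI)
      fix i
      show "0 $ i \<le> (y - z) $ i" by (simp add: z_def)
      show "(y - z) $ i \<le> 1 $ i" by (simp add: z_def) linarith
    qed
    then have "\<theta> (y - z) \<le> B" using B by (auto simp: abs_le_iff)
    moreover have "\<theta> (y - z + z) = \<theta> (y - z)"
      using assms(2) unfolding lattice_periodic_def by (metis Ints_of_int vec_lambda_beta z_def)
    ultimately show ?thesis by simp
  qed
  then show ?thesis by (rule that)
qed

lemma sigma_W_pos:
  assumes cW: "continuous_on UNIV W" and W0: "\<And>s. W s \<ge> 0" and "W 0 \<noteq> 0"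
  shows "sigma_W W > 0"
proof -
  have c: "continuous_on {-1..1} (\<lambda>s. sqrt (2 * W s))"
    by (intro continuous_intros continuous_on_subset[OF cW]) simp
  have "sigma_W W \<noteq> 0"
    unfolding sigma_W_def
    using integral_eq_0_iff[OF c] W0 assms(3) by (auto dest: bspec[where x = 0])
  moreover have "sigma_W W \<ge> 0"
    unfolding sigma_W_def
    by (intro Henstock_Kurzweil_Integration.integral_nonneg integrable_continuous_real c) (simp add: W0)
  ultimately show ?thesis by simp
qed

text \<open>Lower and upper bounds are proved separately and only with slack, for every c on either
  side of s; this combines them into a limit.\<close>

lemma tendsto_ennreal_divideI:
  fixes f :: "real \<Rightarrow> ennreal"
  assumes R: "R > 0" and s: "s > 0"
    and lo: "\<And>c. c < s \<Longrightarrow> \<forall>\<^sub>F \<epsilon> in F. ennreal (R * c) \<le> f \<epsilon>"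
    and hi: "\<And>c. s < c \<Longrightarrow> \<forall>\<^sub>F \<epsilon> in F. f \<epsilon> \<le> ennreal (R * c)"
  shows "((\<lambda>\<epsilon>. f \<epsilon> / ennreal R) \<longlongrightarrow> ennreal s) F"
proof (rule order_tendstoI)
  have div: "ennreal (R * c) / ennreal R = ennreal c" if "c \<ge> 0" for c
    using R that by (simp add: divide_ennreal)
  fix a :: ennreal
  {
    assume a: "a < ennreal s"
    then obtain a' where a': "a = ennreal a'" "0 \<le> a'" by (cases a) auto
    then have "a' < s" using a s by (simp add: ennreal_less_iff)
    define c where "c = (a' + s) / 2"
    have c: "a' < c" "c < s" "0 \<le> c" using \<open>a' < s\<close> a' by (auto simp: c_def)
    show "\<forall>\<^sub>F \<epsilon> in F. a < f \<epsilon> / ennreal R"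
      using lo[OF c(2)]
    proof eventually_elim
      case (elim \<epsilon>)
      have "a < ennreal c" using a' c by (simp add: ennreal_less_iff)
      also have "\<dots> = ennreal (R * c) / ennreal R" using div[OF c(3)] by simp
      also have "\<dots> \<le> f \<epsilon> / ennreal R" using elim by (rule divide_right_mono_ennreal)
      finally show ?case .
    qed
  }
  {
    assume a: "ennreal s < a"
    obtain c where c: "s < c" "ennreal c < a"
    proof (cases a)
      case (real a')
      then have "s < a'" using a s by (simp add: ennreal_less_iff)
      then show ?thesis using that[of "(s + a') / 2"] real s by (simp add: ennreal_less_iff)
    next
      case top
      then show ?thesis using that[of "s + 1"] by simp
    qed
    show "\<forall>\<^sub>F \<epsilon> in F. f \<epsilon> / ennreal R < a"
      using hi[OF c(1)]
    proof eventually_elim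
      case (elim \<epsilon>)
      have "f \<epsilon> / ennreal R \<le> ennreal (R * c) / ennreal R" using elim by (rule divide_right_mono_ennreal)
      also have "\<dots> = ennreal c" using c s by (intro div) simp
      also have "\<dots> < a" by (rule c)
      finally show ?case .
    qed
  }
qed

text \<open>One \<kappa> serves both as distance from the interface and as accuracy, the form in
  which the layer estimate uses it. Uniformity in t comes from
  \<open>t / \<epsilon> \<ge> \<kappa> / \<epsilon>\<close>.\<close>

lemma eventually_scaled_limit:
  fixes q :: "real \<Rightarrow> real"
  assumes "(q \<longlongrightarrow> 1) at_top" "(q \<longlongrightarrow> -1) at_bot" "\<kappa> > 0"
  shows "\<forall>\<^sub>F \<epsilon> in at_right 0. \<forall>t\<ge>\<kappa>. \<bar>q (t / \<epsilon>) - 1\<bar> \<le> \<kappa> \<and> \<bar>q (- t / \<epsilon>) + 1\<bar> \<le> \<kappa>"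
proof -
  obtain T1 where T1: "\<And>s. s \<ge> T1 \<Longrightarrow> dist (q s) 1 < \<kappa>"
    using tendstoD[OF assms(1,3)] unfolding eventually_at_top_linorder by blast
  obtain T2 where T2: "\<And>s. s \<le> T2 \<Longrightarrow> dist (q s) (-1) < \<kappa>"
    using tendstoD[OF assms(2,3)] unfolding eventually_at_bot_linorder by blast
  define T where "T = max 1 (max T1 (- T2))"
  have T: "T > 0" "T1 \<le> T" "- T \<le> T2" by (auto simp: T_def)
  have "\<forall>\<^sub>F \<epsilon> in at_right 0. 0 < \<epsilon> \<and> \<epsilon> < \<kappa> / T"
    using T assms(3) by (intro eventually_at_rightI[of 0 "\<kappa> / T"]) auto
  then show ?thesis
  proof (rule eventually_mono, intro allI impI)
    fix \<epsilon> t :: real assume \<epsilon>: "0 < \<epsilon> \<and> \<epsilon> < \<kappa> / T" and t: "\<kappa> \<le> t"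
    have "\<epsilon> * T < \<kappa>" using \<epsilon> T by (simp add: pos_less_divide_eq)
    then have "T \<le> t / \<epsilon>" using \<epsilon> t by (simp add: pos_le_divide_eq mult.commute)
    then have "T1 \<le> t / \<epsilon>" "- t / \<epsilon> \<le> T2" using T by auto
    then have "dist (q (t / \<epsilon>)) 1 < \<kappa>" "dist (q (- t / \<epsilon>)) (-1) < \<kappa>" by (auto intro: T1 T2)
    then show "\<bar>q (t / \<epsilon>) - 1\<bar> \<le> \<kappa> \<and> \<bar>q (- t / \<epsilon>) + 1\<bar> \<le> \<kappa>"
      by (simp add: dist_real_def)
  qed
qed

context periodic_weight
begin

text \<open>In dimension one \<open>q\<close> may be replaced by a smooth step with the same values at the end points,
  whose derivative is bounded.\<close>
lemma sigma_cell_stripe_upper: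
  fixes W q \<delta> r :: "real \<Rightarrow> real" and k :: 'n
  assumes cW: "continuous_on UNIV W" and W0: "\<And>s. W s \<ge> 0" and zero: "W (-1) = 0" "W 1 = 0"
    and q: "smooth q" "\<And>t. q t \<in> {-1..1}" "(q \<longlongrightarrow> 1) at_top" "(q \<longlongrightarrow> -1) at_bot"
    and qd: "CARD('n) \<ge> 2 \<Longrightarrow> bounded (range (deriv q))"
    and \<delta>: "\<And>\<epsilon>. \<epsilon> > 0 \<Longrightarrow> \<delta> \<epsilon> > 0" "((\<lambda>\<epsilon>. \<delta> \<epsilon> / \<epsilon>) \<longlongrightarrow> 0) (at_right 0)"
    and r: "\<And>\<epsilon>. \<epsilon> > 0 \<Longrightarrow> r \<epsilon> \<ge> 0" "(r \<longlongrightarrow> 0) (at_right 0)"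
    and window: "\<And>M. M > 0 \<Longrightarrow> \<forall>\<^sub>F \<epsilon> in at_right 0. \<forall>t\<in>{r \<epsilon>..r \<epsilon> + M * \<epsilon>}. stripe (t / \<delta> \<epsilon>) = 1"
    and \<rho>: "\<rho> > 0" and c: "sigma_W W < c"
  shows "\<forall>\<^sub>F \<epsilon> in at_right 0. sigma_cell W q (\<lambda>y. stripe (y $ k) * \<theta> y) \<epsilon> (\<delta> \<epsilon>) (axis k 1) (cube \<rho>) \<le> ennreal (\<rho> ^ (CARD('n) - 1) * c)"
proof (cases "CARD('n) \<ge> 2")
  case True
  then obtain Cq where Cq: "\<And>t. \<bar>deriv q t\<bar> \<le> Cq" using qd by (auto simp: bounded_iff)
  show ?thesis
    by (rule sigma_cell_upper[where q = "\<lambda>_. q" and S = stripe, OF cW W0 zero q(1,2) Cq eventually_scaled_limit[OF q(3,4)] \<delta> _ _ r window \<rho> c])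
      (auto simp: stripe_def[of "_ :: real"] stripe_borel)
next
  case False
  then have one: "CARD('n) = 1" using zero_less_card_finite[where 'a = 'n] by linarith
  obtain B where B: "B \<ge> 1" "\<And>t. \<bar>deriv step t\<bar> \<le> B" by (rule deriv_step_bounded) blast
  \<comment> \<open>The values at both ends of the interval are eventually those of q, but the
    transition takes place for arguments in [0, 1], so that the derivative is bounded by
    \<open>2 * B\<close> for all \<epsilon>.\<close>
  define q' where "q' \<epsilon> t = q (- \<rho> / 2 / \<epsilon>) + (q (\<rho> / 2 / \<epsilon>) - q (- \<rho> / 2 / \<epsilon>)) * step t" for \<epsilon> t
  have sq': "smooth (q' \<epsilon>)" for \<epsilon>
    unfolding q'_def by (intro smooth_add smooth_mult smooth_const smooth_step)
  have rq': "q' \<epsilon> t \<in> {-1..1}" for \<epsilon> t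
  proof -
    have "(1 - step t) *\<^sub>R q (- \<rho> / 2 / \<epsilon>) + step t *\<^sub>R q (\<rho> / 2 / \<epsilon>) \<in> {-1..1}"
      by (rule convexD_alt) (use q(2) step_nonneg step_le_1 in auto)
    then show ?thesis by (simp add: q'_def algebra_simps)
  qed
  have dq': "\<bar>deriv (q' \<epsilon>) t\<bar> \<le> 2 * B" for \<epsilon> t
  proof -
    have "(q' \<epsilon> has_real_derivative (q (\<rho> / 2 / \<epsilon>) - q (- \<rho> / 2 / \<epsilon>)) * deriv step t) (at t)"
      unfolding q'_def
      by (rule DERIV_cong[OF DERIV_add[OF DERIV_const DERIV_cmult[OF smooth_DERIV[OF smooth_step]]]]) simp
    then have "deriv (q' \<epsilon>) t = (q (\<rho> / 2 / \<epsilon>) - q (- \<rho> / 2 / \<epsilon>)) * deriv step t" by (rule DERIV_imp_deriv)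
    moreover have "\<bar>q (\<rho> / 2 / \<epsilon>) - q (- \<rho> / 2 / \<epsilon>)\<bar> \<le> 2"
      using q(2)[of "\<rho> / 2 / \<epsilon>"] q(2)[of "- \<rho> / 2 / \<epsilon>"] by auto
    ultimately show ?thesis using B(2)[of t] by (simp only: abs_mult) (intro mult_mono, auto)
  qed
  have lim: "\<forall>\<^sub>F \<epsilon> in at_right 0. \<forall>t\<ge>\<kappa>. \<bar>q' \<epsilon> (t / \<epsilon>) - 1\<bar> \<le> \<kappa> \<and> \<bar>q' \<epsilon> (- t / \<epsilon>) + 1\<bar> \<le> \<kappa>" if \<kappa>: "\<kappa> > 0" for \<kappa>
  proof -
    \<comment> \<open>The end values of \<open>q'\<close> are those of q at distance \<rho> / 2, so
      closeness to the limits is required there as well.\<close>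
    define \<kappa>' where "\<kappa>' = min \<kappa> (\<rho> / 2)"
    have \<kappa>': "\<kappa>' > 0" using \<kappa> \<rho> by (simp add: \<kappa>'_def)
    have "\<forall>\<^sub>F \<epsilon> in at_right 0. 0 < \<epsilon> \<and> \<epsilon> < \<kappa>"
      using \<kappa> by (intro eventually_at_rightI[of 0 \<kappa>]) auto
    then show ?thesis
      using eventually_scaled_limit[OF q(3,4) \<kappa>']
    proof eventually_elim
      case (elim \<epsilon>)
      show ?case
      proof (intro allI impI)
        fix t assume t: "\<kappa> \<le> t"
        have "\<kappa>' \<le> \<rho> / 2" by (simp add: \<kappa>'_def)
        then have e: "\<bar>q (\<rho> / 2 / \<epsilon>) - 1\<bar> \<le> \<kappa>'" "\<bar>q (- (\<rho> / 2) / \<epsilon>) + 1\<bar> \<le> \<kappa>'" using elim(2) by blast+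
        have "t / \<epsilon> \<ge> 1" "- t / \<epsilon> \<le> 0" using elim(1) t by auto
        then have "q' \<epsilon> (t / \<epsilon>) = q (\<rho> / 2 / \<epsilon>)" "q' \<epsilon> (- t / \<epsilon>) = q (- (\<rho> / 2) / \<epsilon>)"
          by (simp_all add: q'_def step_0 step_1)
        moreover have "\<kappa>' \<le> \<kappa>" by (simp add: \<kappa>'_def)
        ultimately show "\<bar>q' \<epsilon> (t / \<epsilon>) - 1\<bar> \<le> \<kappa> \<and> \<bar>q' \<epsilon> (- t / \<epsilon>) + 1\<bar> \<le> \<kappa>" using e by simp
      qed
    qed
  qed
  have "\<forall>\<^sub>F \<epsilon> in at_right 0. sigma_cell W (q' \<epsilon>) (\<lambda>y. stripe (y $ k) * \<theta> y) \<epsilon> (\<delta> \<epsilon>) (axis k 1) (cube \<rho>) \<le> ennreal (\<rho> ^ (CARD('n) - 1) * c)"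
    by (rule sigma_cell_upper[where q = q' and S = stripe, OF cW W0 zero sq' rq' dq' lim \<delta> _ _ r window \<rho> c])
      (auto simp: stripe_def[of "_ :: real"] stripe_borel)
  moreover have "\<forall>\<^sub>F \<epsilon> in at_right 0. 0 < \<epsilon> \<and> \<epsilon> < \<rho> / 2"
    using \<rho> by (intro eventually_at_rightI[of 0 "\<rho> / 2"]) auto
  ultimately show ?thesis
  proof eventually_elim
    case (elim \<epsilon>)
    have "\<rho> / 2 / \<epsilon> \<ge> 1" "- \<rho> / 2 / \<epsilon> \<le> 0" using elim(2) \<rho> by auto
    then have "q' \<epsilon> (\<rho> / 2 / \<epsilon>) = q (\<rho> / 2 / \<epsilon>)" "q' \<epsilon> (- \<rho> / 2 / \<epsilon>) = q (- \<rho> / 2 / \<epsilon>)"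
      by (simp_all add: q'_def step_0 step_1)
    from sigma_cell_boundary_cong[OF q(1) sq' one \<rho> this] elim(1) show ?case by (rule order_trans)
  qed
qed

end

(* The index k plays the role of the first coordinate. For d >= 2 the lateral faces of the cube carry the
   boundary data q (x_1 / eps); if q oscillates too fast near infinity, every extension has energy
   tending to infinity, so smoothness of q has to include a bound on its derivative. *)
theorem theorem3:
  fixes W q :: "real \<Rightarrow> real" and \<theta>' :: "real^'n \<Rightarrow> real" and k :: 'n
  assumes W_cont: "continuous_on UNIV W"
    and W_nonneg: "\<And>s. W s \<ge> 0"
    and W_zero: "\<And>s. W s = 0 \<longleftrightarrow> s = -1 \<or> s = 1"
    and q_smooth: "smooth q"
    and q_range: "\<And>s. q s \<in> {-1..1}"
    and q_top: "(q \<longlongrightarrow> 1) at_top"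
    and q_bot: "(q \<longlongrightarrow> -1) at_bot"
    and q_deriv: "CARD('n) \<ge> 2 \<Longrightarrow> bounded (range (deriv q))"
    and \<theta>'_cont: "continuous_on UNIV \<theta>'"
    and \<theta>'_pos: "\<And>y. \<theta>' y > 0"
    and \<theta>'_periodic: "lattice_periodic \<theta>'"
    and \<theta>'_mean: "(LINT y|lebesgue_on (cbox 0 1). \<theta>' y) = 1"
  shows "\<exists>(stripe :: real \<Rightarrow> real) (\<delta> :: real \<Rightarrow> real).
           (\<forall>t. stripe t \<in> {1, 2}) \<and>
           (\<forall>p\<ge>1. besicovitch p (\<lambda>t. complex_of_real (stripe t))) \<and>
           (\<forall>\<epsilon>>0. \<delta> \<epsilon> > 0) \<and>
           ((\<lambda>\<epsilon>. \<delta> \<epsilon> / \<epsilon>) \<longlongrightarrow> 0) (at_right 0) \<and>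
           (let \<theta> = (\<lambda>y. stripe (y $ k) * \<theta>' y) in
              has_mean_value \<theta> (mean_value \<theta>) \<and>
              (\<forall>\<rho>>0. \<exists>L.
                 ((\<lambda>\<epsilon>. sigma_cell W q \<theta> \<epsilon> (\<delta> \<epsilon>) (axis k 1) (cube \<rho>) / ennreal (\<rho> ^ (CARD('n) - 1)))
                    \<longlongrightarrow> L) (at_right 0) \<and>
                 L \<le> ennreal (sigma_W W)) \<and>
              sigma_W W < sigma_bar W \<theta>)"
proof -
  obtain \<Theta> where \<Theta>: "\<And>y. \<theta>' y \<le> \<Theta>" using lattice_periodic_bounded[OF \<theta>'_cont \<theta>'_periodic] by blast
  interpret periodic_weight \<theta>' \<Theta>
    using \<theta>'_cont \<theta>'_pos \<Theta> \<theta>'_periodic \<theta>'_mean by unfold_locales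
  obtain \<delta> r :: "real \<Rightarrow> real" where \<delta>: "\<And>\<epsilon>. \<epsilon> > 0 \<Longrightarrow> \<delta> \<epsilon> > 0" "((\<lambda>\<epsilon>. \<delta> \<epsilon> / \<epsilon>\<^sup>2) \<longlongrightarrow> 0) (at_right 0)"
    and r: "\<And>\<epsilon>. \<epsilon> > 0 \<Longrightarrow> r \<epsilon> \<ge> 0" "(r \<longlongrightarrow> 0) (at_right 0)"
    and window: "\<And>M. M > 0 \<Longrightarrow> \<forall>\<^sub>F \<epsilon> in at_right 0. \<forall>t\<in>{r \<epsilon>..r \<epsilon> + M * \<epsilon>}. stripe (t / \<delta> \<epsilon>) = 1"
    using stripe_scales by blast
  have \<delta>1: "((\<lambda>\<epsilon>. \<delta> \<epsilon> / \<epsilon>) \<longlongrightarrow> 0) (at_right 0)"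
    by (rule tendsto_times_ident[OF \<delta>(2)]) (simp add: power2_eq_square)
  have zero: "W (-1) = 0" "W 1 = 0" and W0: "W 0 \<noteq> 0" by (simp_all add: W_zero)
  have \<sigma>: "sigma_W W > 0" by (rule sigma_W_pos[OF W_cont W_nonneg W0])
  let ?\<theta> = "\<lambda>y. stripe (y $ k) * \<theta>' y"
  have mv: "mean_value ?\<theta> = 2" by (rule mean_value_eqI[OF has_mean_value_stripe])
  have ge: "\<theta>' y \<le> ?\<theta> y" for y using \<theta>'_pos[of y] by (simp add: stripe_def)
  have lim: "((\<lambda>\<epsilon>. sigma_cell W q ?\<theta> \<epsilon> (\<delta> \<epsilon>) (axis k 1) (cube \<rho>) / ennreal (\<rho> ^ (CARD('n) - 1))) \<longlongrightarrow> ennreal (sigma_W W)) (at_right 0)"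
    if \<rho>: "\<rho> > 0" for \<rho>
  proof (rule tendsto_ennreal_divideI[OF _ \<sigma>])
    show "\<forall>\<^sub>F \<epsilon> in at_right 0. ennreal (\<rho> ^ (CARD('n) - 1) * c) \<le> sigma_cell W q ?\<theta> \<epsilon> (\<delta> \<epsilon>) (axis k 1) (cube \<rho>)"
      if "c < sigma_W W" for c
      by (rule sigma_cell_lower[OF W_cont W_nonneg zero q_smooth q_top q_bot ge \<delta> \<rho> that])
    show "\<forall>\<^sub>F \<epsilon> in at_right 0. sigma_cell W q ?\<theta> \<epsilon> (\<delta> \<epsilon>) (axis k 1) (cube \<rho>) \<le> ennreal (\<rho> ^ (CARD('n) - 1) * c)"
      if "sigma_W W < c" for c
      by (rule sigma_cell_stripe_upper[OF W_cont W_nonneg zero q_smooth q_range q_top q_bot q_deriv \<delta>(1) \<delta>1 r window \<rho> that])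
  qed (use \<rho> in simp)
  \<comment> \<open>The mean 2 gives the factor \<open>sqrt 2\<close>; positivity of
    \<open>sigma_W W\<close> makes the inequality strict.\<close>
  have "sigma_W W * 1 < sigma_W W * sqrt 2" using \<sigma> by (intro mult_strict_left_mono) auto
  then have bar: "sigma_W W < sigma_bar W ?\<theta>" by (simp add: sigma_bar_def mv)
  have "\<forall>\<rho>>0. \<exists>L. ((\<lambda>\<epsilon>. sigma_cell W q ?\<theta> \<epsilon> (\<delta> \<epsilon>) (axis k 1) (cube \<rho>) / ennreal (\<rho> ^ (CARD('n) - 1))) \<longlongrightarrow> L) (at_right 0)
      \<and> L \<le> ennreal (sigma_W W)"
    using lim by blast
  moreover have "has_mean_value ?\<theta> (mean_value ?\<theta>)" unfolding mv by (rule has_mean_value_stripe)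
  moreover have "\<forall>t. stripe t \<in> {1, 2}" by (simp add: stripe_def)
  moreover have "\<forall>p\<ge>1. besicovitch p (\<lambda>t. complex_of_real (stripe t))" using besicovitch_stripe by blast
  moreover have "\<forall>\<epsilon>>0. \<delta> \<epsilon> > 0" using \<delta>(1) by blast
  ultimately show ?thesis
    unfolding Let_def using \<delta>1 bar by (intro exI[of _ stripe] exI[of _ \<delta>] conjI)
qed

end
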